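(* A. Let $D$ be a square-free positive integer, let $K=\mathbb{Q}(\sqrt{-D})$ with ring of integers $\mathfrak{o}_K$, let $\Gamma_D=\mathrm{PSL}(2,\mathfrak{o}_K)$, and let $\mathcal{O}_D=\mathbb{H}^3/\Gamma_D$ be the associated non-compact arithmetic hyperbolic $3$-orbifold. Then, as $Q\to\infty$, the number of square-rootable (over $\mathbb{Q}$) Salem numbers of degree $4$ which are less than or equal to $Q$ and are generated by $\mathcal{O}_D$ is \[ c\,Q^{1/2}+O(Q^{1/4}), \] where $c=\frac{\pi}{4\sqrt{D}}$ if $D\equiv 1,2 \pmod 4$ and $c=\frac{\pi}{2\sqrt{D}}$ if $D\equiv 3\pmod 4$. B. As $Q\to\infty$, the number of Salem numbers of degree $4$ that are square-rootable over $\mathbb{Q}$ and less than or equal to $Q$ is \[ \frac{4}{3}Q^{3/2}+O(Q). \]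
   Context: A Salem number is a real algebraic integer $\lambda>1$ such that $\lambda^{-1}$ is a Galois conjugate of $\lambda$ and all Galois conjugates of $\lambda$ other than $\lambda$ and $\lambda^{-1}$ have absolute value $1$ (degree $2$ is allowed). Its degree is its degree over $\mathbb{Q}$. Let $\lambda$ be a Salem number, $L$ a subfield of $\mathbb{Q}(\lambda+\lambda^{-1})$, and $p(x)$ the minimal polynomial of $\lambda$ over $L$. Then $\lambda$ is square-rootable over $L$ if there exist a totally positive element $\alpha\in L$ and a monic palindromic polynomial $q(x)$, whose even degree coefficients lie in $L$ and whose odd degree coefficients lie in $\sqrt{\alpha}\,L$, such that $q(x)q(-x)=p(x^2)$. For a discrete group $\Gamma$ of isometries of $\mathbb{H}^3$ and a hyperbolic (equivalently, loxodromic, with non-zero translation length) element $\gamma\in\Gamma$, let $\ell(\gamma)>0$ be its translation length, i.e. the length of the corresponding closed geodesic of $\mathbb{H}^3/\Gamma$. The Salem numbers generated by $\mathcal{O}=\mathbb{H}^3/\Gamma$ are the numbers $\lambda=e^{2\ell(\gamma)}$, $\gamma\in\Gamma$ hyperbolic; they are counted as distinct real numbers (without multiplicity). *)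

theory Defs
  imports
    "HOL-Analysis.Analysis"
    "HOL-Computational_Algebra.Computational_Algebra"
    "HOL-Library.Landau_Symbols"
begin

section \<open>Subfields and minimal polynomials\<close>

definition is_subfield :: "'a::field set \<Rightarrow> bool" where
  "is_subfield F \<longleftrightarrow> 0 \<in> F \<and> 1 \<in> F \<and>
     (\<forall>x\<in>F. \<forall>y\<in>F. x - y \<in> F \<and> x * y \<in> F) \<and> (\<forall>x\<in>F. inverse x \<in> F)"

text \<open>In characteristic 0 every subfield contains \<open>\<rat>\<close>, so this is \<open>\<rat>(S)\<close>.\<close>

definition generated_subfield :: "'a::field_char_0 set \<Rightarrow> 'a set" where
  "generated_subfield S = \<Inter>{F. is_subfield F \<and> S \<subseteq> F}"

definition polys_over :: "'a::field set \<Rightarrow> 'a poly set" where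
  "polys_over L = {p. \<forall>i. coeff p i \<in> L}"

definition is_min_poly :: "'a::field set \<Rightarrow> 'a \<Rightarrow> 'a poly \<Rightarrow> bool" where
  "is_min_poly L x p \<longleftrightarrow>
     p \<in> polys_over L \<and> lead_coeff p = 1 \<and> poly p x = 0 \<and>
     (\<forall>q\<in>polys_over L. q \<noteq> 0 \<and> poly q x = 0 \<longrightarrow> degree p \<le> degree q)"

text \<open>Only meaningful when \<open>x\<close> is algebraic over the subfield \<open>L\<close>.\<close>

definition min_poly :: "'a::field set \<Rightarrow> 'a \<Rightarrow> 'a poly" where
  "min_poly L x = (THE p. is_min_poly L x p)"

lemma is_min_poly_unique:
  assumes "is_subfield L" "is_min_poly L x p" "is_min_poly L x q"
  shows "p = q"
proof (rule ccontr)
  assume "p \<noteq> q"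
  have deg: "degree p = degree q"
    using assms(2,3) by (intro antisym) (auto simp: is_min_poly_def)
  define r where "r = p - q"
  have "r \<noteq> 0" "poly r x = 0"
    using \<open>p \<noteq> q\<close> assms(2,3) by (auto simp: r_def is_min_poly_def)
  moreover have "r \<in> polys_over L"
    using assms by (auto simp: r_def is_min_poly_def polys_over_def is_subfield_def)
  ultimately have le: "degree p \<le> degree r"
    using assms(2) by (auto simp: is_min_poly_def)
  have "degree r \<le> degree p"
    using deg by (simp add: r_def degree_diff_le)
  with le have "degree r = degree p"
    by simp
  hence "lead_coeff r = 0"
    using assms(2,3) deg by (simp add: r_def is_min_poly_def)
  with \<open>r \<noteq> 0\<close> show False
    by simp
qed

lemma min_poly_eqI:
  assumes "is_subfield L" "is_min_poly L x p"
  shows "min_poly L x = p"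
  unfolding min_poly_def using assms is_min_poly_unique by blast


section \<open>Salem numbers\<close>

definition galois_conjugate :: "real \<Rightarrow> complex \<Rightarrow> bool" where
  "galois_conjugate x z \<longleftrightarrow> poly (map_poly complex_of_real (min_poly \<rat> x)) z = 0"

definition algebraic_degree :: "real \<Rightarrow> nat" where
  "algebraic_degree x = degree (min_poly \<rat> x)"

definition salem_number :: "real \<Rightarrow> bool" where
  "salem_number x \<longleftrightarrow> algebraic_int x \<and> x > 1 \<and>
     galois_conjugate x (of_real (inverse x)) \<and>
     (\<forall>z. galois_conjugate x z \<and> z \<noteq> of_real x \<and> z \<noteq> of_real (inverse x) \<longrightarrow> norm z = 1)"


section \<open>Square-rootability\<close>

definition real_embedding :: "real set \<Rightarrow> (real \<Rightarrow> real) \<Rightarrow> bool" where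
  "real_embedding L \<sigma> \<longleftrightarrow> \<sigma> 1 = 1 \<and>
     (\<forall>x\<in>L. \<forall>y\<in>L. \<sigma> (x + y) = \<sigma> x + \<sigma> y \<and> \<sigma> (x * y) = \<sigma> x * \<sigma> y)"

definition totally_positive :: "real set \<Rightarrow> real \<Rightarrow> bool" where
  "totally_positive L a \<longleftrightarrow> a \<in> L \<and> (\<forall>\<sigma>. real_embedding L \<sigma> \<longrightarrow> \<sigma> a > 0)"

text \<open>
  \<open>reflect_poly q\<close> reverses the coefficient list of \<open>q\<close> and strips trailing zeros, so
  \<open>reflect_poly q = q\<close> says that the coefficient list is a palindrome. The polynomials
  \<open>q(-x)\<close> and \<open>p(x\<^sup>2)\<close> are written as compositions with \<open>[:0, -1:]\<close> and \<open>[:0, 0, 1:]\<close>.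
\<close>

definition square_rootable :: "real set \<Rightarrow> real \<Rightarrow> bool" where
  "square_rootable L x \<longleftrightarrow>
     salem_number x \<and> is_subfield L \<and> L \<subseteq> generated_subfield {x + inverse x} \<and>
     (\<exists>\<alpha> q. totally_positive L \<alpha> \<and> lead_coeff q = 1 \<and> reflect_poly q = q \<and>
        (\<forall>i. even i \<longrightarrow> coeff q i \<in> L) \<and>
        (\<forall>i. odd i \<longrightarrow> coeff q i \<in> (\<lambda>y. sqrt \<alpha> * y) ` L) \<and>
        q * pcompose q [:0, -1:] = pcompose (min_poly L x) [:0, 0, 1:])"

lemma is_subfield_Rats: "is_subfield (\<rat> :: 'a::field_char_0 set)"
  by (auto simp: is_subfield_def)

lemma Rats_subset_generated_subfield: "\<rat> \<subseteq> generated_subfield S"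
proof -
  have "r \<in> F" if "r \<in> \<rat>" and F: "is_subfield F" for F :: "'a set" and r
  proof -
    have diff: "x - y \<in> F" and mult: "x * y \<in> F" and inv: "inverse x \<in> F"
      if "x \<in> F" "y \<in> F" for x y
      using F that by (auto simp: is_subfield_def)
    have zero: "0 \<in> F" and one: "1 \<in> F"
      using F by (auto simp: is_subfield_def)
    have uminus: "- x \<in> F" if "x \<in> F" for x
      using diff[OF zero that] by simp
    have add: "x + y \<in> F" if "x \<in> F" "y \<in> F" for x y
      using diff[OF that(1) uminus[OF that(2)]] by simp
    have nat: "of_nat n \<in> F" for n
      by (induction n) (auto intro: zero one add)
    have int: "of_int k \<in> F" for k
      by (cases k) (auto intro!: nat uminus diff one simp del: of_nat_Suc)
    from \<open>r \<in> \<rat>\<close> obtain a b where "r = of_int a / of_int b"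
      by (auto elim: Rats_cases')
    thus ?thesis
      by (auto simp: divide_inverse intro!: mult inv int)
  qed
  thus ?thesis
    by (auto simp: generated_subfield_def)
qed


section \<open>Hyperbolic 3-space\<close>

text \<open>
  The upper half-space model, with the metric of constant curvature \<open>-1\<close>. A matrix of
  determinant 1 acts on it by the Poincare extension of its Moebius transformation.
\<close>

definition hyp3 :: "(complex \<times> real) set" where
  "hyp3 = {(z, t). t > 0}"

definition hyp3_dist :: "complex \<times> real \<Rightarrow> complex \<times> real \<Rightarrow> real" where
  "hyp3_dist = (\<lambda>(z, s) (w, t). arcosh (1 + ((norm (z - w))\<^sup>2 + (s - t)\<^sup>2) / (2 * s * t)))"

definition poincare_extension :: "complex^2^2 \<Rightarrow> complex \<times> real \<Rightarrow> complex \<times> real" where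
  "poincare_extension A = (\<lambda>(z, t).
     let a = A$1$1; b = A$1$2; c = A$2$1; d = A$2$2;
         n = (norm (c * z + d))\<^sup>2 + (norm c)\<^sup>2 * t\<^sup>2
     in (((a * z + b) * cnj (c * z + d) + a * cnj c * of_real (t\<^sup>2)) / of_real n, t / n))"

definition SL2 :: "complex set \<Rightarrow> (complex^2^2) set" where
  "SL2 R = {A. det A = 1 \<and> (\<forall>i j. A$i$j \<in> R)}"

text \<open>
  \<open>PSL(2,R)\<close> is realised as a set of isometries of hyperbolic 3-space. Two matrices in
  \<open>SL(2,R)\<close> give the same isometry iff they agree up to sign, see \<open>poincare_extension_eq_iff\<close>.
\<close>

definition PSL2 :: "complex set \<Rightarrow> (complex \<times> real \<Rightarrow> complex \<times> real) set" where
  "PSL2 R = (\<lambda>A. restrict (poincare_extension A) hyp3) ` SL2 R"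

definition translation_length :: "(complex \<times> real \<Rightarrow> complex \<times> real) \<Rightarrow> real" where
  "translation_length g = (INF x\<in>hyp3. hyp3_dist x (g x))"

definition hyperbolic :: "(complex \<times> real \<Rightarrow> complex \<times> real) \<Rightarrow> bool" where
  "hyperbolic g \<longleftrightarrow> translation_length g > 0"

text \<open>The orbifold \<open>H\<^sup>3/\<Gamma>\<close> is represented by the group \<open>\<Gamma>\<close>.\<close>

definition generated_salem_numbers :: "(complex \<times> real \<Rightarrow> complex \<times> real) set \<Rightarrow> real set" where
  "generated_salem_numbers \<Gamma> = {exp (2 * translation_length g) | g. g \<in> \<Gamma> \<and> hyperbolic g}"

definition ring_of_integers :: "complex set \<Rightarrow> complex set" where
  "ring_of_integers K = {x \<in> K. algebraic_int x}"

definition imag_quadratic_field :: "nat \<Rightarrow> complex set" where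
  "imag_quadratic_field D = generated_subfield {\<i> * of_real (sqrt (real D))}"

lemma denominator_pos:
  assumes "a * d - b * c = (1 :: complex)" "t > 0"
  shows "(norm (c * z + d))\<^sup>2 + (norm c)\<^sup>2 * t\<^sup>2 > 0"
proof (cases "c = 0")
  case True
  with assms show ?thesis by auto
next
  case False
  with assms(2) show ?thesis by (intro add_nonneg_pos) auto
qed

lemma poincare_extension_in_hyp3:
  assumes "det A = 1" "x \<in> hyp3"
  shows "poincare_extension A x \<in> hyp3"
  using assms denominator_pos[of "A$1$1" "A$2$2" "A$1$2" "A$2$1" "snd x" "fst x"]
  by (auto simp: hyp3_def poincare_extension_def det_2 Let_def)

lemma poincare_extension_eq_iff:
  assumes "det A = 1" "det B = 1"
  shows "restrict (poincare_extension A) hyp3 = restrict (poincare_extension B) hyp3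
           \<longleftrightarrow> A = B \<or> A = - B"
proof
  assume "A = B \<or> A = - B"
  moreover have "poincare_extension (- B) = poincare_extension B"
  proof -
    have "norm (- (B$2$1 * z) - B$2$2) = norm (B$2$1 * z + B$2$2)" for z
      by (metis minus_add_distrib norm_minus_cancel uminus_add_conv_diff add.commute)
    thus ?thesis
      by (auto simp: poincare_extension_def Let_def fun_eq_iff algebra_simps)
  qed
  ultimately show "restrict (poincare_extension A) hyp3 = restrict (poincare_extension B) hyp3"
    by auto
next
  assume eq: "restrict (poincare_extension A) hyp3 = restrict (poincare_extension B) hyp3"
  define a b c d where abcd: "a = A$1$1" "b = A$1$2" "c = A$2$1" "d = A$2$2"
  define a' b' c' d' where abcd': "a' = B$1$1" "b' = B$1$2" "c' = B$2$1" "d' = B$2$2"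
  have det: "a * d - b * c = 1" and det': "a' * d' - b' * c' = 1"
    using assms by (auto simp: det_2 abcd abcd')
  define n where "n = (\<lambda>z t. (norm (c * z + d))\<^sup>2 + (norm c)\<^sup>2 * t\<^sup>2)"
  define n' where "n' = (\<lambda>z t. (norm (c' * z + d'))\<^sup>2 + (norm c')\<^sup>2 * t\<^sup>2)"
  have n_pos: "n z t > 0" "n' z t > 0" if "t > 0" for z t
    using denominator_pos[OF det that] denominator_pos[OF det' that] by (auto simp: n_def n'_def)
  have pt: "poincare_extension A (z, t) = poincare_extension B (z, t)" if "t > 0" for z t
    using fun_cong[OF eq, of "(z, t)"] that by (simp add: hyp3_def)
  define m where "m = (\<lambda>z t. (a * z + b) * cnj (c * z + d) + a * cnj c * of_real (t\<^sup>2))"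
  define m' where "m' = (\<lambda>z t. (a' * z + b') * cnj (c' * z + d') + a' * cnj c' * of_real (t\<^sup>2))"
  have ext: "poincare_extension A (z, t) = (m z t / of_real (n z t), t / n z t)"
            "poincare_extension B (z, t) = (m' z t / of_real (n' z t), t / n' z t)" for z t
    unfolding poincare_extension_def Let_def abcd abcd' n_def n'_def m_def m'_def prod.case
    by (rule refl)+
  have pt': "m z t / of_real (n z t) = m' z t / of_real (n' z t)" "t / n z t = t / n' z t"
    if "t > 0" for z t
    using pt[OF that, of z] unfolding ext prod.inject by blast+
  have n_eq: "n z t = n' z t" if "t > 0" for z t
    using pt'(2)[OF that, of z] n_pos[OF that, of z] that by (auto simp: frac_eq_eq)
  have "m z t = m' z t" if "t > 0" for z t
    using pt'(1)[OF that, of z] n_pos[OF that, of z] unfolding n_eq[OF that, of z] by simp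
  hence num: "(a * z + b) * cnj (c * z + d) + a * cnj c * of_real (t\<^sup>2)
           = (a' * z + b') * cnj (c' * z + d') + a' * cnj c' * of_real (t\<^sup>2)" if "t > 0" for z t
    using that by (simp only: m_def m'_def)
  have den: "(c * z + d) * cnj (c * z + d) + c * cnj c * of_real (t\<^sup>2)
           = (c' * z + d') * cnj (c' * z + d') + c' * cnj c' * of_real (t\<^sup>2)" if "t > 0" for z t
  proof -
    have "complex_of_real (n z t) = complex_of_real (n' z t)"
      using n_eq[OF that] by simp
    thus ?thesis
      by (simp only: n_def n'_def of_real_add of_real_mult complex_norm_square)
  qed
  have key: "x * cnj c = x' * cnj c' \<and> x * cnj d = x' * cnj d' \<and>
             y * cnj c = y' * cnj c' \<and> y * cnj d = y' * cnj d'"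
    if H: "\<And>z t. t > 0 \<Longrightarrow> (x * z + y) * cnj (c * z + d) + x * cnj c * of_real (t\<^sup>2)
             = (x' * z + y') * cnj (c' * z + d') + x' * cnj c' * of_real (t\<^sup>2)"
    for x y x' y'
  proof -
    note e = H[of 1 0] H[of 2 0] H[of 1 1] H[of 1 \<i>]
    have yd: "y * cnj d + x * cnj c = y' * cnj d' + x' * cnj c'"
      using e(1) by simp
    have "y * cnj d + 4 * (x * cnj c) = y' * cnj d' + 4 * (x' * cnj c')"
      using e(2) by (simp add: mult_ac)
    with yd have xc: "x * cnj c = x' * cnj c'" and yd': "y * cnj d = y' * cnj d'"
      by algebra+
    have p1: "x * cnj d + y * cnj c = x' * cnj d' + y' * cnj c'"
      using e(3) xc yd' by (simp add: algebra_simps)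
    have "\<i> * (x * cnj d - y * cnj c) = \<i> * (x' * cnj d' - y' * cnj c')"
      using e(4) xc yd' by (simp add: algebra_simps)
    hence p2: "x * cnj d - y * cnj c = x' * cnj d' - y' * cnj c'"
      by simp
    from p1 p2 have "x * cnj d = x' * cnj d'" "y * cnj c = y' * cnj c'"
      by algebra+
    with xc yd' show ?thesis by simp
  qed
  note k1 = key[of a b a' b', OF num] and k2 = key[of c d c' d', OF den]
  define N where "N = c * cnj c + d * cnj d"
  have "N = of_real (n 0 1)"
    unfolding N_def n_def of_real_add of_real_mult complex_norm_square by simp
  hence N0: "N \<noteq> 0"
    using n_pos(1)[of 1 0] by simp
  have N': "N = c' * cnj c' + d' * cnj d'"
    using k2 by (simp add: N_def)
  define w where "w = (cnj c * c' + cnj d * d') / N"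
  have scale: "x' = w * x" if "x * cnj c = x' * cnj c'" "x * cnj d = x' * cnj d'" for x x'
  proof -
    have "x' * N = (x' * cnj c') * c' + (x' * cnj d') * d'"
      by (simp add: N' algebra_simps)
    also have "\<dots> = (w * x) * N"
      unfolding that [symmetric] using N0 by (simp add: w_def field_simps)
    finally show ?thesis
      using N0 by simp
  qed
  have s: "a' = w * a" "b' = w * b" "c' = w * c" "d' = w * d"
    using k1 k2 by (auto intro: scale)
  have "w\<^sup>2 * (a * d - b * c) = 1"
    using det' by (simp add: s power2_eq_square algebra_simps)
  hence "w = 1 \<or> w = -1"
    by (simp add: det power2_eq_1_iff)
  thus "A = B \<or> A = - B"
    using s by (auto simp: vec_eq_iff forall_2 abcd abcd')
qed

end

theory Submission
  imports Defs
begin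

text \<open>
  For a Salem number \<open>x\<close> put \<open>s = \<surd>x + 1/\<surd>x\<close>, so that \<open>x + 1/x = s\<^sup>2 - 2\<close>. Comparing coefficients in
  \<open>q(y) q(-y) = p(y\<^sup>2)\<close> shows that \<open>x\<close> of degree four is square-rootable over \<open>\<rat>\<close> iff \<open>s\<close> is a root of
  \<open>y\<^sup>2 - \<surd>M y + E\<close> with integers \<open>M, E\<close>, where the other root \<open>s'\<close> lies in \<open>(-2, 2)\<close> and \<open>s\<^sup>2\<close> is irrational.
  Each \<open>s\<close> arises from exactly two such equations, with the roots \<open>s, s'\<close> and \<open>s, -s'\<close>; requiring
  \<open>E > 0\<close> selects one. Since \<open>s \<le> \<surd>M \<le> s + 2\<close>, part B counts the lattice points with
  \<open>0 < E < 2 \<surd>M - 4\<close> and \<open>\<surd>M \<le> \<surd>Q + O(1)\<close>, the points with rational \<open>s\<^sup>2\<close> being negligible.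

  A matrix in \<open>SL(2, \<complex>)\<close> with trace \<open>t\<close> has translation length \<open>l\<close> with \<open>4 cosh l = \<bar>t\<bar>\<^sup>2 + \<bar>t\<^sup>2 - 4\<bar>\<close>, so
  \<open>x = exp (2 l)\<close> has \<open>s = 2 cosh l\<close>. For \<open>t = (T + V \<surd>-D) / 2\<close> of norm \<open>N\<close> this \<open>s\<close> is a root of
  \<open>y\<^sup>2 - N y + (T\<^sup>2 - 2 N - 4)\<close>. Hence \<open>x\<close> is square-rootable of degree four iff \<open>s\<close> is irrational, and it
  determines \<open>t\<close> up to signs of \<open>T\<close> and \<open>V\<close>. As \<open>\<bar>N - s\<bar> < 2\<close>, part A counts the integers of \<open>\<rat>(\<surd>-D)\<close>
  in a quarter of a disc of radius \<open>Q\<^sup>1\<^sup>/\<^sup>4 + O(1)\<close>.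
\<close>

section \<open>Translation lengths\<close>

text \<open>Lagrange's identity for the vectors \<open>(b, p * \<tau>)\<close> and
  \<open>(q, c * \<tau>)\<close>: the squared modulus of their Hermitian product is the product of
  the squared lengths minus that of the determinant, and the determinant is
  \<open>- \<tau>\<close>.\<close>

lemma norm_lagrange:
  fixes b c p q :: complex and \<tau> :: real
  assumes "p * q - b * c = 1"
  shows "(norm (b * cnj q + p * cnj c * of_real (\<tau>\<^sup>2)))\<^sup>2
       = ((norm b)\<^sup>2 + (norm p)\<^sup>2 * \<tau>\<^sup>2) * ((norm q)\<^sup>2 + (norm c)\<^sup>2 * \<tau>\<^sup>2) - \<tau>\<^sup>2"
proof -
  have x0: "p * q = 1 + b * c" "cnj p * cnj q = 1 + cnj b * cnj c"
    using assms by (auto simp: algebra_simps simp flip: complex_cnj_mult)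
  have "complex_of_real ((norm (b * cnj q + p * cnj c * of_real (\<tau>\<^sup>2)))\<^sup>2)
       = (b * cnj q + p * cnj c * of_real (\<tau>\<^sup>2)) * (cnj b * q + cnj p * c * of_real (\<tau>\<^sup>2))"
    by (simp only: complex_norm_square) simp
  also have "\<dots> = (b * cnj b + p * cnj p * of_real \<tau> ^ 2) * (q * cnj q + c * cnj c * of_real \<tau> ^ 2)
      - of_real \<tau> ^ 2 * (p * q * (cnj p * cnj q) + b * c * (cnj b * cnj c)
           - p * q * (cnj b * cnj c) - b * c * (cnj p * cnj q))"
    by (simp add: algebra_simps)
  also have "p * q * (cnj p * cnj q) + b * c * (cnj b * cnj c)
           - p * q * (cnj b * cnj c) - b * c * (cnj p * cnj q) = 1"
    unfolding x0 by (simp add: algebra_simps)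
  also have "(b * cnj b + p * cnj p * of_real \<tau> ^ 2) * (q * cnj q + c * cnj c * of_real \<tau> ^ 2)
      - of_real \<tau> ^ 2 * 1 = of_real (((norm b)\<^sup>2 + (norm p)\<^sup>2 * \<tau>\<^sup>2) * ((norm q)\<^sup>2 + (norm c)\<^sup>2 * \<tau>\<^sup>2) - \<tau>\<^sup>2)"
    unfolding of_real_diff of_real_mult of_real_add complex_norm_square by simp
  finally show ?thesis by (simp only: of_real_eq_iff)
qed

text \<open>The numbers \<open>p, u, c, q\<close> are the entries of the conjugate of \<open>A\<close> by the translation \<open>w \<mapsto> w + z\<close>.\<close>

lemma hyp3_dist_poincare_extension:
  fixes A :: "complex^2^2" and z :: complex and t :: real
  defines "a \<equiv> A$1$1" and "b \<equiv> A$1$2" and "c \<equiv> A$2$1" and "d \<equiv> A$2$2"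
  defines "p \<equiv> a - c * z" and "q \<equiv> c * z + d" and "u \<equiv> b + (a - d) * z - c * z\<^sup>2"
  assumes det: "det A = 1" and t: "t > 0"
  shows "hyp3_dist (z, t) (poincare_extension A (z, t))
       = arcosh (((norm p)\<^sup>2 + (norm q)\<^sup>2 + (norm u)\<^sup>2 / t\<^sup>2 + (norm c)\<^sup>2 * t\<^sup>2) / 2)"
proof -
  define n where "n = (norm q)\<^sup>2 + (norm c)\<^sup>2 * t\<^sup>2"
  have det': "a * d - b * c = 1"
    using det by (simp add: det_2 a_def b_def c_def d_def)
  have n: "n > 0"
    using denominator_pos[OF det' t, of z] by (simp add: n_def q_def)
  have pq: "p * q - u * c = 1"
    using det' by (simp add: p_def q_def u_def algebra_simps power2_eq_square)
  define w where "w = ((a * z + b) * cnj q + a * cnj c * of_real (t\<^sup>2)) / of_real n"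
  have ext: "poincare_extension A (z, t) = (w, t / n)"
    unfolding poincare_extension_def Let_def prod.case n_def w_def q_def a_def b_def c_def d_def
    by (rule refl)
  define v where "v = u * cnj q + p * cnj c * of_real (t\<^sup>2)"
  have nc: "complex_of_real n = q * cnj q + c * cnj c * of_real (t\<^sup>2)"
    unfolding n_def of_real_add of_real_mult complex_norm_square by simp
  have num: "(a * z + b) * cnj q + a * cnj c * of_real (t\<^sup>2) - z * of_real n = v"
    unfolding nc v_def p_def u_def q_def by (simp add: algebra_simps power2_eq_square)
  have "z - w = - v / of_real n"
    using n unfolding w_def num[symmetric] by (simp add: field_simps)
  hence "(norm (z - w))\<^sup>2 = (norm v)\<^sup>2 / n\<^sup>2"
    using n by (simp add: norm_divide power_divide)
  also have "(norm v)\<^sup>2 = ((norm u)\<^sup>2 + (norm p)\<^sup>2 * t\<^sup>2) * n - t\<^sup>2"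
    unfolding v_def n_def by (rule norm_lagrange[OF pq])
  finally have nzw: "(norm (z - w))\<^sup>2 = (((norm u)\<^sup>2 + (norm p)\<^sup>2 * t\<^sup>2) * n - t\<^sup>2) / n\<^sup>2" .
  \<comment> \<open>The \<open>- t^2\<close> from \<open>norm_lagrange\<close> cancels the square of
    \<open>t\<close> in \<open>(t - t / n)^2\<close>, and the cross term of that square cancels the
    leading 1.\<close>
  have "1 + ((norm (z - w))\<^sup>2 + (t - t / n)\<^sup>2) / (2 * t * (t / n))
      = ((norm p)\<^sup>2 + n + (norm u)\<^sup>2 / t\<^sup>2) / 2"
    unfolding nzw using n t by (simp add: field_simps power2_eq_square)
  also have "\<dots> = ((norm p)\<^sup>2 + (norm q)\<^sup>2 + (norm u)\<^sup>2 / t\<^sup>2 + (norm c)\<^sup>2 * t\<^sup>2) / 2"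
    by (simp add: n_def)
  finally show ?thesis
    unfolding ext hyp3_dist_def prod.case by (rule arg_cong)
qed

text \<open>This is \<open>2 cosh\<close> of the translation length of a matrix in \<open>SL(2,C)\<close> with trace \<open>t\<close>.\<close>

definition trace_cosh :: "complex \<Rightarrow> real" where
  "trace_cosh t = ((norm t)\<^sup>2 + norm (t\<^sup>2 - 4)) / 2"

lemma trace_cosh_ge_2: "trace_cosh t \<ge> 2"
proof -
  have "norm (t\<^sup>2 - (t\<^sup>2 - 4)) \<le> norm (t\<^sup>2) + norm (t\<^sup>2 - 4)"
    by (rule norm_triangle_ineq4)
  thus ?thesis by (simp add: trace_cosh_def norm_power)
qed

lemma norm_parallelogram:
  fixes p q :: complex
  shows "(norm p)\<^sup>2 + (norm q)\<^sup>2 = ((norm (p + q))\<^sup>2 + (norm (p - q))\<^sup>2) / 2"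
  unfolding cmod_power2 by (simp add: power2_eq_square algebra_simps)

text \<open>The discriminant splits as \<open>(p + q)^2 - 4 = (p - q)^2 + 4 * u * c\<close>. The
  triangle inequality, the parallelogram law and the arithmetic-geometric mean inequality for
  \<open>norm u / t\<close> and \<open>norm c * t\<close> then bound every displacement from
  below.\<close>

lemma trace_cosh_le:
  assumes "p * q - u * c = 1" "t > (0::real)"
  shows "trace_cosh (p + q) \<le> (norm p)\<^sup>2 + (norm q)\<^sup>2 + (norm u)\<^sup>2 / t\<^sup>2 + (norm c)\<^sup>2 * t\<^sup>2"
proof -
  have "(p + q)\<^sup>2 - 4 = (p - q)\<^sup>2 + 4 * (u * c)"
    using assms(1) by (simp add: power2_eq_square algebra_simps)
  hence "norm ((p + q)\<^sup>2 - 4) \<le> (norm (p - q))\<^sup>2 + 4 * (norm u * norm c)"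
    using norm_triangle_ineq[of "(p - q)\<^sup>2" "4 * (u * c)"] by (simp add: norm_power norm_mult)
  moreover have "2 * (norm u * norm c) \<le> (norm u)\<^sup>2 / t\<^sup>2 + (norm c)\<^sup>2 * t\<^sup>2"
    using sum_squares_bound[of "norm u / t" "norm c * t"] assms(2)
    by (simp add: power_mult_distrib power_divide)
  ultimately show ?thesis
    using norm_parallelogram[of p q] by (simp add: trace_cosh_def field_simps)
qed

text \<open>The bound of \<open>trace_cosh_le\<close> is approached where its inequalities are
  almost equalities. A margin \<open>\<epsilon>\<close> is allowed because the infimum need not be
  attained, for instance by parabolic elements.\<close>

lemma approximate_trace_cosh:
  fixes A :: "complex^2^2"
  defines "a \<equiv> A$1$1" and "b \<equiv> A$1$2" and "c \<equiv> A$2$1" and "d \<equiv> A$2$2"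
  assumes det: "det A = 1" and e: "\<epsilon> > 0"
  obtains z and t :: real where "t > 0"
    "(norm (a - c * z))\<^sup>2 + (norm (c * z + d))\<^sup>2 + (norm (b + (a - d) * z - c * z\<^sup>2))\<^sup>2 / t\<^sup>2 + (norm c)\<^sup>2 * t\<^sup>2
       \<le> trace_cosh (a + d) + \<epsilon>"
proof -
  have det': "a * d - b * c = 1"
    using det by (simp add: det_2 a_def b_def c_def d_def)
  show thesis
  proof (cases "c = 0")
    case False
    \<comment> \<open>The midpoint of the two fixed points makes \<open>p\<close> and
      \<open>q\<close> equal. The height with \<open>t^2 = norm u / norm c\<close> would balance the
      last two terms; the extra \<open>\<epsilon>\<close> keeps it positive when
      \<open>u = 0\<close>.\<close>
    define z where "z = (a - d) / (2 * c)"
    define u where "u = b + (a - d) * z - c * z\<^sup>2"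
    define t where "t = sqrt ((norm u + \<epsilon> / norm c) / norm c)"
    have nc: "norm c > 0" using False by simp
    have t2: "t\<^sup>2 = (norm u + \<epsilon> / norm c) / norm c" and t: "t > 0"
      unfolding t_def using e nc by (auto intro!: divide_pos_pos add_nonneg_pos)
    have cz: "c * z = (a - d) / 2"
      using False by (simp add: z_def)
    have p: "a - c * z = (a + d) / 2" and q: "c * z + d = (a + d) / 2"
      unfolding cz by (simp_all add: field_simps)
    have "4 * (c * u) = 4 * (b * c) + 4 * (a - d) * (c * z) - 4 * (c * z)\<^sup>2"
      by (simp add: u_def power2_eq_square algebra_simps)
    also have "\<dots> = (a + d)\<^sup>2 - 4"
      unfolding cz using det' by (simp add: power2_eq_square field_simps)
    finally have cu: "norm ((a + d)\<^sup>2 - 4) = 4 * (norm c * norm u)"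
      by (metis norm_mult norm_numeral)
    define x where "x = norm u + \<epsilon> / norm c"
    have x: "x > 0" "x \<ge> norm u" using e nc by (auto simp: x_def intro: add_nonneg_pos)
    have "(norm u)\<^sup>2 / t\<^sup>2 = norm u * norm c * (norm u / x)"
      unfolding t2 x_def[symmetric] power2_eq_square[of "norm u"] by simp
    also have "\<dots> \<le> norm u * norm c * 1"
      using x by (intro mult_left_mono) auto
    finally have 1: "(norm u)\<^sup>2 / t\<^sup>2 \<le> norm c * norm u" by (simp add: mult.commute)
    have 2: "(norm c)\<^sup>2 * t\<^sup>2 = norm c * norm u + \<epsilon>"
      using nc by (subst t2) (simp add: power2_eq_square field_simps)
    have 3: "(norm ((a + d) / 2))\<^sup>2 = (norm (a + d))\<^sup>2 / 4"
      by (simp add: norm_divide power_divide)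
    have arith: "X1 + X1 + X2 + X3 \<le> (Y + Z) / 2 + \<epsilon>"
      if "X2 \<le> k" "X3 = k + \<epsilon>" "X1 = Y / 4" "Z = 4 * k" for X1 X2 X3 Y Z k :: real
      using that by simp
    show thesis
      by (rule that[OF t, of z], unfold p q u_def[symmetric] trace_cosh_def)
         (rule arith[OF 1 2 3 cu])
  next
    case True
    \<comment> \<open>For \<open>a \<noteq> d\<close> this is the finite fixed point, where
      \<open>u\<close> vanishes. For \<open>a = d\<close> the map is a Euclidean translation, whose
      displacement tends to 0 as the height grows.\<close>
    define z where "z = (if a = d then 0 else - b / (a - d))"
    define u where "u = b + (a - d) * z - c * z\<^sup>2"
    have "norm ((a + d)\<^sup>2 - 4) = (norm (a - d))\<^sup>2"
    proof -
      have "(a + d)\<^sup>2 - 4 = (a - d)\<^sup>2"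
        using det' True by (simp add: power2_eq_square algebra_simps)
      thus ?thesis by (simp add: norm_power)
    qed
    hence tc: "trace_cosh (a + d) = (norm a)\<^sup>2 + (norm d)\<^sup>2"
      unfolding norm_parallelogram[of a d] by (simp add: trace_cosh_def)
    define t where "t = sqrt (((norm u)\<^sup>2 + 1) / \<epsilon>)"
    have t2: "t\<^sup>2 = ((norm u)\<^sup>2 + 1) / \<epsilon>" and t: "t > 0"
      using e by (auto simp: t_def intro!: divide_pos_pos add_nonneg_pos)
    have "(norm u)\<^sup>2 / t\<^sup>2 = \<epsilon> * ((norm u)\<^sup>2 / ((norm u)\<^sup>2 + 1))"
      using e by (simp add: t2)
    also have "\<dots> \<le> \<epsilon> * 1"
    proof (intro mult_left_mono)
      have "x / (x + 1) \<le> 1" if "x \<ge> 0" for x :: real using that by simp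
      from this[OF zero_le_power2[of "norm u"]] show "(norm u)\<^sup>2 / ((norm u)\<^sup>2 + 1) \<le> 1" .
    qed (use e in auto)
    finally have "(norm u)\<^sup>2 / t\<^sup>2 \<le> \<epsilon>" by simp
    thus thesis
      by (intro that[OF t, of z], unfold u_def[symmetric]) (simp add: True tc)
  qed
qed

section \<open>The infimum of the displacement function\<close>

lemma arcosh_real_mono: "1 \<le> x \<Longrightarrow> x \<le> y \<Longrightarrow> arcosh x \<le> arcosh (y :: real)"
  by (cases "x = y") (auto intro!: less_imp_le arcosh_real_strict_mono)

lemma arcosh_le_add:
  assumes "x \<ge> (1::real)" "\<epsilon> > 0"
  obtains \<delta> where "\<delta> > 0" "\<And>y. y \<le> x + \<delta> \<Longrightarrow> 1 \<le> y \<Longrightarrow> arcosh y \<le> arcosh x + \<epsilon>"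
proof
  define \<delta> where "\<delta> = cosh (arcosh x + \<epsilon>) - x"
  have "cosh (arcosh x) < cosh (arcosh x + \<epsilon>)"
    using assms by (intro cosh_real_strict_mono) auto
  thus "\<delta> > 0" using assms by (simp add: \<delta>_def)
  fix y assume y: "y \<le> x + \<delta>" "1 \<le> y"
  hence "arcosh y \<le> arcosh (cosh (arcosh x + \<epsilon>))"
    using assms by (intro arcosh_real_mono) (auto simp: \<delta>_def)
  also have "\<dots> = arcosh x + \<epsilon>"
    using assms by (intro arcosh_cosh_real) auto
  finally show "arcosh y \<le> arcosh x + \<epsilon>" .
qed

lemma translation_length_SL2:
  fixes A :: "complex^2^2"
  assumes det: "det A = 1"
  shows "translation_length (restrict (poincare_extension A) hyp3) = arcosh (trace_cosh (trace A) / 2)"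
proof -
  define a b c d where abcd: "a = A$1$1" "b = A$1$2" "c = A$2$1" "d = A$2$2"
  have det': "a * d - b * c = 1"
    using det by (simp add: det_2 abcd)
  have tr: "trace A = a + d"
    by (simp add: trace_def sum_2 abcd)
  define F where "F = (\<lambda>z (t::real). (norm (a - c * z))\<^sup>2 + (norm (c * z + d))\<^sup>2
     + (norm (b + (a - d) * z - c * z\<^sup>2))\<^sup>2 / t\<^sup>2 + (norm c)\<^sup>2 * t\<^sup>2)"
  have F: "hyp3_dist (z, t) (poincare_extension A (z, t)) = arcosh (F z t / 2)" if "t > 0" for z t
    using hyp3_dist_poincare_extension[OF det that, of z] by (simp add: F_def abcd)
  have lower: "trace_cosh (trace A) \<le> F z t" if "t > 0" for z t
    using trace_cosh_le[of "a - c * z" "c * z + d" "b + (a - d) * z - c * z\<^sup>2" c t] that det'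
    by (simp add: F_def tr algebra_simps power2_eq_square)
  have ge1: "trace_cosh (trace A) / 2 \<ge> 1"
    using trace_cosh_ge_2[of "trace A"] by simp
  show ?thesis
    unfolding translation_length_def
  proof (rule cInf_eq_non_empty)
    have "(0, 1) \<in> hyp3" by (simp add: hyp3_def)
    thus "(\<lambda>x. hyp3_dist x (restrict (poincare_extension A) hyp3 x)) ` hyp3 \<noteq> {}" by blast
  next
    fix y assume "y \<in> (\<lambda>x. hyp3_dist x (restrict (poincare_extension A) hyp3 x)) ` hyp3"
    then obtain z t where zt: "t > 0" "y = arcosh (F z t / 2)"
      by (auto simp: hyp3_def F)
    thus "arcosh (trace_cosh (trace A) / 2) \<le> y"
      using lower[OF zt(1), of z] ge1 by (auto intro!: arcosh_real_mono)
  next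
    fix y assume y: "\<And>x. x \<in> (\<lambda>x. hyp3_dist x (restrict (poincare_extension A) hyp3 x)) ` hyp3 \<Longrightarrow> y \<le> x"
    have y': "y \<le> arcosh (F z t / 2)" if "t > 0" for z t
      by (rule y, rule image_eqI[of _ _ "(z, t)"]) (use that F[OF that, of z] in \<open>auto simp: hyp3_def\<close>)
    show "y \<le> arcosh (trace_cosh (trace A) / 2)"
    proof (rule field_le_epsilon)
      fix \<epsilon> :: real assume "\<epsilon> > 0"
      from arcosh_le_add[OF ge1 this] obtain \<delta> where \<delta>: "\<delta> > 0"
        "\<And>y. y \<le> trace_cosh (trace A) / 2 + \<delta> \<Longrightarrow> 1 \<le> y \<Longrightarrow> arcosh y \<le> arcosh (trace_cosh (trace A) / 2) + \<epsilon>"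
        by blast
      from \<delta>(1) have "2 * \<delta> > 0" by simp
      from approximate_trace_cosh[OF det this] obtain z t where
        zt: "t > 0" "F z t \<le> trace_cosh (trace A) + 2 * \<delta>"
        unfolding F_def tr abcd by metis
      have "arcosh (F z t / 2) \<le> arcosh (trace_cosh (trace A) / 2) + \<epsilon>"
        using zt lower[OF zt(1), of z] ge1 by (intro \<delta>(2)) auto
      with y'[OF zt(1), of z] show "y \<le> arcosh (trace_cosh (trace A) / 2) + \<epsilon>" by linarith
    qed
  qed
qed

section \<open>Minimal polynomials over the rationals\<close>

text \<open>An annihilating polynomial of least degree, made monic, supplies the existence that the
  \<open>THE\<close> in \<open>min_poly\<close> requires; uniqueness is
  \<open>is_min_poly_unique\<close>.\<close>

lemma is_min_poly_min_poly:
  assumes L: "is_subfield L" and "r \<in> polys_over L" "r \<noteq> 0" "poly r x = 0"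
  shows "is_min_poly L x (min_poly L x)"
proof -
  define P where "P = (\<lambda>r. r \<in> polys_over L \<and> r \<noteq> 0 \<and> poly r x = 0)"
  have "P r" using assms by (simp add: P_def)
  then obtain p where p: "P p" "\<And>q. P q \<Longrightarrow> degree p \<le> degree q"
    using ex_has_least_nat[of P r degree] by blast
  define p' where "p' = smult (inverse (lead_coeff p)) p"
  have nz: "lead_coeff p \<noteq> 0" using p(1) by (simp add: P_def)
  have "is_min_poly L x p'"
    unfolding is_min_poly_def
  proof (intro conjI ballI impI)
    show "p' \<in> polys_over L"
      using p(1) L by (auto simp: P_def p'_def polys_over_def is_subfield_def)
    show "lead_coeff p' = 1" "poly p' x = 0"
      using p(1) nz by (simp_all add: p'_def P_def)
    fix q assume "q \<in> polys_over L" "q \<noteq> 0 \<and> poly q x = 0"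
    thus "degree p' \<le> degree q"
      using p(2)[of q] nz by (simp add: p'_def P_def)
  qed
  thus ?thesis using min_poly_eqI[OF L] by simp
qed

section \<open>Integrality of minimal polynomials\<close>

lemma poly_map_of_int_add:
  "poly (map_poly (of_int :: int \<Rightarrow> 'a::comm_ring_1) (p + q)) x = poly (map_poly of_int p) x + poly (map_poly of_int q) x"
  by (induction p q rule: poly_induct2) (simp_all add: map_poly_pCons algebra_simps)

lemma poly_map_of_int_smult:
  "poly (map_poly (of_int :: int \<Rightarrow> 'a::comm_ring_1) (smult c p)) x = of_int c * poly (map_poly of_int p) x"
  by (induction p) (simp_all add: map_poly_pCons algebra_simps)

lemma poly_map_of_int_mult:
  "poly (map_poly (of_int :: int \<Rightarrow> 'a::comm_ring_1) (p * q)) x = poly (map_poly of_int p) x * poly (map_poly of_int q) x"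
  by (induction p) (simp_all add: map_poly_pCons poly_map_of_int_add poly_map_of_int_smult algebra_simps)

lemma common_denominator:
  fixes p :: "'a::field_char_0 poly"
  assumes "p \<in> polys_over \<rat>"
  obtains c :: int and f where "c \<noteq> 0" "map_poly of_int f = smult (of_int c) p"
proof -
  have "\<exists>c::int. c \<noteq> 0 \<and> of_int c * coeff p i \<in> \<int>" for i
  proof -
    have "coeff p i \<in> \<rat>" using assms by (simp add: polys_over_def)
    then obtain a b where "b > 0" "coeff p i = of_int a / of_int b"
      by (auto elim: Rats_cases')
    thus ?thesis by (intro exI[of _ b]) auto
  qed
  then obtain d :: "nat \<Rightarrow> int" where d: "\<And>i. d i \<noteq> 0" "\<And>i. of_int (d i) * coeff p i \<in> \<int>"
    by metis
  define c where "c = (\<Prod>i\<le>degree p. d i)"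
  have int: "of_int c * coeff p i \<in> \<int>" for i
  proof (cases "i \<le> degree p")
    case True
    hence "c = d i * (\<Prod>j\<in>{..degree p} - {i}. d j)"
      unfolding c_def by (subst prod.remove[of _ i]) auto
    hence "of_int c * coeff p i = (of_int (d i) * coeff p i) * of_int (\<Prod>j\<in>{..degree p} - {i}. d j)"
      by simp
    thus ?thesis using d(2)[of i] by (metis Ints_mult Ints_of_int)
  qed (simp add: coeff_eq_0)
  \<comment> \<open>A left inverse of \<open>of_int\<close>. It satisfies \<open>g 0 = 0\<close>, so
    \<open>map_poly g\<close> acts coefficientwise.\<close>
  define g where "g = (\<lambda>y::'a. if y \<in> \<int> then THE k. y = of_int k else 0)"
  have g: "g (of_int k) = k" for k
    by (simp add: g_def)
  have "map_poly of_int (map_poly g (smult (of_int c) p)) = smult (of_int c) p"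
  proof (rule poly_eqI)
    fix i
    have "g 0 = 0" using g[of 0] by simp
    moreover obtain k where "of_int c * coeff p i = of_int k"
      using int[of i] by (auto elim: Ints_cases)
    ultimately show "coeff (map_poly of_int (map_poly g (smult (of_int c) p))) i = coeff (smult (of_int c) p) i"
      by (simp add: coeff_map_poly g)
  qed
  moreover have "c \<noteq> 0" using d by (simp add: c_def)
  ultimately show thesis using that by blast
qed

text \<open>Gauss's lemma: a primitive integer multiple \<open>f\<close> of the minimal polynomial divides the given
  monic integer polynomial over the integers, so its leading coefficient is a unit.\<close>

lemma coeff_min_poly_algebraic_int:
  fixes x :: "'a::field_char_0"
  assumes "algebraic_int x"
  shows "coeff (min_poly \<rat> x) i \<in> \<int>"
proof -
  obtain P where P: "poly (map_poly of_int P) x = 0" "lead_coeff P = (1::int)"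
    using assms unfolding algebraic_int_altdef_ipoly by blast
  define p where "p = min_poly \<rat> x"
  have "P \<noteq> 0" using P(2) by auto
  hence "map_poly of_int P \<noteq> (0 :: 'a poly)"
    by (metis coeff_0 coeff_map_poly leading_coeff_0_iff of_int_0 of_int_eq_iff)
  hence p: "is_min_poly \<rat> x p"
    unfolding p_def using P
    by (intro is_min_poly_min_poly[of _ "map_poly of_int P"] is_subfield_Rats)
       (auto simp: polys_over_def coeff_map_poly)
  have p': "p \<in> polys_over \<rat>" "lead_coeff p = 1" "poly p x = 0"
    "\<And>q. q \<in> polys_over \<rat> \<Longrightarrow> q \<noteq> 0 \<Longrightarrow> poly q x = 0 \<Longrightarrow> degree p \<le> degree q"
    using p by (auto simp: is_min_poly_def)
  obtain c f0 where f0: "c \<noteq> (0::int)" "map_poly of_int f0 = smult (of_int c) p"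
    using common_denominator[OF p'(1)] by blast
  have "smult (of_int c) p \<noteq> 0"
    using f0(1) p'(2) by auto
  hence f0nz: "f0 \<noteq> 0"
    using f0(2) by auto
  define f where "f = primitive_part f0"
  have f: "f0 = smult (content f0) f" and cf: "content f = 1"
    using f0nz by (simp_all add: f_def)
  have coeff_f: "of_int (content f0) * of_int (coeff f i) = (of_int c * coeff p i :: 'a)" for i
  proof -
    have "(of_int (coeff f0 i) :: 'a) = of_int c * coeff p i"
      using f0(2) by (metis coeff_map_poly coeff_smult of_int_0)
    thus ?thesis using f by (metis coeff_smult of_int_mult)
  qed
  have cnz: "content f0 \<noteq> 0" using f0nz by simp
  have coeff_f_0: "coeff f i = 0 \<longleftrightarrow> coeff p i = 0" for i
    using coeff_f[of i] cnz f0(1) by auto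
  have deg: "degree f = degree p"
  proof (rule antisym)
    show "degree f \<le> degree p" by (rule degree_le) (use coeff_f_0 coeff_eq_0[of p] in blast)
    show "degree p \<le> degree f" by (rule degree_le) (use coeff_f_0 coeff_eq_0[of f] in blast)
  qed
  have fnz: "f \<noteq> 0" using cf by auto
  have fx: "poly (map_poly of_int f) x = 0"
  proof -
    have "of_int (content f0) * poly (map_poly of_int f) x = poly (map_poly of_int f0) x"
      by (subst (2) f) (rule poly_map_of_int_smult[symmetric])
    also have "\<dots> = 0" using f0(2) p'(3) by simp
    finally show ?thesis using cnz by simp
  qed
  \<comment> \<open>Division of \<open>P\<close> by \<open>f\<close> within the integers costs the
    factor \<open>l\<close>. The remainder vanishes at \<open>x\<close> and has degree below that of
    \<open>p\<close>, so it is 0 by minimality.\<close>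
  obtain q r where qr: "pseudo_divmod P f = (q, r)" by fastforce
  define l where "l = lead_coeff f ^ (Suc (degree P) - degree f)"
  have Pf: "smult l P = f * q + r" and r: "r = 0 \<or> degree r < degree f"
    using pseudo_divmod[OF fnz qr] by (simp_all add: l_def)
  have rx: "poly (map_poly of_int r) x = 0"
    using arg_cong[OF Pf, of "\<lambda>p. poly (map_poly of_int p) x"] P(1) fx
    by (simp add: poly_map_of_int_add poly_map_of_int_mult poly_map_of_int_smult)
  have "r = 0"
  proof (rule ccontr)
    assume "r \<noteq> 0"
    have "degree p \<le> degree (map_poly of_int r :: 'a poly)"
    proof (rule p'(4))
      show "map_poly of_int r \<noteq> (0 :: 'a poly)"
        using \<open>r \<noteq> 0\<close> by (metis coeff_0 coeff_map_poly leading_coeff_0_iff of_int_0 of_int_eq_iff)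
    qed (use rx in \<open>auto simp: polys_over_def coeff_map_poly\<close>)
    also have "\<dots> \<le> degree r" by (rule map_poly_degree_leq)
    finally show False using r \<open>r \<noteq> 0\<close> deg by simp
  qed
  have lnz: "l \<noteq> 0" using fnz by (simp add: l_def)
  have "content P dvd 1" using content_dvd_coeff[of P "degree P"] P(2) by simp
  hence "content P = 1" by (simp only: is_unit_content_iff)
  \<comment> \<open>As \<open>P\<close> and \<open>f\<close> have content 1, the factor
    \<open>l\<close> is the content of \<open>q\<close> up to sign and can be cancelled.\<close>
  hence "content q = normalize l"
    using arg_cong[OF Pf, of content] \<open>r = 0\<close> cf by (simp add: content_mult)
  hence "[:l:] dvd q" by (simp add: const_poly_dvd_iff_dvd_content)
  then obtain q' where "q = smult l q'" by (auto elim!: dvdE)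
  hence "smult l P = smult l (f * q')" using Pf \<open>r = 0\<close> by simp
  hence "smult l (P - f * q') = 0" by (simp add: smult_diff_right)
  hence "P = f * q'" using lnz by simp
  define k where "k = lead_coeff f"
  have "lead_coeff P = k * lead_coeff q'"
    unfolding k_def \<open>P = f * q'\<close> by (rule lead_coeff_mult)
  hence "k dvd 1" using P(2) by (metis dvd_triv_left)
  hence "\<bar>k\<bar> = 1" by (simp only: zdvd1_eq)
  hence k: "k * k = 1" by (metis abs_mult_self_eq mult_1)
  have c: "of_int c = (of_int (content f0) * of_int k :: 'a)"
    using coeff_f[of "degree p"] p'(2) deg by (simp add: k_def)
  have "of_int (content f0) * of_int (coeff f i) = of_int (content f0) * (of_int k * coeff p i)"
    unfolding coeff_f c by (simp only: mult.assoc)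
  hence "of_int (coeff f i) = of_int k * coeff p i"
    using cnz by (simp only: mult_cancel_left of_int_eq_0_iff simp_thms)
  hence "of_int (k * coeff f i) = of_int (k * k) * coeff p i"
    by (simp only: of_int_mult mult.assoc)
  hence "coeff p i = of_int (k * coeff f i)"
    unfolding k by simp
  thus ?thesis unfolding p_def by (simp only: Ints_of_int)
qed

lemma poly_eq_degree_le_4:
  assumes "degree p \<le> 4"
  shows "p = [:coeff p 0, coeff p 1, coeff p 2, coeff p 3, coeff p 4:]"
proof (rule poly_eqI)
  fix i show "coeff p i = coeff [:coeff p 0, coeff p 1, coeff p 2, coeff p 3, coeff p 4:] i"
  proof (cases "i \<le> 4")
    case True
    hence "i \<in> {0, 1, 2, 3, 4}" by auto
    thus ?thesis by (auto simp: numeral_eq_Suc)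
  next
    case False
    hence "coeff p i = 0" using assms by (intro coeff_eq_0) auto
    thus ?thesis using False by (auto simp: coeff_pCons split: nat.split)
  qed
qed

lemma rational_root_monic_quadratic_int:
  fixes y :: real
  assumes "y \<in> \<rat>" "y\<^sup>2 + a * y + b = 0" "a \<in> \<int>" "b \<in> \<int>"
  shows "y \<in> \<int>"
proof (rule rational_algebraic_int_is_int[OF _ assms(1)])
  show "algebraic_int y"
  proof (rule algebraic_int.intros[of "[:b, a, 1:]"])
    show "\<forall>i. coeff [:b, a, 1:] i \<in> \<int>" using assms by (auto simp: coeff_pCons split: nat.split)
    show "poly [:b, a, 1:] y = 0" using assms(2) by (simp add: power2_eq_square algebra_simps)
  qed auto
qed

section \<open>Salem numbers of degree four\<close>

definition sqrt_trace :: "real \<Rightarrow> real" where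
  "sqrt_trace x = sqrt x + 1 / sqrt x"

lemma sqrt_trace_square: "x > 0 \<Longrightarrow> (sqrt_trace x)\<^sup>2 = x + 1 / x + 2"
  by (simp add: sqrt_trace_def power2_sum power_divide)

lemma sqrt_trace_root: "x > 0 \<Longrightarrow> x\<^sup>2 + (2 - (sqrt_trace x)\<^sup>2) * x + 1 = 0"
  by (subst sqrt_trace_square) (simp_all add: field_simps power2_eq_square)

lemma sqrt_trace_gt_2: "x > 1 \<Longrightarrow> sqrt_trace x > 2"
proof -
  assume x: "x > 1"
  have "x + 1 / x - 2 = (x - 1)\<^sup>2 / x"
    using x by (simp add: power2_eq_square field_simps)
  also have "\<dots> > 0" using x by simp
  finally have "(sqrt_trace x)\<^sup>2 > 2\<^sup>2"
    unfolding sqrt_trace_square[OF less_trans[OF zero_less_one x]] by simp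
  moreover have "sqrt_trace x > 0" using x by (simp add: sqrt_trace_def add_pos_pos)
  ultimately show ?thesis by (rule power2_less_imp_less[OF _ less_imp_le])
qed

text \<open>The product of \<open>y^2 + (2 - A) * y + 1\<close> and
  \<open>y^2 + (2 - B) * y + 1\<close>: its roots form reciprocal pairs with sums
  \<open>A - 2\<close> and \<open>B - 2\<close>. The shift by 2 makes \<open>A\<close> and
  \<open>B\<close> the squares of \<open>s\<close> and \<open>s'\<close>.\<close>

definition salem_quartic :: "real \<Rightarrow> real \<Rightarrow> real poly" where
  "salem_quartic A B = [:1, 4 - A - B, 6 - 2 * A - 2 * B + A * B, 4 - A - B, 1:]"

lemma poly_salem_quartic:
  "poly (map_poly of_real (salem_quartic A B)) (z :: 'a::{real_algebra_1, field}) =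
     (z\<^sup>2 + (2 - of_real A) * z + 1) * (z\<^sup>2 + (2 - of_real B) * z + 1)"
  by (simp add: salem_quartic_def map_poly_pCons algebra_simps power2_eq_square)

lemma poly_salem_quartic_real:
  "poly (salem_quartic A B) z = (z\<^sup>2 + (2 - A) * z + 1) * (z\<^sup>2 + (2 - B) * z + 1)"
  by (simp add: salem_quartic_def algebra_simps power2_eq_square)

section \<open>From square-rootability to a pair of roots\<close>

definition square_rootable_salem4 :: "real \<Rightarrow> bool" where
  "square_rootable_salem4 x \<longleftrightarrow> salem_number x \<and> algebraic_degree x = 4 \<and> square_rootable \<rat> x"

text \<open>The polynomial \<open>q\<close> is \<open>[:1, c, d, c, 1:]\<close>. With
  \<open>m = c^2\<close>, \<open>e = d - 2\<close> and \<open>A = s^2\<close>, the equation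
  \<open>p(x) = 0\<close> divided by \<open>x^2\<close> becomes \<open>(A + e)^2 = m * A\<close>.
  Its other root is \<open>B = m - 2 * e - A\<close>, with \<open>A * B = e^2\<close>.\<close>

lemma square_rootable_min_poly:
  assumes "square_rootable \<rat> x" "algebraic_degree x = 4"
  obtains m e :: int where
    "min_poly \<rat> x = salem_quartic ((sqrt_trace x)\<^sup>2) (of_int m - 2 * of_int e - (sqrt_trace x)\<^sup>2)"
    "(sqrt_trace x)\<^sup>2 * (of_int m - 2 * of_int e - (sqrt_trace x)\<^sup>2) = (of_int e)\<^sup>2"
proof -
  define p where "p = min_poly \<rat> x"
  have x: "algebraic_int x" "x > 1"
    using assms by (auto simp: square_rootable_def salem_number_def)
  have int: "coeff p i \<in> \<int>" for i
    unfolding p_def by (rule coeff_min_poly_algebraic_int[OF x(1)])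
  have pm: "is_min_poly \<rat> x p"
    unfolding p_def using x(1)
    by (elim algebraic_int.cases) (rule is_min_poly_min_poly[OF is_subfield_Rats], auto simp: polys_over_def intro: Ints_subset_Rats[THEN subsetD])
  have dp: "degree p = 4" using assms(2) by (simp add: p_def algebraic_degree_def)
  obtain \<alpha> q where q: "totally_positive \<rat> \<alpha>" "lead_coeff q = 1" "reflect_poly q = q"
     "\<And>i. even i \<Longrightarrow> coeff q i \<in> \<rat>" "\<And>i. odd i \<Longrightarrow> coeff q i \<in> (\<lambda>y. sqrt \<alpha> * y) ` \<rat>"
     "q * pcompose q [:0, -1:] = pcompose p [:0, 0, 1:]"
    using assms(1) by (auto simp: square_rootable_def p_def)
  \<comment> \<open>The identity embedding turns total positivity into \<open>\<alpha> > 0\<close>,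
    so that the square of \<open>sqrt \<alpha>\<close> is the rational number
    \<open>\<alpha>\<close>.\<close>
  have "real_embedding \<rat> id" by (simp add: real_embedding_def)
  hence \<alpha>: "\<alpha> > 0" "\<alpha> \<in> \<rat>" using q(1) by (auto simp: totally_positive_def)
  have qnz: "q \<noteq> 0" using q(2) by auto
  have dq: "degree q = 4"
  proof -
    have "pcompose q [:0, -1:] \<noteq> 0" using qnz by (simp add: pcompose_eq_0_iff)
    hence "degree (q * pcompose q [:0, -1:]) = 2 * degree q"
      using qnz by (simp add: degree_mult_eq degree_pcompose)
    thus ?thesis unfolding q(6) using dp by (simp add: degree_pcompose)
  qed
  have refl: "coeff q (4 - i) = coeff q i" if "i \<le> 4" for i
    using that q(3) dq coeff_reflect_poly[of q i] by simp
  define c d where "c = coeff q 1" and "d = coeff q 2"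
  have q_eq: "q = [:1, c, d, c, 1:]"
    using poly_eq_degree_le_4[of q] refl[of 0] refl[of 1] q(2) dq by (simp add: c_def d_def)
  have p_eq: "p = [:coeff p 0, coeff p 1, coeff p 2, coeff p 3, coeff p 4:]"
    by (rule poly_eq_degree_le_4) (simp add: dp)
  define p0 p1 p2 p3 p4 where ps: "p0 = coeff p 0" "p1 = coeff p 1" "p2 = coeff p 2" "p3 = coeff p 3" "p4 = coeff p 4"
  have p_eq: "p = [:p0, p1, p2, p3, p4:]"
    unfolding ps by (rule p_eq)
  have coeffs: "p0 = 1" "p1 = 2 * d - c\<^sup>2" "p2 = d\<^sup>2 + 2 - 2 * c\<^sup>2" "p3 = 2 * d - c\<^sup>2" "p4 = 1"
    using q(6) unfolding p_eq q_eq by (simp_all add: pcompose_pCons power2_eq_square algebra_simps)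
  have d: "d \<in> \<rat>" using q(4)[of 2] by (simp add: d_def)
  have c2: "c\<^sup>2 \<in> \<rat>"
  proof -
    obtain y where "y \<in> \<rat>" "c = sqrt \<alpha> * y" using q(5)[of 1] by (auto simp: c_def)
    thus ?thesis using \<alpha> by (simp add: power_mult_distrib)
  qed
  have a: "2 * d - c\<^sup>2 \<in> \<int>" and b: "d\<^sup>2 + 2 - 2 * c\<^sup>2 \<in> \<int>"
    using int[of 1] int[of 2] unfolding ps(2,3)[symmetric] coeffs(2,3) .
  define a b where "a = 2 * d - c\<^sup>2" and "b = d\<^sup>2 + 2 - 2 * c\<^sup>2"
  \<comment> \<open>Eliminating \<open>d\<close> from \<open>a\<close> and \<open>b\<close> gives a
    monic quadratic for \<open>c^2\<close> with integer coefficients. Then \<open>d^2\<close> is an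
    integer as well, hence so is the rational number \<open>d\<close>.\<close>
  have c2Z: "c\<^sup>2 \<in> \<int>"
  proof (rule rational_root_monic_quadratic_int[OF c2])
    show "(c\<^sup>2)\<^sup>2 + (2 * a - 8) * c\<^sup>2 + (a\<^sup>2 + 8 - 4 * b) = 0"
      by (simp add: a_def b_def power2_eq_square algebra_simps)
  qed (use a b in \<open>auto simp flip: a_def b_def\<close>)
  have dZ: "d \<in> \<int>"
  proof (rule rational_root_monic_quadratic_int[OF d])
    show "d\<^sup>2 + 0 * d + - (d\<^sup>2 + 2 - 2 * c\<^sup>2 - 2 + 2 * c\<^sup>2) = 0" by simp
    show "- (d\<^sup>2 + 2 - 2 * c\<^sup>2 - 2 + 2 * c\<^sup>2) \<in> \<int>"
      using b c2Z by (intro Ints_minus Ints_add Ints_diff Ints_mult) auto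
  qed auto
  obtain m where m: "c\<^sup>2 = of_int m" using c2Z by (auto elim: Ints_cases)
  obtain d' where d': "d = of_int d'" using dZ by (auto elim: Ints_cases)
  define A where "A = (sqrt_trace x)\<^sup>2"
  have A: "A = x + 1 / x + 2" unfolding A_def using x by (simp add: sqrt_trace_square)
  have "poly p x = 0" using pm by (simp add: is_min_poly_def)
  hence p0: "1 + (2 * d - c\<^sup>2) * x + (d\<^sup>2 + 2 - 2 * c\<^sup>2) * x\<^sup>2 + (2 * d - c\<^sup>2) * x ^ 3 + x ^ 4 = 0"
    unfolding p_eq coeffs by (simp add: algebra_simps power2_eq_square power3_eq_cube power4_eq_xxxx)
  define X where "X = 1 / x"
  have X: "x * X = 1" and X': "X * x = 1" using x by (simp_all add: X_def)
  have "X\<^sup>2 * (1 + (2 * d - c\<^sup>2) * x + (d\<^sup>2 + 2 - 2 * c\<^sup>2) * x\<^sup>2 + (2 * d - c\<^sup>2) * x ^ 3 + x ^ 4) =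
      X\<^sup>2 + (2 * d - c\<^sup>2) * X * (x * X) + (d\<^sup>2 + 2 - 2 * c\<^sup>2) * (x * X)\<^sup>2 + (2 * d - c\<^sup>2) * x * (x * X)\<^sup>2
       + x\<^sup>2 * (x * X)\<^sup>2"
    by (simp add: algebra_simps power2_eq_square power3_eq_cube power4_eq_xxxx)
  also have "\<dots> = (x + X)\<^sup>2 - 2 * (x * X) + (2 * d - c\<^sup>2) * (x + X) + (d\<^sup>2 + 2 - 2 * c\<^sup>2)"
    unfolding X by (simp add: algebra_simps power2_sum X')
  also have "\<dots> = (A + (d - 2))\<^sup>2 - c\<^sup>2 * A"
    unfolding X A X_def[symmetric] by (simp add: algebra_simps power2_eq_square)
  finally have eq: "(A + (d - 2))\<^sup>2 = c\<^sup>2 * A" using p0 by simp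
  define B where "B = c\<^sup>2 - 2 * (d - 2) - A"
  have AB: "A * B = (d - 2)\<^sup>2"
    using eq by (simp add: B_def power2_eq_square algebra_simps)
  have "p = salem_quartic A B"
    unfolding p_eq coeffs salem_quartic_def AB by (simp add: B_def power2_eq_square algebra_simps)
  thus thesis
    using that[of m "d' - 2"] AB unfolding A_def B_def m d' p_def by simp
qed

text \<open>The two conjugates besides \<open>x\<close> and its inverse are the roots of
  \<open>y^2 + (2 - B) * y + 1\<close>. They lie on the unit circle, which forces
  \<open>0 < B < 4\<close>, and \<open>s'\<close> is the positive root of \<open>B\<close>. This
  choice of sign replaces \<open>e\<close> by its absolute value and \<open>m\<close> by
  \<open>m - 2 * e + 2 * \<bar>e\<bar>\<close>.\<close>

lemma square_rootable_salem4_imp: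
  assumes "square_rootable_salem4 x"
  obtains M E :: int and s' where "M > 0" "E > 0" "0 < s'" "s' < 2"
    "sqrt_trace x * s' = of_int E" "(sqrt_trace x + s')\<^sup>2 = of_int M" "(sqrt_trace x)\<^sup>2 \<notin> \<rat>"
proof -
  have x: "salem_number x" "algebraic_degree x = 4" "square_rootable \<rat> x" "x > 1"
    using assms by (auto simp: square_rootable_salem4_def salem_number_def)
  define s where "s = sqrt_trace x"
  obtain m e where min: "min_poly \<rat> x = salem_quartic (s\<^sup>2) (of_int m - 2 * of_int e - s\<^sup>2)" and
     AB: "s\<^sup>2 * (of_int m - 2 * of_int e - s\<^sup>2) = (of_int e)\<^sup>2"
    using square_rootable_min_poly[OF x(3,2)] unfolding s_def by metis
  define B where "B = of_int m - 2 * of_int e - s\<^sup>2"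
  have s2: "s > 2" unfolding s_def using x by (simp add: sqrt_trace_gt_2)
  have root: "x\<^sup>2 + (2 - s\<^sup>2) * x + 1 = 0"
    unfolding s_def using x by (intro sqrt_trace_root) auto
  \<comment> \<open>Otherwise \<open>x\<close> would be a root of a rational quadratic, against its
    degree four.\<close>
  have irr: "s\<^sup>2 \<notin> \<rat>"
  proof
    assume *: "s\<^sup>2 \<in> \<rat>"
    have pm: "is_min_poly \<rat> x (min_poly \<rat> x)"
    proof (rule is_min_poly_min_poly[OF is_subfield_Rats])
      show "[:1, 2 - s\<^sup>2, 1:] \<in> polys_over \<rat>"
        using * by (auto simp: polys_over_def coeff_pCons split: nat.split)
      show "poly [:1, 2 - s\<^sup>2, 1:] x = 0" using root by (simp add: algebra_simps power2_eq_square)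
    qed auto
    have "[:1, 2 - s\<^sup>2, 1:] \<in> polys_over \<rat>" "poly [:1, 2 - s\<^sup>2, 1:] x = 0"
      using * root by (auto simp: polys_over_def coeff_pCons algebra_simps power2_eq_square split: nat.split)
    hence "degree (min_poly \<rat> x) \<le> degree [:1, 2 - s\<^sup>2, 1:]"
      using pm unfolding is_min_poly_def by (auto simp del: degree_pCons_eq_if)
    thus False using x(2) by (simp add: algebraic_degree_def)
  qed
  have irrB: "B \<notin> \<rat>"
  proof
    assume "B \<in> \<rat>"
    hence "of_int m - 2 * of_int e - B \<in> \<rat>" by auto
    thus False using irr by (simp add: B_def)
  qed
  define z where "z = ((of_real B - 2) + csqrt ((of_real B - 2)\<^sup>2 - 4)) / 2"
  have z: "z\<^sup>2 + (2 - of_real B) * z + 1 = 0"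
  proof -
    have "((\<beta> + w) / 2)\<^sup>2 - \<beta> * ((\<beta> + w) / 2) + 1 = (w\<^sup>2 - (\<beta>\<^sup>2 - 4)) / 4" for \<beta> w :: complex
      by (simp add: power2_eq_square field_simps)
    from this[of "of_real B - 2" "csqrt ((of_real B - 2)\<^sup>2 - 4)", folded z_def]
    have "z\<^sup>2 - (of_real B - 2) * z + 1 = 0" by simp
    thus ?thesis by (simp add: algebra_simps)
  qed
  have "B \<noteq> s\<^sup>2"
  proof
    assume "B = s\<^sup>2"
    hence "s\<^sup>2 = (of_int m - 2 * of_int e) / 2" by (simp add: B_def)
    also have "\<dots> \<in> \<rat>" by auto
    finally show False using irr by simp
  qed
  have conj: "galois_conjugate x z"
    unfolding galois_conjugate_def min B_def[symmetric] poly_salem_quartic using z by simp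
  have root2: "y\<^sup>2 + (2 - s\<^sup>2) * y + 1 = 0 \<Longrightarrow> y \<noteq> 0 \<Longrightarrow> z \<noteq> of_real y" for y
  proof
    assume y: "y\<^sup>2 + (2 - s\<^sup>2) * y + 1 = 0" "y \<noteq> 0" "z = of_real y"
    have "complex_of_real (y\<^sup>2 + (2 - B) * y + 1) = 0" using z y(3) by simp
    hence "y\<^sup>2 + (2 - B) * y + 1 = 0" by (simp only: of_real_eq_0_iff)
    hence "(s\<^sup>2 - B) * y = 0" using y(1) by algebra
    thus False using y(2) \<open>B \<noteq> s\<^sup>2\<close> by simp
  qed
  have "z \<noteq> of_real x" using root2[OF root] x(4) by simp
  moreover have "z \<noteq> of_real (inverse x)"
    using root x(4) by (intro root2) (simp_all add: field_simps power2_eq_square)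
  ultimately have "norm z = 1"
    using x(1) conj by (auto simp: salem_number_def)
  \<comment> \<open>On the unit circle the inverse of \<open>z\<close> is its complex conjugate, so
    the quadratic for \<open>z\<close> reads \<open>B - 2 = 2 * Re z\<close>. The end points 0 and 4
    are excluded by the irrationality of \<open>B\<close>.\<close>
  hence "z * cnj z = 1" by (metis complex_norm_square of_real_1 one_power2)
  hence "z * (z + cnj z - (of_real B - 2)) = 0"
    using z by (simp add: algebra_simps power2_eq_square)
  hence "complex_of_real (2 * Re z) = of_real B - 2"
    using \<open>norm z = 1\<close> by (auto simp: complex_add_cnj)
  hence "B - 2 = 2 * Re z" by (metis of_real_eq_iff of_real_diff of_real_numeral)
  hence "0 \<le> B" "B \<le> 4"
    using abs_Re_le_cmod[of z] \<open>norm z = 1\<close> by auto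
  moreover have "B \<noteq> 0" "B \<noteq> 4" using irrB by auto
  ultimately have B: "0 < B" "B < 4" by auto
  define s' where "s' = sqrt B"
  have s': "0 < s'" "s' < 2" "s'\<^sup>2 = B"
    using B real_sqrt_less_mono[of B 4] by (auto simp: s'_def)
  have "(s * s')\<^sup>2 = (of_int e)\<^sup>2" using AB s' by (simp add: power_mult_distrib B_def)
  hence ss': "s * s' = of_int \<bar>e\<bar>"
    using s' s2 by (intro power2_eq_imp_eq[of "s * s'" "of_int \<bar>e\<bar>"]) simp_all
  have "(s + s')\<^sup>2 = of_int (m - 2 * e + 2 * \<bar>e\<bar>)"
    using ss' s'(3) by (simp add: power2_sum B_def)
  moreover have "(s + s')\<^sup>2 > 0" using s2 s' by simp
  ultimately have M: "(s + s')\<^sup>2 = of_int (m - 2 * e + 2 * \<bar>e\<bar>)" "m - 2 * e + 2 * \<bar>e\<bar> > 0"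
    by (simp_all only: of_int_0_less_iff)
  have "s * s' > 0" using s2 s' by simp
  hence "\<bar>e\<bar> > 0" unfolding ss' by simp
  thus thesis
    using that[of "m - 2 * e + 2 * \<bar>e\<bar>" "\<bar>e\<bar>" s'] M s' ss' irr unfolding s_def by blast
qed

text \<open>Galois conjugation from \<open>A\<close> to \<open>B\<close> done by hand: modulo
  \<open>X^2 - (A + B) * X + A * B\<close> the cubic reduces to \<open>U + V * X\<close> with
  rational \<open>U\<close> and \<open>V\<close>, and irrationality of \<open>A\<close> makes both
  vanish.\<close>

lemma cubic_conjugate:
  fixes A B :: real
  assumes A: "A \<notin> \<rat>" and PR: "A + B \<in> \<rat>" "A * B \<in> \<rat>"
    and c: "c0 \<in> \<rat>" "c1 \<in> \<rat>" "c2 \<in> \<rat>" "c3 \<in> \<rat>"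
    and root: "c0 + c1 * A + c2 * A\<^sup>2 + c3 * A ^ 3 = 0"
  shows "c0 + c1 * B + c2 * B\<^sup>2 + c3 * B ^ 3 = 0"
proof -
  define P where "P = A + B"
  define R where "R = A * B"
  define U where "U = c0 - c2 * R - c3 * P * R"
  define V where "V = c1 + c2 * P + c3 * (P\<^sup>2 - R)"
  have rat: "U \<in> \<rat>" "V \<in> \<rat>"
    using PR c by (auto simp: U_def V_def P_def R_def)
  have "U + V * A = 0"
    unfolding root[symmetric]
    by (simp add: U_def V_def P_def R_def power2_eq_square power3_eq_cube algebra_simps)
  have "V = 0"
  proof (rule ccontr)
    assume "V \<noteq> 0"
    hence "A = - U / V" using \<open>U + V * A = 0\<close> by (simp add: field_simps)
    thus False using rat A by simp
  qed
  with \<open>U + V * A = 0\<close> have "U = 0" by simp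
  have "c0 + c1 * B + c2 * B\<^sup>2 + c3 * B ^ 3 = U + V * B"
    by (simp add: U_def V_def P_def R_def power2_eq_square power3_eq_cube algebra_simps)
  thus ?thesis by (simp add: \<open>U = 0\<close> \<open>V = 0\<close>)
qed

text \<open>A cubic relation has the form \<open>\<alpha> + \<beta> x = 0\<close> with \<open>\<alpha>, \<beta> \<in> \<rat>(\<tau>)\<close>, whence
  \<open>\<alpha>\<^sup>2 + \<tau> \<alpha> \<beta> + \<beta>\<^sup>2 = 0\<close>. Conjugating \<open>\<tau>\<close> to \<open>\<tau>'\<close> turns the left side into a definite form.\<close>

lemma salem_quartic_no_cubic_relation:
  fixes x \<tau> \<tau>' :: real
  assumes \<tau>: "\<tau> \<notin> \<rat>" "\<tau> + \<tau>' \<in> \<rat>" "\<tau> * \<tau>' \<in> \<rat>" and \<tau>': "\<bar>\<tau>'\<bar> < 2"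
    and x: "x\<^sup>2 = \<tau> * x - 1"
    and c: "c0 \<in> \<rat>" "c1 \<in> \<rat>" "c2 \<in> \<rat>" "c3 \<in> \<rat>"
    and root: "c0 + c1 * x + c2 * x\<^sup>2 + c3 * x ^ 3 = 0"
  shows "c0 = 0 \<and> c1 = 0 \<and> c2 = 0 \<and> c3 = 0"
proof -
  define P where "P = \<tau> + \<tau>'"
  define R where "R = \<tau> * \<tau>'"
  have \<tau>2: "\<tau>\<^sup>2 = P * \<tau> - R"
    by (simp add: P_def R_def power2_eq_square algebra_simps)
  define a0 where "a0 = c0 - c2"
  define a1 where "a1 = - c3"
  define b0 where "b0 = c1 - c3 - c3 * R"
  define b1 where "b1 = c2 + c3 * P"
  have rat: "a0 \<in> \<rat>" "a1 \<in> \<rat>" "b0 \<in> \<rat>" "b1 \<in> \<rat>"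
    using c \<tau> by (auto simp: a0_def a1_def b0_def b1_def P_def R_def)
  define \<alpha> where "\<alpha> = a0 + a1 * \<tau>"
  define \<beta> where "\<beta> = b0 + b1 * \<tau>"
  have x3: "x ^ 3 = (P * \<tau> - R - 1) * x - \<tau>"
  proof -
    have "x ^ 3 = \<tau>\<^sup>2 * x - \<tau> - x" using x by algebra
    thus ?thesis unfolding \<tau>2 by (simp add: algebra_simps)
  qed
  have "c0 + c1 * x + c2 * x\<^sup>2 + c3 * x ^ 3 = \<alpha> + \<beta> * x"
    unfolding x x3 by (simp add: \<alpha>_def \<beta>_def a0_def a1_def b0_def b1_def algebra_simps)
  hence "\<alpha> + \<beta> * x = 0" using root by simp
  hence "\<alpha>\<^sup>2 + \<tau> * \<alpha> * \<beta> + \<beta>\<^sup>2 = 0"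
    using x by algebra
  hence "(a0\<^sup>2 + b0\<^sup>2) + (2 * a0 * a1 + 2 * b0 * b1 + a0 * b0) * \<tau>
     + (a1\<^sup>2 + b1\<^sup>2 + a0 * b1 + a1 * b0) * \<tau>\<^sup>2 + a1 * b1 * \<tau> ^ 3 = 0"
    by (simp add: \<alpha>_def \<beta>_def power2_eq_square power3_eq_cube algebra_simps)
  hence "(a0\<^sup>2 + b0\<^sup>2) + (2 * a0 * a1 + 2 * b0 * b1 + a0 * b0) * \<tau>'
     + (a1\<^sup>2 + b1\<^sup>2 + a0 * b1 + a1 * b0) * \<tau>'\<^sup>2 + a1 * b1 * \<tau>' ^ 3 = 0"
    by (rule cubic_conjugate[OF \<tau>(1-3), rotated 4])      (use rat in auto)
  \<comment> \<open>Completing the square shows the form to be positive definite for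
    \<open>\<bar>\<tau>'\<bar> < 2\<close>, so both conjugated coefficients are 0.\<close>
  hence form: "(a0 + a1 * \<tau>' + \<tau>' * (b0 + b1 * \<tau>') / 2)\<^sup>2 + (1 - \<tau>'\<^sup>2 / 4) * (b0 + b1 * \<tau>')\<^sup>2 = 0"
    by (simp add: power2_eq_square power3_eq_cube field_simps)
  have "\<tau>'\<^sup>2 < 2\<^sup>2" using \<tau>' by (metis abs_numeral abs_le_square_iff not_less)
  hence pos: "1 - \<tau>'\<^sup>2 / 4 > 0" by simp
  hence "0 \<le> (1 - \<tau>'\<^sup>2 / 4) * (b0 + b1 * \<tau>')\<^sup>2" by simp
  from form this have "(a0 + a1 * \<tau>' + \<tau>' * (b0 + b1 * \<tau>') / 2)\<^sup>2 = 0 \<and> (1 - \<tau>'\<^sup>2 / 4) * (b0 + b1 * \<tau>')\<^sup>2 = 0"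
    by (subst (asm) add_nonneg_eq_0_iff) (rule zero_le_power2)
  hence ab: "a0 + a1 * \<tau>' + \<tau>' * (b0 + b1 * \<tau>') / 2 = 0" and b: "b0 + b1 * \<tau>' = 0"
    using pos by (simp_all only: power_eq_0_iff mult_eq_0_iff) auto
  have a: "a0 + a1 * \<tau>' = 0" using ab b by simp
  have irr: "\<tau>' \<notin> \<rat>"
  proof
    assume "\<tau>' \<in> \<rat>"
    hence "\<tau> + \<tau>' - \<tau>' \<in> \<rat>" using \<tau> by (intro Rats_diff) auto
    thus False using \<tau> by simp
  qed
  have lin: "u = 0 \<and> v = 0" if "u \<in> \<rat>" "v \<in> \<rat>" "u + v * \<tau>' = 0" for u v
  proof (cases "v = 0")
    case False
    hence "\<tau>' = - u / v" using that by (simp add: field_simps)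
    thus ?thesis using that irr by simp
  qed (use that in auto)
  show ?thesis
    using lin[OF rat(1,2) a] lin[OF rat(3,4) b] by (simp add: a0_def a1_def b0_def b1_def)
qed

lemma real_embedding_of_int:
  assumes "real_embedding \<rat> \<sigma>"
  shows "\<sigma> (of_int k) = of_int k"
proof -
  have add: "\<sigma> (x + y) = \<sigma> x + \<sigma> y" if "x \<in> \<rat>" "y \<in> \<rat>" for x y
    using assms that by (auto simp: real_embedding_def)
  have one: "\<sigma> 1 = 1" using assms by (auto simp: real_embedding_def)
  have zero: "\<sigma> 0 = 0" using add[of 0 0] by simp
  have nat: "\<sigma> (of_nat n) = of_nat n" for n
    by (induction n) (auto simp: zero one add)
  show ?thesis
  proof (cases k)
    case (neg n)
    have "\<sigma> (of_nat (Suc n)) + \<sigma> (- of_nat (Suc n)) = 0"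
      by (subst add[symmetric]) (auto simp: zero simp del: of_nat_Suc)
    hence "\<sigma> (- of_nat (Suc n)) = - of_nat (Suc n)"
      unfolding nat by simp
    thus ?thesis by (simp add: neg)
  qed (simp add: nat)
qed

lemma square_rootable_salem4I:
  fixes x s' :: real and m e :: int
  assumes x: "x > 1" and s': "\<bar>s'\<bar> < 2" and e: "sqrt_trace x * s' = of_int e"
    and m: "(sqrt_trace x + s')\<^sup>2 = of_int m" and irr: "(sqrt_trace x)\<^sup>2 \<notin> \<rat>"
  shows "square_rootable_salem4 x"
proof -
  define A where "A = (sqrt_trace x)\<^sup>2"
  define B where "B = s'\<^sup>2"
  have AB: "A + B = of_int (m - 2 * e)" "A * B = of_int (e\<^sup>2)"
    using e m by (simp_all add: A_def B_def power2_sum flip: power_mult_distrib)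
  have s2: "sqrt_trace x > 2" using x by (rule sqrt_trace_gt_2)
  have "B < 2\<^sup>2" using s' unfolding B_def by (metis abs_numeral abs_le_square_iff not_less)
  hence B4: "B < 4" by simp
  have AQ: "A \<notin> \<rat>" using irr by (simp add: A_def)
  have "s' \<noteq> 0"
  proof
    assume "s' = 0"
    hence "A = of_int m" using m by (simp add: A_def)
    thus False using AQ by simp
  qed
  hence B0: "B > 0" by (simp add: B_def)
  have m0: "m > 0"
  proof -
    have "(sqrt_trace x + s')\<^sup>2 > 0" using s2 s' by auto
    thus ?thesis unfolding m by simp
  qed
  have root: "x\<^sup>2 + (2 - A) * x + 1 = 0"
    unfolding A_def using x by (intro sqrt_trace_root) auto
  define p where "p = salem_quartic A B"
  have int: "coeff p i \<in> \<int>" for i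
  proof -
    have "p = [:1, 4 - of_int (m - 2 * e), 6 - 2 * of_int (m - 2 * e) + of_int (e\<^sup>2), 4 - of_int (m - 2 * e), 1:]"
      unfolding p_def salem_quartic_def AB[symmetric] by simp
    thus ?thesis by (auto simp: coeff_pCons split: nat.split)
  qed
  have px: "poly p x = 0" by (simp add: p_def poly_salem_quartic_real root)
  have dp: "degree p = 4" "lead_coeff p = 1" by (simp_all add: p_def salem_quartic_def)
  have mp: "is_min_poly \<rat> x p"
    unfolding is_min_poly_def
  proof (intro conjI ballI impI)
    show "p \<in> polys_over \<rat>"
      using int Ints_subset_Rats by (auto simp: polys_over_def)
    fix q assume q: "q \<in> polys_over \<rat>" "q \<noteq> 0 \<and> poly q x = 0"
    show "degree p \<le> degree q"
    proof (rule ccontr)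
      assume "\<not> degree p \<le> degree q"
      hence dq: "degree q < 4" by (simp add: dp)
      define c0 c1 c2 c3 where c: "c0 = coeff q 0" "c1 = coeff q 1" "c2 = coeff q 2" "c3 = coeff q 3"
      have q_eq: "q = [:c0, c1, c2, c3:]"
        using poly_eq_degree_le_4[of q] dq by (simp add: c coeff_eq_0)
      have "c0 = 0 \<and> c1 = 0 \<and> c2 = 0 \<and> c3 = 0"
      proof (rule salem_quartic_no_cubic_relation[of "A - 2" "B - 2" x])
        show "A - 2 \<notin> \<rat>"
        proof
          assume "A - 2 \<in> \<rat>"
          hence "A - 2 + 2 \<in> \<rat>" by (intro Rats_add) auto
          thus False using AQ by simp
        qed
        have "A - 2 + (B - 2) = of_int (m - 2 * e - 4)" using AB by simp
        thus "A - 2 + (B - 2) \<in> \<rat>" by simp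
        have "(A - 2) * (B - 2) = of_int (e\<^sup>2 - 2 * (m - 2 * e) + 4)"
          using AB by (simp add: algebra_simps)
        thus "(A - 2) * (B - 2) \<in> \<rat>" by simp
        show "\<bar>B - 2\<bar> < 2" using B0 B4 by auto
        show "x\<^sup>2 = (A - 2) * x - 1" using root by (simp add: algebra_simps)
        show "c0 + c1 * x + c2 * x\<^sup>2 + c3 * x ^ 3 = 0"
          using q(2) unfolding q_eq by (simp add: power2_eq_square power3_eq_cube algebra_simps)
      qed (use q(1) in \<open>auto simp: c polys_over_def\<close>)
      thus False using q(2) q_eq by simp
    qed
  qed (use px dp in auto)
  hence min: "min_poly \<rat> x = p" by (intro min_poly_eqI is_subfield_Rats)
  have conj: "galois_conjugate x z \<longleftrightarrow>
      z\<^sup>2 + (2 - of_real A) * z + 1 = 0 \<or> z\<^sup>2 + (2 - of_real B) * z + 1 = 0" for z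
    unfolding galois_conjugate_def min p_def poly_salem_quartic by simp
  have salem: "salem_number x"
    unfolding salem_number_def
  proof (intro conjI allI impI)
    show "algebraic_int x"
      using int px dp by (intro algebraic_int.intros[of p]) auto
    have "(inverse x)\<^sup>2 + (2 - A) * inverse x + 1 = 0"
      using root x by (simp add: field_simps power2_eq_square)
    hence "complex_of_real ((inverse x)\<^sup>2 + (2 - A) * inverse x + 1) = 0" by simp
    thus "galois_conjugate x (of_real (inverse x))" unfolding conj by simp
    fix z assume z: "galois_conjugate x z \<and> z \<noteq> of_real x \<and> z \<noteq> of_real (inverse x)"
    from z consider "z\<^sup>2 + (2 - of_real A) * z + 1 = 0" | "z\<^sup>2 + (2 - of_real B) * z + 1 = 0"
      unfolding conj by blast
    thus "norm z = 1"
    proof cases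
      case 1
      have "x * (A - 2) = x * x + 1" using root by (simp add: power2_eq_square algebra_simps)
      hence "A - 2 = x + inverse x" using x by (simp add: field_simps)
      hence "complex_of_real A - 2 = of_real x + of_real (inverse x)"
        by (metis of_real_add of_real_diff of_real_numeral)
      hence A': "2 - complex_of_real A = - (of_real x + of_real (inverse x))"
        by (metis minus_diff_eq)
      have xi: "complex_of_real x * of_real (inverse x) = 1" using x by simp
      have "(z - of_real x) * (z - of_real (inverse x)) = 0"
        using 1 unfolding A' using xi by algebra
      thus ?thesis using z by auto
    next
      case 2
      obtain a b where ab: "z = Complex a b" by (cases z)
      have re: "a\<^sup>2 - b\<^sup>2 + (2 - B) * a + 1 = 0" and im: "b * (2 * a + (2 - B)) = 0"
        using 2 by (simp_all add: complex_eq_iff ab power2_eq_square algebra_simps)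
      show ?thesis
      \<comment> \<open>For \<open>0 < B < 4\<close> there is no real root. For a nonreal one the
        imaginary part gives \<open>B - 2 = 2 * a\<close>, and the real part becomes
        \<open>a^2 + b^2 = 1\<close>.\<close>
      proof (cases "b = 0")
        case True
        have "(a + (2 - B) / 2)\<^sup>2 + (1 - (2 - B)\<^sup>2 / 4) = 0"
          using re True by (simp add: power2_eq_square field_simps)
        moreover have "1 - (2 - B)\<^sup>2 / 4 = B * (4 - B) / 4"
          by (simp add: power2_eq_square field_simps)
        moreover have "B * (4 - B) / 4 > 0" using B0 B4 by simp
        ultimately show ?thesis
          using zero_le_power2[of "a + (2 - B) / 2"] by linarith
      next
        case False
        hence "2 - B = - 2 * a" using im by simp
        hence "a\<^sup>2 + b\<^sup>2 = 1" using re by (simp add: power2_eq_square)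
        thus ?thesis by (simp add: ab cmod_def)
      qed
    qed
  qed (rule x)
  have "square_rootable \<rat> x"
    unfolding square_rootable_def
  \<comment> \<open>The witness is \<open>(y^2 + s * y + 1) * (y^2 + s' * y + 1)\<close>, where
    \<open>s + s' = sqrt m\<close> and \<open>s * s' = e\<close>. Each factor times its reflection
    is a factor of \<open>p(y^2)\<close>.\<close>
  proof (intro conjI exI[of _ "real_of_int m"] exI[of _ "[:1, sqrt (of_int m), of_int e + 2, sqrt (of_int m), 1:]"])
    show "totally_positive \<rat> (of_int m)"
      using m0 by (auto simp: totally_positive_def real_embedding_of_int)
    show "reflect_poly [:1, sqrt (of_int m), of_int e + 2, sqrt (of_int m), 1:]
        = [:1, sqrt (of_int m), of_int e + 2, sqrt (of_int m), 1::real:]"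
      by (simp add: reflect_poly_pCons)
    show "\<forall>i. even i \<longrightarrow> coeff [:1, sqrt (real_of_int m), of_int e + 2, sqrt (of_int m), 1:] i \<in> \<rat>"
      by (auto simp: coeff_pCons split: nat.split)
    have "sqrt (of_int m) \<in> (\<lambda>y. sqrt (of_int m) * y) ` \<rat>" by (rule image_eqI[of _ _ 1]) auto
    moreover have "0 \<in> (\<lambda>y. sqrt (of_int m) * y) ` \<rat>" by (rule image_eqI[of _ _ 0]) auto
    ultimately show "\<forall>i. odd i \<longrightarrow> coeff [:1, sqrt (real_of_int m), of_int e + 2, sqrt (of_int m), 1:] i
        \<in> (\<lambda>y. sqrt (of_int m) * y) ` \<rat>"
      by (auto simp: coeff_pCons split: nat.split)
    define r where "r = sqrt (of_int m)"
    have mm: "r * r = A + B + 2 * of_int e"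
      using m0 AB by (simp add: r_def)
    have ee: "of_int e * of_int e = A * B" using AB by (simp add: power2_eq_square)
    show "[:1, sqrt (of_int m), of_int e + 2, sqrt (of_int m), 1:] *
        pcompose [:1, sqrt (of_int m), of_int e + 2, sqrt (of_int m), 1:] [:0, - 1:]
      = pcompose (min_poly \<rat> x) [:0, 0, 1:]"
      unfolding min p_def salem_quartic_def r_def[symmetric]
      by (simp add: pcompose_pCons mm ee algebra_simps)
  qed (use salem is_subfield_Rats Rats_subset_generated_subfield in auto)
  with salem show ?thesis
    by (simp add: square_rootable_salem4_def algebraic_degree_def min dp)
qed

section \<open>Lattice point counts\<close>

text \<open>By the mean value theorem \<open>F\<close> grows over a unit step by an amount between
  the values of the decreasing \<open>f\<close> at its ends. Derivatives are asked for in the open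
  interval only, since the antiderivative for the ellipse involves \<open>arcsin\<close> at 1 at the
  right end.\<close>

lemma sum_antiderivative_bound:
  fixes F f :: "real \<Rightarrow> real"
  assumes a: "a \<ge> 0" and cont: "continuous_on {0..a} F" and F0: "F 0 = 0"
    and deriv: "\<And>x. 0 < x \<Longrightarrow> x < a \<Longrightarrow> (F has_real_derivative f x) (at x)"
    and anti: "\<And>x y. 0 \<le> x \<Longrightarrow> x \<le> y \<Longrightarrow> y \<le> a \<Longrightarrow> f y \<le> f x"
    and nonneg: "\<And>x. 0 \<le> x \<Longrightarrow> x \<le> a \<Longrightarrow> 0 \<le> f x"
  shows "(\<Sum>v=1..nat \<lfloor>a\<rfloor>. f (real v)) \<le> F a" "F a \<le> f 0 + (\<Sum>v=1..nat \<lfloor>a\<rfloor>. f (real v))"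
proof -
  have mvt: "(y - x) * f y \<le> F y - F x \<and> F y - F x \<le> (y - x) * f x" if "0 \<le> x" "x \<le> y" "y \<le> a" for x y
  proof (cases "x = y")
    case False
    hence "x < y" using that by simp
    moreover have "continuous_on {x..y} F"
      using cont by (rule continuous_on_subset) (use that in auto)
    moreover have "(F has_real_derivative f z) (at z)" if "x < z" "z < y" for z
      using that \<open>0 \<le> x\<close> \<open>y \<le> a\<close> by (intro deriv) auto
    ultimately obtain z where z: "x < z" "z < y" "F y - F x = (y - x) * f z"
      using MVT[of x y F] by (metis DERIV_unique real_differentiable_def)
    have "f y \<le> f z" "f z \<le> f x" using z that by (auto intro!: anti)
    thus ?thesis unfolding z(3) using \<open>x < y\<close> by (auto intro!: mult_left_mono)
  qed simp
  \<comment> \<open>The summand \<open>f (real n)\<close> on the left of the second bound is kept to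
    absorb the incomplete last step from the integer part of \<open>a\<close> to
    \<open>a\<close>.\<close>
  have ind: "(\<Sum>v=1..n. f (real v)) \<le> F (real n) \<and> F (real n) + f (real n) \<le> f 0 + (\<Sum>v=1..n. f (real v))"
    if "real n \<le> a" for n
    using that
  proof (induction n)
    case (Suc n)
    have IH: "(\<Sum>v=1..n. f (real v)) \<le> F (real n) \<and> F (real n) + f (real n) \<le> f 0 + (\<Sum>v=1..n. f (real v))"
      using Suc by simp
    have "f (real (Suc n)) \<le> F (real (Suc n)) - F (real n)" "F (real (Suc n)) - F (real n) \<le> f (real n)"
      using mvt[of "real n" "real (Suc n)"] Suc.prems by simp_all
    thus ?case using IH by simp
  qed (simp add: F0)
  have n: "real (nat \<lfloor>a\<rfloor>) \<le> a" "a < real (nat \<lfloor>a\<rfloor>) + 1"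
    using a by linarith+
  define m where "m = real (nat \<lfloor>a\<rfloor>)"
  have m: "0 \<le> m" "m \<le> a" "a - m \<le> 1"
    using n unfolding m_def by linarith+
  have 1: "(a - m) * f a \<le> F a - F m" "F a - F m \<le> (a - m) * f m"
    using mvt[of m a] m by auto
  have "0 \<le> (a - m) * f a" using m nonneg[of a] a by (intro mult_nonneg_nonneg) auto
  thus "(\<Sum>v=1..nat \<lfloor>a\<rfloor>. f (real v)) \<le> F a"
    using ind[OF n(1)] 1 by (simp add: m_def)
  have "(a - m) * f m \<le> 1 * f m" using m nonneg[of m] by (intro mult_right_mono) auto
  thus "F a \<le> f 0 + (\<Sum>v=1..nat \<lfloor>a\<rfloor>. f (real v))"
    using ind[OF n(1)] 1 by (simp add: m_def)
qed

text \<open>The main term is the area of a quarter ellipse with semi-axes \<open>W\<close> and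
  \<open>W / sqrt D\<close>, evaluated through the antiderivative \<open>F\<close>. The error is the
  value \<open>W\<close> of the integrand at 0.\<close>

lemma sum_ellipse_bound:
  fixes W D :: real
  assumes W: "W > 0" and D: "D > 0"
  shows "\<bar>(\<Sum>v=1..nat \<lfloor>W / sqrt D\<rfloor>. sqrt (W\<^sup>2 - D * (real v)\<^sup>2)) - pi * W\<^sup>2 / (4 * sqrt D)\<bar> \<le> W"
proof -
  define a where "a = W / sqrt D"
  define f where "f = (\<lambda>x. sqrt (W\<^sup>2 - D * x\<^sup>2))"
  define F where "F = (\<lambda>x. (x * sqrt (W\<^sup>2 - D * x\<^sup>2) + W\<^sup>2 / sqrt D * arcsin (sqrt D * x / W)) / 2)"
  have a: "a > 0" using W D by (simp add: a_def)
  have arg: "-1 \<le> sqrt D * x / W \<and> sqrt D * x / W \<le> 1" if "0 \<le> x" "x \<le> a" for x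
  proof
    have "0 \<le> sqrt D * x / W" using that W D by simp
    thus "-1 \<le> sqrt D * x / W" by linarith
    show "sqrt D * x / W \<le> 1" using that W D by (simp add: a_def field_simps)
  qed
  have pos: "W\<^sup>2 - D * x\<^sup>2 > 0" if "0 \<le> x" "x < a" for x
  proof -
    have "sqrt D * x < W" using that W D by (simp add: a_def field_simps)
    hence "(sqrt D * x)\<^sup>2 < W\<^sup>2" using that D by (intro power_strict_mono) auto
    thus ?thesis using D by (simp add: power_mult_distrib)
  qed
  have fa: "D * a\<^sup>2 = W\<^sup>2" using D by (simp add: a_def power_divide)
  have Fa: "F a = pi * W\<^sup>2 / (4 * sqrt D)"
  proof -
    have 1: "sqrt D * a / W = 1" using W D by (simp add: a_def)
    show ?thesis unfolding F_def fa 1 by simp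
  qed
  define A where "A = (\<lambda>x. arcsin (sqrt D * x / W))"
  have A: "continuous_on {0..a} A"
    unfolding A_def
  proof (rule continuous_on_arcsin)
    show "\<forall>x\<in>{0..a}. - 1 \<le> sqrt D * x / W \<and> sqrt D * x / W \<le> 1"
      using arg by (meson atLeastAtMost_iff)
  qed (use W in \<open>auto intro!: continuous_intros\<close>)
  have "F = (\<lambda>x. (x * sqrt (W\<^sup>2 - D * x\<^sup>2) + W\<^sup>2 / sqrt D * A x) / 2)"
    by (simp add: F_def A_def)
  hence cont: "continuous_on {0..a} F"
    using A D by (auto intro!: continuous_intros)
  have der: "(F has_real_derivative f x) (at x)" if x: "0 < x" "x < a" for x
  proof -
    define r where "r = sqrt (W\<^sup>2 - D * x\<^sup>2)"
    have p: "W\<^sup>2 - D * x\<^sup>2 > 0" using pos x by simp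
    hence r: "r > 0" "r\<^sup>2 = W\<^sup>2 - D * x\<^sup>2" by (auto simp: r_def)
    have lt: "sqrt D * x / W < 1" using x W D by (simp add: a_def field_simps)
    have gt: "-1 < sqrt D * x / W"
      by (rule less_le_trans[of _ 0]) (use x W D in auto)
    have eq: "1 - (sqrt D * x / W)\<^sup>2 = (r / W)\<^sup>2"
      using W D unfolding power_divide r(2) by (simp add: power_mult_distrib field_simps)
    have q: "sqrt (1 - (sqrt D * x / W)\<^sup>2) = r / W"
      unfolding eq using W r(1) by (subst real_sqrt_abs) simp
    have d1: "((\<lambda>x. sqrt (W\<^sup>2 - D * x\<^sup>2)) has_real_derivative - (D * x) / r) (at x)"
      using p by (auto intro!: derivative_eq_intros simp: r_def field_simps)
    have d2: "((\<lambda>x. arcsin (sqrt D * x / W)) has_real_derivative inverse (r / W) * (sqrt D / W)) (at x)"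
      unfolding q[symmetric]
    proof (rule DERIV_chain2[where f = arcsin and g = "\<lambda>x. sqrt D * x / W"])
      show "((\<lambda>x. sqrt D * x / W) has_real_derivative sqrt D / W) (at x)"
        using W by (auto intro!: derivative_eq_intros)
    qed (rule DERIV_arcsin[OF gt lt])
    have d3: "(F has_real_derivative
        ((x * (- (D * x) / r) + 1 * sqrt (W\<^sup>2 - D * x\<^sup>2)) + W\<^sup>2 / sqrt D * (inverse (r / W) * (sqrt D / W))) / 2) (at x)"
      unfolding F_def
      by (rule DERIV_cdivide DERIV_add DERIV_mult' DERIV_ident DERIV_cmult d1 d2)+
    have e1: "W\<^sup>2 / sqrt D * (inverse (r / W) * (sqrt D / W)) = W\<^sup>2 / r"
      using W D r by (simp add: field_simps)
    have e2: "x * (- (D * x) / r) + W\<^sup>2 / r = r"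
      using r by (simp add: field_simps power2_eq_square)
    have "(u + 1 * r + w) / 2 = r" if "u + w = r" for u w :: real
      using that by simp
    from this[OF e2] have "(x * (- (D * x) / r) + 1 * r + W\<^sup>2 / r) / 2 = r" .
    thus ?thesis using d3 unfolding r_def[symmetric] e1 f_def by (simp only:)
  qed
  have anti: "f y \<le> f x" if "0 \<le> x" "x \<le> y" "y \<le> a" for x y
    using that D by (auto simp: f_def intro!: mult_left_mono power_mono)
  have nonneg: "0 \<le> f x" if "0 \<le> x" "x \<le> a" for x
    using anti[OF that(1,2)] fa by (simp add: f_def)
  have "F 0 = 0" by (simp add: F_def)
  from sum_antiderivative_bound[OF less_imp_le[OF a] cont this der anti nonneg]
  have "(\<Sum>v=1..nat \<lfloor>a\<rfloor>. f (real v)) \<le> F a" "F a \<le> f 0 + (\<Sum>v=1..nat \<lfloor>a\<rfloor>. f (real v))"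
    by blast+
  moreover have "f 0 = W" using W by (simp add: f_def)
  ultimately show ?thesis
    unfolding a_def[symmetric] Fa by (simp add: f_def abs_le_iff)
qed

section \<open>Integers of an imaginary quadratic field in a quarter ellipse\<close>

lemma card_Sigma_bound:
  fixes f :: "nat \<Rightarrow> real"
  assumes fin: "\<And>v. v \<in> {1..n} \<Longrightarrow> finite (X v)"
    and bound: "\<And>v. v \<in> {1..n} \<Longrightarrow> \<bar>real (card (X v)) - f v\<bar> \<le> K"
  shows "\<bar>real (card (Sigma {1..n} X)) - (\<Sum>v=1..n. f v)\<bar> \<le> K * real n"
proof -
  have "real (card (Sigma {1..n} X)) = (\<Sum>v=1..n. real (card (X v)))"
    using fin by (subst card_SigmaI) auto
  hence "\<bar>real (card (Sigma {1..n} X)) - (\<Sum>v=1..n. f v)\<bar> = \<bar>\<Sum>v=1..n. real (card (X v)) - f v\<bar>"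
    by (simp add: sum_subtractf)
  also have "\<dots> \<le> (\<Sum>v=1..n. \<bar>real (card (X v)) - f v\<bar>)"
    by (rule sum_abs)
  also have "\<dots> \<le> (\<Sum>v=1..n. K)"
    using bound by (intro sum_mono) auto
  finally show ?thesis by (simp add: mult.commute)
qed

text \<open>Both parity classes are parametrised at once by \<open>T = 2 * j - p\<close> with
  \<open>1 \<le> j \<le> (g + p) / 2\<close>.\<close>

lemma card_parity_interval:
  fixes p :: nat and g :: real
  assumes "p \<le> 1" "g \<ge> 0"
  shows "finite {T. 0 < T \<and> even (T + p) \<and> real T \<le> g}"
    "\<bar>real (card {T. 0 < T \<and> even (T + p) \<and> real T \<le> g}) - g / 2\<bar> \<le> 1"
proof -
  define k where "k = nat \<lfloor>(g + real p) / 2\<rfloor>"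
  have "(g + real p) / 2 \<ge> 0" using assms by simp
  hence k: "real k \<le> (g + real p) / 2" "(g + real p) / 2 < real k + 1"
    unfolding k_def by linarith+
  have eq: "{T. 0 < T \<and> even (T + p) \<and> real T \<le> g} = (\<lambda>j. 2 * j - p) ` {1..k}" (is "?A = ?B")
  proof (intro equalityI subsetI)
    fix T assume T: "T \<in> ?A"
    hence "2 dvd T + p" by blast
    then obtain j where j: "T + p = 2 * j" by (rule dvdE)
    have "real T + real p = 2 * real j" using j by linarith
    hence "real j \<le> (g + real p) / 2" using T by simp
    hence "real j < real k + 1" using k by linarith
    hence "j \<in> {1..k}" using j T by auto
    moreover have "T = 2 * j - p" using j by simp
    ultimately show "T \<in> ?B" by blast
  next
    fix T assume "T \<in> ?B"
    then obtain j where j: "T = 2 * j - p" "1 \<le> j" "j \<le> k" by auto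
    have "T + p = 2 * j" using j assms by simp
    hence ev: "even (T + p)" by simp
    have "real T = 2 * real j - real p" using j assms by (simp add: of_nat_diff)
    also have "\<dots> \<le> 2 * real k - real p" using j by simp
    also have "\<dots> \<le> g" using k by simp
    finally show "T \<in> ?A" using j assms ev by auto
  qed
  have "inj_on (\<lambda>j. 2 * j - p) {1..k}"
    using assms by (auto simp: inj_on_def)
  hence card: "card ?A = k" unfolding eq by (simp add: card_image)
  show "finite ?A" unfolding eq by simp
  show "\<bar>real (card ?A) - g / 2\<bar> \<le> 1"
    unfolding card using k assms by (simp add: abs_le_iff field_simps)
qed

lemma power2_le_iff_le_sqrt: "(x::real) \<ge> 0 \<Longrightarrow> x\<^sup>2 \<le> y \<longleftrightarrow> 0 \<le> y \<and> x \<le> sqrt y"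
  using real_le_rsqrt[of x y] power_mono[of x "sqrt y" 2] order_trans[OF zero_le_power2[of x], of y] by auto

text \<open>For square-free \<open>D\<close> the pair \<open>(V, T)\<close> stands for the algebraic
  integer with real part \<open>T / 2\<close> and imaginary part \<open>V * sqrt D / 2\<close>, of
  norm at most \<open>R\<close>. Positivity picks one of the four sign choices; \<open>V\<close>
  comes first because the count is by columns of fixed \<open>V\<close>.\<close>

definition ellipse_points :: "nat \<Rightarrow> real \<Rightarrow> (nat \<times> nat) set" where
  "ellipse_points D R = {(V, T). 0 < V \<and> 0 < T \<and> 4 dvd T\<^sup>2 + D * V\<^sup>2 \<and> real (T\<^sup>2 + D * V\<^sup>2) \<le> 4 * R}"

text \<open>Squares are 0 or 1 modulo 4, and \<open>D\<close> is not divisible by 4, so only the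
  residues 1, 2 and 3 have to be inspected.\<close>

lemma four_dvd_norm_form:
  fixes T V D :: nat
  assumes "squarefree D"
  shows "4 dvd T\<^sup>2 + D * V\<^sup>2 \<longleftrightarrow> (if D mod 4 = 3 then even (T + V) else even T \<and> even V)"
proof -
  have D0: "D mod 4 \<noteq> 0"
  proof
    assume "D mod 4 = 0"
    hence "2\<^sup>2 dvd D" by (simp add: mod_eq_0_iff_dvd)
    hence "is_unit (2::nat)" using assms unfolding squarefree_def by blast
    thus False by simp
  qed
  have sq: "x\<^sup>2 mod 4 = (if even x then 0 else 1)" for x :: nat
  proof (cases "even x")
    case True
    then obtain k where "x = 2 * k" by (auto elim: evenE)
    thus ?thesis by (simp add: power_mult_distrib)
  next
    case False
    then obtain k where "x = 2 * k + 1" by (auto elim: oddE)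
    hence "x\<^sup>2 = 1 + 4 * (k\<^sup>2 + k)" by (simp add: power2_eq_square algebra_simps)
    thus ?thesis using False by simp
  qed
  have "(D * V\<^sup>2) mod 4 = ((D mod 4) * (V\<^sup>2 mod 4)) mod 4"
    by (rule mod_mult_eq[symmetric])
  hence "(T\<^sup>2 + D * V\<^sup>2) mod 4 = (T\<^sup>2 mod 4 + ((D mod 4) * (V\<^sup>2 mod 4)) mod 4) mod 4"
    by (metis mod_add_eq)
  moreover have "D mod 4 \<in> {1, 2, 3}" using D0 by auto
  ultimately show ?thesis
    unfolding dvd_eq_mod_eq_0[of 4] sq by (auto split: if_splits)
qed

text \<open>Here integrality is \<open>T \<equiv> V\<close> modulo 2: every column \<open>V\<close>
  carries about half of the integers up to the height of the ellipse.\<close>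

lemma card_ellipse_points_3:
  assumes sf: "squarefree D" "D > 0" and D: "D mod 4 = 3" and R: "R > 0"
  shows "finite (ellipse_points D R) \<and>
         \<bar>real (card (ellipse_points D R)) - pi / (2 * sqrt D) * R\<bar> \<le> 4 * sqrt R"
proof -
  define W where "W = 2 * sqrt R"
  have W: "W > 0" "W\<^sup>2 = 4 * R" using R by (simp_all add: W_def power_mult_distrib)
  define n where "n = nat \<lfloor>W / sqrt D\<rfloor>"
  define X where "X = (\<lambda>V. {T. 0 < T \<and> even (T + V mod 2) \<and> real T \<le> sqrt (W\<^sup>2 - D * (real V)\<^sup>2)})"
  have sD: "sqrt D \<ge> 1" using sf by simp
  have in_n: "real V \<le> W / sqrt D \<longleftrightarrow> D * (real V)\<^sup>2 \<le> W\<^sup>2" for V :: nat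
  proof -
    have "real V \<le> W / sqrt D \<longleftrightarrow> sqrt D * real V \<le> W" using sD by (simp add: field_simps)
    also have "\<dots> \<longleftrightarrow> (sqrt D * real V)\<^sup>2 \<le> W\<^sup>2" using W by (intro sym[OF power_mono_iff]) auto
    finally show ?thesis by (simp add: power_mult_distrib)
  qed
  have n: "V \<le> n \<longleftrightarrow> D * (real V)\<^sup>2 \<le> W\<^sup>2" for V
    unfolding in_n[symmetric] n_def using W sD by (simp add: le_nat_iff le_floor_iff)
  have eq: "ellipse_points D R = Sigma {1..n} X"
  proof (intro set_eqI, clarify)
    fix V T :: nat
    have "real (T\<^sup>2 + D * V\<^sup>2) \<le> 4 * R \<longleftrightarrow> (real T)\<^sup>2 \<le> W\<^sup>2 - D * (real V)\<^sup>2"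
      by (simp add: W algebra_simps)
    also have "\<dots> \<longleftrightarrow> D * (real V)\<^sup>2 \<le> W\<^sup>2 \<and> real T \<le> sqrt (W\<^sup>2 - D * (real V)\<^sup>2)"
      by (subst power2_le_iff_le_sqrt) auto
    finally have "real (T\<^sup>2 + D * V\<^sup>2) \<le> 4 * R \<longleftrightarrow> V \<le> n \<and> real T \<le> sqrt (W\<^sup>2 - D * (real V)\<^sup>2)"
      unfolding n .
    moreover have "even (T + V mod 2) \<longleftrightarrow> even (T + V)" by (simp add: even_add)
    ultimately show "(V, T) \<in> ellipse_points D R \<longleftrightarrow> (V, T) \<in> Sigma {1..n} X"
      unfolding ellipse_points_def X_def using four_dvd_norm_form[OF sf(1), of T V] D by auto
  qed
  have X: "finite (X V)" "\<bar>real (card (X V)) - sqrt (W\<^sup>2 - D * (real V)\<^sup>2) / 2\<bar> \<le> 1" if "V \<in> {1..n}" for V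
    unfolding X_def by (rule card_parity_interval; use that n[of V] in force)+
  have "\<bar>real (card (Sigma {1..n} X)) - (\<Sum>V=1..n. sqrt (W\<^sup>2 - D * (real V)\<^sup>2) / 2)\<bar> \<le> 1 * real n"
    by (rule card_Sigma_bound[OF X])
  moreover have "(\<Sum>V=1..n. sqrt (W\<^sup>2 - D * (real V)\<^sup>2) / 2) = (\<Sum>V=1..n. sqrt (W\<^sup>2 - D * (real V)\<^sup>2)) / 2"
    by (simp add: sum_divide_distrib)
  moreover have "\<bar>(\<Sum>V=1..n. sqrt (W\<^sup>2 - D * (real V)\<^sup>2)) - pi * W\<^sup>2 / (4 * sqrt D)\<bar> \<le> W"
    unfolding n_def using sf by (intro sum_ellipse_bound W) auto
  moreover have "pi * W\<^sup>2 / (4 * sqrt D) = 2 * (pi / (2 * sqrt D) * R)"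
    by (simp add: W)
  moreover have "real n \<le> W"
  proof -
    have "real n \<le> W / sqrt D" using W sD by (simp add: n_def)
    also have "\<dots> \<le> W / 1" using W sD by (intro divide_left_mono) auto
    finally show ?thesis by simp
  qed
  moreover have "W = 2 * sqrt R" by (rule W_def)
  moreover have "finite (Sigma {1..n} X)" using X(1) by blast
  ultimately show ?thesis unfolding eq by (auto simp: abs_le_iff)
qed

text \<open>Here \<open>T\<close> and \<open>V\<close> are both even. Halving \<open>V\<close>
  halves the semi-axes in the sum, while even \<open>T\<close> up to twice the height number about
  the height itself.\<close>

lemma card_ellipse_points_12:
  assumes sf: "squarefree D" "D > 0" and D: "D mod 4 \<noteq> 3" and R: "R > 0"
  shows "finite (ellipse_points D R) \<and>
         \<bar>real (card (ellipse_points D R)) - pi / (4 * sqrt D) * R\<bar> \<le> 4 * sqrt R"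
proof -
  define W where "W = sqrt R"
  have W: "W > 0" "W\<^sup>2 = R" using R by (simp_all add: W_def)
  define n where "n = nat \<lfloor>W / sqrt D\<rfloor>"
  define X where "X = (\<lambda>V. {T. 0 < T \<and> even (T + 0) \<and> real T \<le> 2 * sqrt (W\<^sup>2 - D * (real V)\<^sup>2)})"
  have sD: "sqrt D \<ge> 1" using sf by simp
  have in_n: "real V \<le> W / sqrt D \<longleftrightarrow> D * (real V)\<^sup>2 \<le> W\<^sup>2" for V :: nat
  proof -
    have "real V \<le> W / sqrt D \<longleftrightarrow> sqrt D * real V \<le> W" using sD by (simp add: field_simps)
    also have "\<dots> \<longleftrightarrow> (sqrt D * real V)\<^sup>2 \<le> W\<^sup>2" using W by (intro sym[OF power_mono_iff]) auto
    finally show ?thesis by (simp add: power_mult_distrib)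
  qed
  have n: "V \<le> n \<longleftrightarrow> D * (real V)\<^sup>2 \<le> W\<^sup>2" for V
    unfolding in_n[symmetric] n_def using W sD by (simp add: le_nat_iff le_floor_iff)
  have eq: "ellipse_points D R = map_prod (\<lambda>V. 2 * V) id ` Sigma {1..n} X"
  proof (intro equalityI subsetI)
    fix z assume "z \<in> ellipse_points D R"
    then obtain V T where z: "z = (2 * V, T)" "0 < V" "0 < T" "even T" "real (T\<^sup>2 + D * (2 * V)\<^sup>2) \<le> 4 * R"
      using D by (auto simp: ellipse_points_def four_dvd_norm_form[OF sf(1)] elim!: evenE)
    have "(real T / 2)\<^sup>2 \<le> W\<^sup>2 - D * (real V)\<^sup>2"
      using z(5) by (simp add: W power_mult_distrib power_divide field_simps)
    hence "D * (real V)\<^sup>2 \<le> W\<^sup>2" "real T / 2 \<le> sqrt (W\<^sup>2 - D * (real V)\<^sup>2)"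
      using zero_le_power2[of "real T / 2"] by (linarith, intro real_le_rsqrt)
    hence "(V, T) \<in> Sigma {1..n} X" using z n by (auto simp: X_def)
    thus "z \<in> map_prod (\<lambda>V. 2 * V) id ` Sigma {1..n} X" unfolding z(1) by force
  next
    fix z assume "z \<in> map_prod (\<lambda>V. 2 * V) id ` Sigma {1..n} X"
    then obtain V T where z: "z = (2 * V, T)" "1 \<le> V" "V \<le> n" "0 < T" "even T"
        "real T \<le> 2 * sqrt (W\<^sup>2 - D * (real V)\<^sup>2)"
      by (auto simp: X_def)
    have "(real T)\<^sup>2 \<le> (2 * sqrt (W\<^sup>2 - D * (real V)\<^sup>2))\<^sup>2"
      using z(6) by (intro power_mono) auto
    also have "\<dots> = 4 * (W\<^sup>2 - D * (real V)\<^sup>2)"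
      using z n[of V] by (simp add: power_mult_distrib)
    finally show "z \<in> ellipse_points D R"
      using z D by (simp add: ellipse_points_def four_dvd_norm_form[OF sf(1)] W power_mult_distrib)
  qed
  have "inj_on (map_prod (\<lambda>V. 2 * V) id) (Sigma {1..n} X)"
    by (auto simp: inj_on_def)
  hence card: "card (ellipse_points D R) = card (Sigma {1..n} X)"
    unfolding eq by (rule card_image)
  have X: "finite (X V)" "\<bar>real (card (X V)) - 2 * sqrt (W\<^sup>2 - D * (real V)\<^sup>2) / 2\<bar> \<le> 1" if "V \<in> {1..n}" for V
    unfolding X_def by (rule card_parity_interval; use that n[of V] in force)+
  have "\<bar>real (card (Sigma {1..n} X)) - (\<Sum>V=1..n. 2 * sqrt (W\<^sup>2 - D * (real V)\<^sup>2) / 2)\<bar> \<le> 1 * real n"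
    by (rule card_Sigma_bound[OF X])
  moreover have "\<bar>(\<Sum>V=1..n. sqrt (W\<^sup>2 - D * (real V)\<^sup>2)) - pi * W\<^sup>2 / (4 * sqrt D)\<bar> \<le> W"
    unfolding n_def using sf by (intro sum_ellipse_bound W) auto
  moreover have "pi * W\<^sup>2 / (4 * sqrt D) = pi / (4 * sqrt D) * R"
    by (simp add: W)
  moreover have "real n \<le> W"
  proof -
    have "real n \<le> W / sqrt D" using W sD by (simp add: n_def)
    also have "\<dots> \<le> W / 1" using W sD by (intro divide_left_mono) auto
    finally show ?thesis by simp
  qed
  moreover have "W = sqrt R" by (rule W_def)
  moreover have "finite (ellipse_points D R)" unfolding eq using X(1) by blast
  ultimately show ?thesis unfolding card by (auto simp: abs_le_iff)
qed

text \<open>The condition on \<open>E\<close> says that \<open>y^2 - sqrt M * y + E\<close> is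
  negative at 2, so that 2 separates its roots; \<open>E > 0\<close> makes the smaller root
  positive.\<close>

definition parabola_points :: "real \<Rightarrow> (nat \<times> nat) set" where
  "parabola_points R = {(M, E). 0 < M \<and> 0 < E \<and> real E + 4 < 2 * sqrt (real M) \<and> sqrt (real M) \<le> R}"

lemma sum_sqrt_bound:
  "4 / 3 * real n * sqrt (real n) \<le> 2 * (\<Sum>m=1..n. sqrt (real m)) \<and>
   2 * (\<Sum>m=1..n. sqrt (real m)) \<le> 4 / 3 * real n * sqrt (real n) + 2 * sqrt (real n)"
proof (induction n)
  case (Suc n)
  define a where "a = sqrt (real n)"
  define b where "b = sqrt (real (Suc n))"
  have ab: "0 \<le> a" "a \<le> b" "b\<^sup>2 - a\<^sup>2 = 1" "real n = a\<^sup>2" "real (Suc n) = b\<^sup>2"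
    by (simp_all add: a_def b_def)
  have "4 / 3 * b\<^sup>2 * b - 4 / 3 * a\<^sup>2 * a = 4 / 3 * (b - a) * (b\<^sup>2 + a * b + a\<^sup>2)"
    by (simp add: power2_eq_square algebra_simps)
  \<comment> \<open>The factor \<open>b^2 - a^2 = 1\<close> makes both step inequalities homogeneous
    cubics in \<open>a\<close> and \<open>b\<close>, and each difference is then visibly
    nonnegative.\<close>
  moreover have "2 * b = 2 * b * (b\<^sup>2 - a\<^sup>2)" "2 * a = 2 * a * (b\<^sup>2 - a\<^sup>2)" using ab by simp_all
  moreover have "2 * b * (b\<^sup>2 - a\<^sup>2) - 4 / 3 * (b - a) * (b\<^sup>2 + a * b + a\<^sup>2)
       = 2 / 3 * (b - a)\<^sup>2 * (b + 2 * a)"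
    by (simp add: power2_eq_square field_simps)
  moreover have "4 / 3 * (b - a) * (b\<^sup>2 + a * b + a\<^sup>2) - 2 * a * (b\<^sup>2 - a\<^sup>2)
       = 2 / 3 * (b - a)\<^sup>2 * (2 * b + a)"
    by (simp add: power2_eq_square field_simps)
  moreover have "2 / 3 * (b - a)\<^sup>2 * (b + 2 * a) \<ge> 0" "2 / 3 * (b - a)\<^sup>2 * (2 * b + a) \<ge> 0"
    using ab by (auto intro!: mult_nonneg_nonneg)
  ultimately have step: "4 / 3 * b\<^sup>2 * b - 4 / 3 * a\<^sup>2 * a \<le> 2 * b" "2 * a \<le> 4 / 3 * b\<^sup>2 * b - 4 / 3 * a\<^sup>2 * a"
    by linarith+
  have IH: "4 / 3 * a\<^sup>2 * a \<le> 2 * (\<Sum>m=1..n. sqrt (real m))"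
    "2 * (\<Sum>m=1..n. sqrt (real m)) \<le> 4 / 3 * a\<^sup>2 * a + 2 * a"
    using Suc.IH unfolding a_def[symmetric] unfolding ab(4) by blast+
  have sum: "2 * (\<Sum>m=1..Suc n. sqrt (real m)) = 2 * (\<Sum>m=1..n. sqrt (real m)) + 2 * b"
    by (simp add: b_def)
  show ?case
    unfolding sum unfolding b_def[symmetric] unfolding ab(5) using step IH by linarith
qed auto

lemma card_parabola_points:
  assumes R: "R \<ge> 1"
  shows "finite (parabola_points R) \<and> \<bar>real (card (parabola_points R)) - 4 / 3 * R ^ 3\<bar> \<le> 10 * R\<^sup>2"
proof -
  define n where "n = nat \<lfloor>R\<^sup>2\<rfloor>"
  \<comment> \<open>The strict bound \<open>E < 2 * sqrt M - 4\<close> turns into the ceiling minus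
    1. The error 5 below consists of the offset 4 and a rounding error of at most 1.\<close>
  define X where "X = (\<lambda>M::nat. {1..nat (\<lceil>2 * sqrt (real M) - 4\<rceil> - 1)})"
  have n: "real n \<le> R\<^sup>2" "R\<^sup>2 < real n + 1"
    using zero_le_power2[of R] unfolding n_def by linarith+
  have mem: "M \<le> n \<longleftrightarrow> sqrt (real M) \<le> R" for M
  proof -
    have "sqrt (real M) \<le> R \<longleftrightarrow> real M \<le> R\<^sup>2" using R by (auto simp: real_sqrt_le_iff' intro: real_le_lsqrt sqrt_le_D)
    also have "\<dots> \<longleftrightarrow> M \<le> n" using n by linarith
    finally show ?thesis by simp
  qed
  have memX: "E \<in> X M \<longleftrightarrow> 0 < E \<and> real E + 4 < 2 * sqrt (real M)" for E M
  proof -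
    have "real E + 4 < 2 * sqrt (real M) \<longleftrightarrow> int E < \<lceil>2 * sqrt (real M) - 4\<rceil>"
      unfolding less_ceiling_iff by auto
    thus ?thesis unfolding X_def by auto
  qed
  have eq: "parabola_points R = Sigma {1..n} X"
    by (auto simp: parabola_points_def memX mem)
  have X: "finite (X M)" "\<bar>real (card (X M)) - 2 * sqrt (real M)\<bar> \<le> 5" if "M \<in> {1..n}" for M
  proof -
    show "finite (X M)" by (simp add: X_def)
    define y where "y = 2 * sqrt (real M) - 4"
    have y: "y \<ge> -4" by (simp add: y_def)
    have "real (card (X M)) = real (nat (\<lceil>y\<rceil> - 1))" by (simp add: X_def y_def)
    hence "\<bar>real (card (X M)) - (y + 4)\<bar> \<le> 5" using y by linarith
    thus "\<bar>real (card (X M)) - 2 * sqrt (real M)\<bar> \<le> 5" by (simp add: y_def)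
  qed
  have 1: "\<bar>real (card (Sigma {1..n} X)) - (\<Sum>M=1..n. 2 * sqrt (real M))\<bar> \<le> 5 * real n"
    by (rule card_Sigma_bound[OF X])
  have 2: "(\<Sum>M=1..n. 2 * sqrt (real M)) = 2 * (\<Sum>M=1..n. sqrt (real M))"
    by (simp add: sum_distrib_left)
  have sn: "sqrt (real n) \<le> R" using mem[of n] by simp
  have sn2: "R - 1 \<le> sqrt (real n)"
  proof (rule real_le_rsqrt)
    have "(R - 1)\<^sup>2 \<le> R\<^sup>2 - 1" using R by (simp add: power2_eq_square algebra_simps)
    thus "(R - 1)\<^sup>2 \<le> real n" using n by linarith
  qed
  define q where "q = real n * sqrt (real n)"
  define S where "S = 2 * (\<Sum>M=1..n. sqrt (real M))"
  define r2 where "r2 = R\<^sup>2"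
  define r3 where "r3 = R ^ 3"
  have "q \<le> R\<^sup>2 * R" unfolding q_def using n sn R by (intro mult_mono) auto
  hence up: "q \<le> r3" by (simp add: r3_def power2_eq_square power3_eq_cube)
  have "(R\<^sup>2 - 1) * (R - 1) \<le> q" unfolding q_def using n sn2 R by (intro mult_mono) auto
  hence low: "r3 - r2 - R + 1 \<le> q"
    by (simp add: r2_def r3_def power2_eq_square power3_eq_cube algebra_simps)
  have "R \<le> r2" "real n \<le> r2" "1 \<le> r2" using one_le_power[OF R, of 2] R n
    by (simp_all add: r2_def self_le_power)
  moreover have "4 / 3 * q \<le> S" "S \<le> 4 / 3 * q + 2 * sqrt (real n)"
    using sum_sqrt_bound[of n] by (simp_all add: q_def S_def mult.assoc)
  moreover have "\<bar>real (card (Sigma {1..n} X)) - S\<bar> \<le> 5 * real n"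
    using 1 unfolding 2 S_def .
  ultimately have "\<bar>real (card (Sigma {1..n} X)) - 4 / 3 * r3\<bar> \<le> 10 * r2"
    using up low sn unfolding abs_le_iff by linarith
  moreover have "finite (Sigma {1..n} X)" using X(1) by blast
  ultimately show ?thesis unfolding eq r2_def r3_def by blast
qed

section \<open>Counting square-rootable Salem numbers\<close>

text \<open>A selector of the relation is injective. Both counts of Salem numbers below use this in
  each direction between numbers and lattice points.\<close>

lemma inj_relation_finite_card:
  assumes B: "finite B" and ex: "\<And>a. a \<in> A \<Longrightarrow> \<exists>b\<in>B. r a b"
    and inj: "\<And>a a' b. a \<in> A \<Longrightarrow> a' \<in> A \<Longrightarrow> r a b \<Longrightarrow> r a' b \<Longrightarrow> a = a'"
  shows "finite A" "card A \<le> card B"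
proof -
  obtain f where f: "\<And>a. a \<in> A \<Longrightarrow> f a \<in> B \<and> r a (f a)" using ex by metis
  hence "inj_on f A" by (intro inj_onI) (metis inj)
  moreover have "f ` A \<subseteq> B" using f by blast
  ultimately show "finite A" "card A \<le> card B"
    using B by (auto intro: inj_on_finite card_inj_on_le)
qed

section \<open>The correspondence between \<open>x\<close>, \<open>s\<close> and lattice
  points\<close>

lemma sqrt_trace_inj:
  assumes "x > 1" "y > 1" "sqrt_trace x = sqrt_trace y"
  shows "x = y"
proof -
  define a b where "a = sqrt x" and "b = sqrt y"
  have ab: "a > 1" "b > 1" using assms by (auto simp: a_def b_def)
  have "(a - b) * (a * b - 1) = 0"
    using assms(3) ab unfolding sqrt_trace_def a_def[symmetric] b_def[symmetric]
    by (simp add: field_simps)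
  moreover have "a * b > 1" using ab by (simp add: less_1_mult)
  ultimately have "a = b" by simp
  thus ?thesis by (simp add: a_def b_def)
qed

lemma sqrt_trace_surj:
  assumes "s > 2"
  obtains x where "x > 1" "sqrt_trace x = s"
proof -
  define w where "w = sqrt (s\<^sup>2 - 4)"
  define a where "a = (s + w) / 2"
  have "s\<^sup>2 > 2\<^sup>2" using assms by (intro power_strict_mono) auto
  hence w: "w \<ge> 0" "w\<^sup>2 = s\<^sup>2 - 4" by (auto simp: w_def)
  have a: "a > 1" using assms w by (simp add: a_def)
  have "a * (s - a) = 1"
    using w(2) by (simp add: a_def power2_eq_square field_simps)
  hence "1 / a = s - a" using a by (simp add: field_simps)
  moreover have "sqrt (a\<^sup>2) = a" using a by simp
  ultimately have "sqrt_trace (a\<^sup>2) = s" by (simp add: sqrt_trace_def)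
  moreover have "a\<^sup>2 > 1" using a by (simp add: one_less_power)
  ultimately show thesis using that by blast
qed

lemma sqrt_trace_bounds:
  assumes "x > 1"
  shows "sqrt x < sqrt_trace x" "sqrt_trace x < sqrt x + 1"
  using assms by (simp_all add: sqrt_trace_def)

lemma rational_multiple_irrational:
  fixes s :: real
  assumes "s \<notin> \<rat>" "k \<in> \<rat>" "k * s \<in> \<rat>"
  shows "k = 0"
proof (rule ccontr)
  assume "k \<noteq> 0"
  hence "s = (k * s) / k" by simp
  also have "\<dots> \<in> \<rat>" using assms by (intro Rats_divide)
  finally show False using assms by simp
qed

definition root_pair :: "nat \<times> nat \<Rightarrow> real \<Rightarrow> real \<Rightarrow> bool" where
  "root_pair = (\<lambda>(M, E) s s'. 2 < s \<and> 0 < s' \<and> s' < 2 \<and> s * s' = real E \<and> (s + s')\<^sup>2 = real M)"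

lemma root_pair_exists:
  assumes "(M, E) \<in> parabola_points R"
  shows "\<exists>s s'. root_pair (M, E) s s'"
proof -
  define u where "u = sqrt (real M)"
  define w where "w = sqrt (real M - 4 * real E)"
  have ME: "0 < M" "0 < E" "real E + 4 < 2 * u" using assms by (auto simp: parabola_points_def u_def)
  have u: "u > 0" "u\<^sup>2 = real M" using ME by (auto simp: u_def)
  \<comment> \<open>This restates \<open>E + 4 < 2 * u\<close>. The root \<open>w\<close> of the
    discriminant then satisfies \<open>\<bar>u - 4\<bar> < w < u\<close>, which is what places
    \<open>(u + w) / 2\<close> above 2 and \<open>(u - w) / 2\<close> between 0 and 2.\<close>
  have "(u - 4)\<^sup>2 < real M - 4 * real E"
    using ME(3) u(2) by (simp add: power2_eq_square algebra_simps)
  hence w: "\<bar>u - 4\<bar> < w" unfolding w_def by (rule real_less_rsqrt[of "\<bar>u - 4\<bar>", simplified])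
  hence "real M - 4 * real E > 0" unfolding w_def by (metis abs_ge_zero le_less_trans real_sqrt_gt_0_iff)
  hence w2: "w\<^sup>2 = u\<^sup>2 - 4 * real E" by (simp add: w_def u(2))
  have "w\<^sup>2 < u\<^sup>2" using w2 ME by simp
  hence "w < u" using u by (intro power2_less_imp_less[of w u]) auto
  have "(u + w) / 2 * ((u - w) / 2) = (u\<^sup>2 - w\<^sup>2) / 4"
    by (simp add: power2_eq_square field_simps)
  hence "(u + w) / 2 * ((u - w) / 2) = real E" using w2 by simp
  moreover have "((u + w) / 2 + (u - w) / 2)\<^sup>2 = real M" using u(2) by (simp add: field_simps)
  moreover have "2 < (u + w) / 2" "0 < (u - w) / 2" "(u - w) / 2 < 2"
    using w \<open>w < u\<close> by (auto simp: abs_less_iff)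
  ultimately have "root_pair (M, E) ((u + w) / 2) ((u - w) / 2)" unfolding root_pair_def by simp
  thus ?thesis by blast
qed

lemma root_pair_sqrt: "root_pair (M, E) s s' \<Longrightarrow> sqrt (real M) = s + s'"
  unfolding root_pair_def by (auto intro!: real_sqrt_unique)

lemma root_pair_unique:
  assumes "root_pair z s s'" "root_pair z t t'"
  shows "s = t"
proof -
  obtain M E where z: "z = (M, E)" by (cases z)
  have "s + s' = t + t'" using assms root_pair_sqrt unfolding z by metis
  moreover have "s * s' = t * t'" using assms by (auto simp: root_pair_def z)
  ultimately have "(s - t) * (s - t') = 0" by algebra
  moreover have "s > t'" using assms by (auto simp: root_pair_def z)
  ultimately show ?thesis by simp
qed

text \<open>Since \<open>s^2 + s'^2 = M - 2 * E\<close>, the difference \<open>k\<close> of the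
  squares of the smaller roots is rational. So is \<open>k * s^2\<close>, a difference of squares of
  integers, hence \<open>k = 0\<close>.\<close>

lemma root_pair_irrational_unique:
  assumes 1: "root_pair (M, E) s s'" and 2: "root_pair (M', E') s t'" and irr: "s\<^sup>2 \<notin> \<rat>"
  shows "(M, E) = (M', E')"
proof -
  define k where "k = s'\<^sup>2 - t'\<^sup>2"
  have "k = (real M - 2 * real E) - (real M' - 2 * real E')"
    using 1 2 by (simp add: root_pair_def k_def power2_sum)
  hence k: "k \<in> \<rat>" by auto
  have "k * s\<^sup>2 = (s * s')\<^sup>2 - (s * t')\<^sup>2" by (simp add: k_def power_mult_distrib algebra_simps)
  also have "\<dots> = (real E)\<^sup>2 - (real E')\<^sup>2" using 1 2 by (simp add: root_pair_def)
  also have "\<dots> \<in> \<rat>" by auto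
  finally have "k = 0" using rational_multiple_irrational[OF irr k] by blast
  hence "s' = t'" using 1 2 by (simp add: k_def root_pair_def power2_eq_iff_nonneg)
  thus ?thesis using 1 2 by (simp add: root_pair_def)
qed

text \<open>At these points the number \<open>x\<close> with \<open>sqrt_trace x = s\<close> has
  degree at most two, so they must be removed from the count.\<close>

definition degenerate_points :: "real \<Rightarrow> (nat \<times> nat) set" where
  "degenerate_points R = {z \<in> parabola_points R. \<exists>s s'. root_pair z s s' \<and> s\<^sup>2 \<in> \<rat>}"

text \<open>In the degenerate case the squares of both roots are integers, that of the smaller root
  being \<open>1\<close>, \<open>2\<close> or \<open>3\<close>.\<close>

lemma card_degenerate_points:
  assumes R: "R \<ge> 0"
  shows "real (card (degenerate_points R)) \<le> 3 * (R\<^sup>2 + 1)"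
proof -
  define k where "k = nat \<lfloor>R\<^sup>2\<rfloor>"
  \<comment> \<open>The possible values of the pair \<open>(s^2, s'^2)\<close>, which determines the
    lattice point.\<close>
  define B where "B = {0..k} \<times> {1, 2, 3 :: nat}"
  define r where "r = (\<lambda>z (a, b). \<exists>s s'. root_pair z s s' \<and> s\<^sup>2 = real a \<and> s'\<^sup>2 = real b)"
  have "card (degenerate_points R) \<le> card B"
  proof (rule inj_relation_finite_card)
    show "finite B" by (simp add: B_def)
    fix z assume "z \<in> degenerate_points R"
    then obtain M E s s' where z: "z = (M, E)" "z \<in> parabola_points R" "root_pair z s s'" "s\<^sup>2 \<in> \<rat>"
      unfolding degenerate_points_def by (cases z) blast
    have rp: "2 < s" "0 < s'" "s' < 2" "s * s' = real E" "(s + s')\<^sup>2 = real M"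
      using z(3) by (auto simp: root_pair_def z(1))
    have sum: "s\<^sup>2 + s'\<^sup>2 = real M - 2 * real E" using rp by (simp add: power2_sum)
    have prod: "s\<^sup>2 * s'\<^sup>2 = (real E)\<^sup>2" using rp by (simp flip: power_mult_distrib)
    have "s\<^sup>2 \<in> \<int>"
    proof (rule rational_root_monic_quadratic_int[OF z(4)])
      show "(s\<^sup>2)\<^sup>2 + - (real M - 2 * real E) * s\<^sup>2 + (real E)\<^sup>2 = 0"
        unfolding sum[symmetric] prod[symmetric] by (simp add: power2_eq_square algebra_simps)
    qed auto
    then obtain a where a: "s\<^sup>2 = of_int a" by (auto elim: Ints_cases)
    have b: "s'\<^sup>2 = of_int (int M - 2 * int E - a)" using sum a by simp
    have "s'\<^sup>2 < 2\<^sup>2" using rp by (intro power_strict_mono) auto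
    hence "s'\<^sup>2 < 4" by simp
    moreover have "s'\<^sup>2 > 0" using rp by simp
    ultimately have b': "0 < int M - 2 * int E - a" "int M - 2 * int E - a < 4" unfolding b by linarith+
    have "a \<ge> 0" using a by (metis of_int_0_le_iff zero_le_power2)
    have "s \<le> sqrt (real M)" using root_pair_sqrt[OF z(3)[unfolded z(1)]] rp by simp
    also have "\<dots> \<le> R" using z(2) by (simp add: z(1) parabola_points_def)
    finally have "s\<^sup>2 \<le> R\<^sup>2" using rp by (intro power_mono) auto
    hence "nat a \<le> k" unfolding a k_def by (intro nat_mono) (simp add: le_floor_iff)
    moreover have "nat (int M - 2 * int E - a) \<in> {1, 2, 3}" using b' by auto
    moreover have "s\<^sup>2 = real (nat a)" "s'\<^sup>2 = real (nat (int M - 2 * int E - a))"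
      using a b b' \<open>a \<ge> 0\<close> by simp_all
    ultimately have "(nat a, nat (int M - 2 * int E - a)) \<in> B \<and> r z (nat a, nat (int M - 2 * int E - a))"
      using z(3) unfolding B_def r_def by auto
    thus "\<exists>b\<in>B. r z b" by blast
  next
    fix z z' b assume "r z b" "r z' b"
    then obtain s s' t t' where *: "root_pair z s s'" "root_pair z' t t'" "s\<^sup>2 = t\<^sup>2" "s'\<^sup>2 = t'\<^sup>2"
      unfolding r_def by (cases b) fastforce
    obtain M E M' E' where z: "z = (M, E)" "z' = (M', E')" by (cases z, cases z')
    have "s = t" "s' = t'"
      using * by (auto simp: z root_pair_def power2_eq_iff_nonneg)
    thus "z = z'" using * by (simp add: z root_pair_def)
  qed
  also have "card B = 3 * (k + 1)" by (simp add: B_def card_cartesian_product)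
  finally have "real (card (degenerate_points R)) \<le> real (3 * (k + 1))"
    by (simp only: of_nat_le_iff)
  hence "real (card (degenerate_points R)) \<le> 3 * (real k + 1)" by simp
  moreover have "real k \<le> R\<^sup>2" using zero_le_power2[of R] unfolding k_def by linarith
  ultimately show ?thesis by argo
qed

text \<open>The shift 3 comes from \<open>sqrt M = s + s' < (sqrt x + 1) + 2\<close>. The lower
  bound uses \<open>sqrt x < s < sqrt M\<close> and so keeps the radius
  \<open>sqrt Q\<close>.\<close>

lemma card_square_rootable_salem4:
  assumes Q: "Q \<ge> 1"
  defines "S \<equiv> {x. square_rootable_salem4 x \<and> x \<le> Q}"
  shows "card S \<le> card (parabola_points (sqrt Q + 3))"
    and "card (parabola_points (sqrt Q)) \<le> card S + card (degenerate_points (sqrt Q))"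
proof -
  define r where "r = (\<lambda>x z. \<exists>s'. root_pair z (sqrt_trace x) s')"
  have fin: "finite (parabola_points R)" if "R \<ge> 1" for R using card_parabola_points[OF that] by simp
  have sQ: "sqrt Q \<ge> 1" using Q by simp
  have 1: "\<exists>z\<in>parabola_points (sqrt Q + 3). r x z" if "x \<in> S" for x
  proof -
    have x: "square_rootable_salem4 x" "x \<le> Q" using that by (auto simp: S_def)
    hence x1: "x > 1" by (auto simp: square_rootable_salem4_def salem_number_def)
    define s where "s = sqrt_trace x"
    obtain M E s' where ME: "M > 0" "E > 0" "0 < s'" "s' < 2"
        "s * s' = of_int E" "(s + s')\<^sup>2 = of_int M"
      using square_rootable_salem4_imp[OF x(1)] unfolding s_def by metis
    have s2: "s > 2" unfolding s_def using x1 by (rule sqrt_trace_gt_2)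
    have rp: "root_pair (nat M, nat E) s s'"
      using ME s2 by (simp add: root_pair_def)
    have "s < sqrt x + 1" unfolding s_def using x1 by (rule sqrt_trace_bounds)
    moreover have "sqrt x \<le> sqrt Q" using x by simp
    ultimately have "sqrt (real (nat M)) \<le> sqrt Q + 3"
      using root_pair_sqrt[OF rp] ME by linarith
    \<comment> \<open>Expanded, this is exactly \<open>E + 4 < 2 * (s + s')\<close>.\<close>
    moreover have "(s - 2) * (2 - s') > 0" using s2 ME by simp
    hence "real (nat E) + 4 < 2 * sqrt (real (nat M))"
      using root_pair_sqrt[OF rp] ME by (simp add: algebra_simps)
    ultimately have "(nat M, nat E) \<in> parabola_points (sqrt Q + 3)"
      using ME by (simp add: parabola_points_def)
    thus ?thesis using rp unfolding r_def s_def by blast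
  qed
  have 2: "x = y" if "x \<in> S" "y \<in> S" "r x z" "r y z" for x y z
  proof -
    have "x > 1" "y > 1"
      using that by (auto simp: S_def square_rootable_salem4_def salem_number_def)
    moreover have "sqrt_trace x = sqrt_trace y" using that root_pair_unique unfolding r_def by metis
    ultimately show ?thesis by (rule sqrt_trace_inj)
  qed
  have finS: "finite S" and "card S \<le> card (parabola_points (sqrt Q + 3))"
    using inj_relation_finite_card[where r = r, OF fin[of "sqrt Q + 3"] 1 2] sQ by auto
  thus "card S \<le> card (parabola_points (sqrt Q + 3))" by simp
  define r' where "r' = (\<lambda>z x. (\<exists>s'. root_pair z (sqrt_trace x) s') \<and> (sqrt_trace x)\<^sup>2 \<notin> \<rat>)"
  have 3: "\<exists>x\<in>S. r' z x" if "z \<in> parabola_points (sqrt Q) - degenerate_points (sqrt Q)" for z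
  proof -
    obtain M E where z: "z = (M, E)" by (cases z)
    have zp: "(M, E) \<in> parabola_points (sqrt Q)" using that z by simp
    from root_pair_exists[OF zp] obtain s s' where rp: "root_pair (M, E) s s'" by blast
    hence irr: "s\<^sup>2 \<notin> \<rat>" using that unfolding degenerate_points_def z by blast
    have s: "2 < s" "0 < s'" "s' < 2" "s * s' = real E" "(s + s')\<^sup>2 = real M"
      using rp by (auto simp: root_pair_def)
    from sqrt_trace_surj[OF s(1)] obtain x where x: "x > 1" "sqrt_trace x = s" by blast
    have "square_rootable_salem4 x"
      using s x irr by (intro square_rootable_salem4I[of x s' "int E" "int M"]) auto
    moreover have "sqrt (real M) \<le> sqrt Q"
      using zp unfolding parabola_points_def by blast
    hence "sqrt x \<le> sqrt Q"
      using sqrt_trace_bounds(1)[OF x(1)] root_pair_sqrt[OF rp] s(2) unfolding x(2) by linarith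
    hence "x \<le> Q" by simp
    ultimately have "x \<in> S" by (simp add: S_def)
    thus ?thesis using rp irr x unfolding r'_def z by blast
  qed
  have 4: "z = z'" if "r' z x" "r' z' x" for z z' x
    using that root_pair_irrational_unique unfolding r'_def by (cases z, cases z') blast
  have "card (parabola_points (sqrt Q) - degenerate_points (sqrt Q)) \<le> card S"
    by (rule inj_relation_finite_card(2)[where r = r', OF finS 3 4])
  moreover have "card (parabola_points (sqrt Q)) - card (degenerate_points (sqrt Q))
     \<le> card (parabola_points (sqrt Q) - degenerate_points (sqrt Q))"
    by (rule diff_card_le_card_Diff, rule finite_subset[OF _ fin[OF sQ]]) (auto simp: degenerate_points_def)
  ultimately show "card (parabola_points (sqrt Q)) \<le> card S + card (degenerate_points (sqrt Q))"
    by linarith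
qed

lemma square_rootable_salem4_asymptotics:
  assumes Q: "Q \<ge> 1"
  shows "\<bar>real (card {x. square_rootable_salem4 x \<and> x \<le> Q}) - 4 / 3 * sqrt Q ^ 3\<bar> \<le> 250 * Q"
proof -
  define r where "r = sqrt Q"
  define c where "c = real (card {x. square_rootable_salem4 x \<and> x \<le> Q})"
  have r: "r \<ge> 1" "r\<^sup>2 = Q" using Q by (simp_all add: r_def)
  have rr: "r \<le> Q" "1 \<le> Q" using r Q self_le_power[of r 2] by auto
  have "c \<le> real (card (parabola_points (r + 3)))"
    unfolding c_def r_def using card_square_rootable_salem4(1)[OF Q] by simp
  also have "\<dots> \<le> 4 / 3 * (r + 3) ^ 3 + 10 * (r + 3)\<^sup>2"
    using card_parabola_points[of "r + 3"] r by (simp add: abs_le_iff)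
  also have "(r + 3) ^ 3 = r ^ 3 + 9 * Q + 27 * r + 27"
    unfolding r(2)[symmetric] by (simp add: power2_eq_square power3_eq_cube algebra_simps)
  also have "(r + 3)\<^sup>2 = Q + 6 * r + 9"
    unfolding r(2)[symmetric] by (simp add: power2_eq_square algebra_simps)
  finally have "c \<le> 4 / 3 * r ^ 3 + 22 * Q + 96 * r + 126" by (simp add: algebra_simps)
  \<comment> \<open>Both \<open>r\<close> and 1 are at most \<open>Q\<close>, and
    \<open>22 + 96 + 126 = 244\<close>.\<close>
  hence up: "c \<le> 4 / 3 * r ^ 3 + 250 * Q" using rr by linarith
  have "real (card (parabola_points r)) \<le> c + real (card (degenerate_points r))"
    unfolding c_def r_def using card_square_rootable_salem4(2)[OF Q] by linarith
  moreover have "real (card (degenerate_points r)) \<le> 3 * (Q + 1)"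
    using card_degenerate_points[of r] r by simp
  moreover have "4 / 3 * r ^ 3 - 10 * Q \<le> real (card (parabola_points r))"
    using card_parabola_points[of r] r by (simp add: abs_le_iff)
  ultimately have "4 / 3 * r ^ 3 - 250 * Q \<le> c" using rr by argo
  with up show ?thesis unfolding r_def c_def by (simp add: abs_le_iff)
qed

section \<open>Integers of imaginary quadratic fields\<close>

definition sqrt_neg :: "nat \<Rightarrow> complex" where
  "sqrt_neg D = \<i> * of_real (sqrt (real D))"

lemma sqrt_neg_square: "sqrt_neg D * sqrt_neg D = - of_nat D"
proof -
  have "complex_of_real (sqrt (real D)) * complex_of_real (sqrt (real D)) = of_nat D"
    by (metis of_real_mult of_real_of_nat_eq of_nat_0_le_iff real_sqrt_mult_self abs_of_nonneg)
  hence "\<i> * \<i> * (complex_of_real (sqrt (real D)) * complex_of_real (sqrt (real D))) = - of_nat D"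
    by simp
  thus ?thesis unfolding sqrt_neg_def by (simp only: mult_ac)
qed

text \<open>The field is an intersection of subfields, so it suffices that the rational combinations
  of 1 and \<open>sqrt_neg D\<close> form a subfield; inverses come from the norm.\<close>

lemma imag_quadratic_fieldE:
  assumes "t \<in> imag_quadratic_field D" "D > 0"
  obtains x y :: real where "x \<in> \<rat>" "y \<in> \<rat>" "t = of_real x + of_real y * sqrt_neg D"
proof -
  define F where "F = {of_real x + of_real y * sqrt_neg D | x y :: real. x \<in> \<rat> \<and> y \<in> \<rat>}"
  have FI: "of_real x + of_real y * sqrt_neg D \<in> F" if "x \<in> \<rat>" "y \<in> \<rat>" for x y :: real
    using that by (auto simp: F_def)
  have "is_subfield F"
    unfolding is_subfield_def
  proof (intro conjI ballI)
    show "0 \<in> F" "1 \<in> F" using FI[of 0 0] FI[of 1 0] by simp_all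
  next
    fix u v assume "u \<in> F" "v \<in> F"
    then obtain x y x' y' where
      u: "u = of_real x + of_real y * sqrt_neg D" "x \<in> \<rat>" "y \<in> \<rat>" and
      v: "v = of_real x' + of_real y' * sqrt_neg D" "x' \<in> \<rat>" "y' \<in> \<rat>"
      by (auto simp: F_def)
    have uv: "u - v = of_real (x - x') + of_real (y - y') * sqrt_neg D"
      by (simp add: u v algebra_simps)
    show "u - v \<in> F" unfolding uv using u v by (intro FI) auto
    have "u * v = of_real x * of_real x' + of_real y * of_real y' * (sqrt_neg D * sqrt_neg D)
             + (of_real x * of_real y' + of_real y * of_real x') * sqrt_neg D"
      by (simp add: u v algebra_simps)
    also have "\<dots> = of_real (x * x' - real D * y * y') + of_real (x * y' + y * x') * sqrt_neg D"
      unfolding sqrt_neg_square by simp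
    finally have uv: "u * v = of_real (x * x' - real D * y * y') + of_real (x * y' + y * x') * sqrt_neg D" .
    show "u * v \<in> F" unfolding uv using u v by (intro FI) auto
  next
    fix u assume "u \<in> F"
    then obtain x y where u: "u = of_real x + of_real y * sqrt_neg D" "x \<in> \<rat>" "y \<in> \<rat>"
      by (auto simp: F_def)
    define n where "n = x\<^sup>2 + real D * y\<^sup>2"
    show "inverse u \<in> F"
    proof (cases "n = 0")
      case True
      have "real D * y\<^sup>2 \<ge> 0" by simp
      hence "x\<^sup>2 = 0" "real D * y\<^sup>2 = 0"
        using True zero_le_power2[of x] unfolding n_def by linarith+
      hence "u = 0" using \<open>D > 0\<close> by (simp add: u)
      thus ?thesis using FI[of 0 0] by simp
    next
      case False
      define w where "w = of_real (x / n) + of_real (- y / n) * sqrt_neg D"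
      have "u * (of_real x - of_real y * sqrt_neg D)
           = of_real x * of_real x - of_real y * of_real y * (sqrt_neg D * sqrt_neg D)"
        by (simp add: u algebra_simps)
      also have "\<dots> = of_real n"
        unfolding sqrt_neg_square by (simp add: n_def power2_eq_square)
      finally have "u * (of_real x - of_real y * sqrt_neg D) = of_real n" .
      moreover have "w = (of_real x - of_real y * sqrt_neg D) / of_real n"
        using False by (simp add: w_def field_simps)
      ultimately have "u * w = 1" using False by simp
      hence "inverse u = w" by (rule inverse_unique)
      moreover have "w \<in> F"
        unfolding w_def using u by (intro FI) (auto simp: n_def)
      ultimately show ?thesis by simp
    qed
  qed
  moreover have "sqrt_neg D \<in> F" using FI[of 0 1] by simp
  ultimately have "imag_quadratic_field D \<subseteq> F"
    unfolding imag_quadratic_field_def generated_subfield_def sqrt_neg_def by blast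
  thus thesis using assms that unfolding F_def by blast
qed

lemma imag_quadratic_fieldI:
  fixes x y :: real
  assumes "x \<in> \<rat>" "y \<in> \<rat>"
  shows "of_real x + of_real y * sqrt_neg D \<in> imag_quadratic_field D"
  unfolding imag_quadratic_field_def generated_subfield_def
proof (rule InterI, clarify)
  fix F :: "complex set" assume F: "is_subfield F" "{\<i> * of_real (sqrt (real D))} \<subseteq> F"
  have rat: "of_real r \<in> F" if "r \<in> \<rat>" for r :: real
  proof -
    from that obtain q where "r = of_rat q" by (rule Rats_cases)
    hence "complex_of_real r \<in> \<rat>" by simp
    moreover have "\<rat> \<subseteq> F"
      using Rats_subset_generated_subfield[of F] F(1) unfolding generated_subfield_def by blast
    ultimately show ?thesis by blast
  qed
  have mult: "u * v \<in> F" and diff: "u - v \<in> F" if "u \<in> F" "v \<in> F" for u v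
    using F(1) that by (auto simp: is_subfield_def)
  have "sqrt_neg D \<in> F" using F(2) by (simp add: sqrt_neg_def)
  hence "of_real x - of_real (- y) * sqrt_neg D \<in> F"
    using assms by (intro diff mult rat) auto
  thus "of_real x + of_real y * sqrt_neg D \<in> F" by simp
qed

definition quad_int :: "nat \<Rightarrow> int \<Rightarrow> int \<Rightarrow> complex" where
  "quad_int D T V = of_real (of_int T / 2) + of_real (of_int V / 2) * sqrt_neg D"

lemma squarefree_denominator:
  fixes w :: real
  assumes "squarefree (D::nat)" "w \<in> \<rat>" "real D * w\<^sup>2 \<in> \<int>"
  shows "w \<in> \<int>"
proof -
  obtain a b :: int where ab: "b > 0" "coprime a b" "w = of_int a / of_int b"
    using assms(2) by (auto elim: Rats_cases')
  obtain k where k: "real D * w\<^sup>2 = of_int k" using assms(3) by (auto elim: Ints_cases)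
  have "real_of_int (int D * a\<^sup>2) = of_int (k * b\<^sup>2)"
    using k ab(1) by (simp add: ab(3) power_divide field_simps)
  hence "int D * a\<^sup>2 = k * b\<^sup>2" by (simp only: of_int_eq_iff)
  hence "b\<^sup>2 dvd int D * a\<^sup>2" by simp
  moreover have "coprime (b\<^sup>2) (a\<^sup>2)" using ab(2) by (simp add: coprime_commute)
  ultimately have "b\<^sup>2 dvd int D" by (simp add: coprime_dvd_mult_left_iff)
  hence "nat (b\<^sup>2) dvd D" using nat_dvd_iff[of "b\<^sup>2" D] by (simp add: nat_dvd_iff)
  hence "(nat b)\<^sup>2 dvd D" using ab(1) by (simp add: nat_power_eq)
  hence "nat b dvd 1" using assms(1) unfolding squarefree_def by blast
  hence "b = 1" using ab(1) by simp
  thus ?thesis using ab by simp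
qed

text \<open>A nonrational element has the minimal polynomial given by its trace \<open>2 * x\<close>
  and norm \<open>x^2 + D * y^2\<close>, which are integers by
  \<open>coeff_min_poly_algebraic_int\<close>. Then \<open>D * (2 * y)^2\<close> is an integer, and
  square-freeness of \<open>D\<close> makes \<open>2 * y\<close> one.\<close>

lemma ring_of_integers_imag_quadratic:
  assumes D: "D > 0" "squarefree D"
  shows "t \<in> ring_of_integers (imag_quadratic_field D) \<longleftrightarrow>
      (\<exists>T V. t = quad_int D T V \<and> 4 dvd T\<^sup>2 + int D * V\<^sup>2)"
proof
  assume "\<exists>T V. t = quad_int D T V \<and> 4 dvd T\<^sup>2 + int D * V\<^sup>2"
  then obtain T V k where t: "t = quad_int D T V" and k: "T\<^sup>2 + int D * V\<^sup>2 = 4 * k"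
    by (auto elim!: dvdE)
  have "t \<in> imag_quadratic_field D"
    unfolding t quad_int_def by (intro imag_quadratic_fieldI) auto
  moreover have "algebraic_int t"
  proof (rule algebraic_int.intros[of "[:of_int k, - of_int T, 1:]"])
    show "\<forall>i. coeff [:of_int k, - of_int T, 1::complex:] i \<in> \<int>"
      by (auto simp: coeff_pCons split: nat.split)
    have k': "of_int (4 * k) = ((of_int T)\<^sup>2 + of_nat D * (of_int V)\<^sup>2 :: complex)"
      unfolding k[symmetric] by simp
    define P where "P = poly [:of_int k, - of_int T, 1:] t"
    have "4 * P = of_int (4 * k) - (of_int T)\<^sup>2
        + (of_int V)\<^sup>2 * (sqrt_neg D * sqrt_neg D)"
      by (simp add: P_def t quad_int_def power2_eq_square field_simps)
    hence "P = 0"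
      unfolding sqrt_neg_square k' by simp
    thus "poly [:of_int k, - of_int T, 1:] t = 0" by (simp only: P_def)
  qed auto
  ultimately show "t \<in> ring_of_integers (imag_quadratic_field D)"
    by (simp add: ring_of_integers_def)
next
  assume "t \<in> ring_of_integers (imag_quadratic_field D)"
  hence t: "t \<in> imag_quadratic_field D" "algebraic_int t"
    by (auto simp: ring_of_integers_def)
  from imag_quadratic_fieldE[OF t(1) D(1)] obtain x y :: real where
    xy: "x \<in> \<rat>" "y \<in> \<rat>" "t = of_real x + of_real y * sqrt_neg D" by metis
  have "2 * x \<in> \<int> \<and> x\<^sup>2 + real D * y\<^sup>2 \<in> \<int>"
  proof (cases "y = 0")
    case True
    hence "algebraic_int x" using t(2) xy(3) by simp
    hence "x \<in> \<int>" using xy(1) by (rule rational_algebraic_int_is_int)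
    thus ?thesis using True by auto
  next
    case False
    define p where "p = [:of_real (x\<^sup>2 + real D * y\<^sup>2), - of_real (2 * x), 1::complex:]"
    have rat: "complex_of_real r \<in> \<rat>" if "r \<in> \<rat>" for r
      using that by (rule Rats_cases) simp
    have "is_min_poly \<rat> t p"
      unfolding is_min_poly_def
    proof (intro conjI ballI impI)
      have "complex_of_real (x\<^sup>2 + real D * y\<^sup>2) \<in> \<rat>" "complex_of_real (2 * x) \<in> \<rat>"
        using xy by (intro rat; auto)+
      thus "p \<in> polys_over \<rat>"
        unfolding p_def by (auto simp: polys_over_def coeff_pCons split: nat.split)
      show "lead_coeff p = 1" by (simp add: p_def)
      have "poly p t = of_nat D * of_real y * of_real y + of_real y * of_real y * (sqrt_neg D * sqrt_neg D)"
        by (simp add: p_def xy(3) power2_eq_square algebra_simps)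
      thus "poly p t = 0" unfolding sqrt_neg_square by simp
      fix q assume q: "q \<in> polys_over \<rat>" "q \<noteq> 0 \<and> poly q t = 0"
      show "degree p \<le> degree q"
      proof (rule ccontr)
        assume "\<not> degree p \<le> degree q"
        hence dq: "degree q < 2" by (simp add: p_def)
        have real: "\<exists>r. w = complex_of_real r" if "w \<in> \<rat>" for w
        proof -
          from that obtain a b where "w = of_int a / of_int b" by (rule Rats_cases')
          hence "w = of_real (of_int a / of_int b)" by simp
          thus ?thesis by blast
        qed
        have "coeff q 0 \<in> \<rat>" "coeff q 1 \<in> \<rat>" using q(1) by (auto simp: polys_over_def)
        then obtain c0 c1 where c: "coeff q 0 = complex_of_real c0" "coeff q 1 = complex_of_real c1"
          using real by blast
        have q_eq: "q = [:of_real c0, of_real c1:]"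
          unfolding c[symmetric] using poly_eq_degree_le_4[of q] dq by (simp add: coeff_eq_0)
        hence root: "of_real c0 + t * of_real c1 = 0" using q(2) by simp
        hence "Im (of_real c0 + t * of_real c1) = 0" by simp
        hence "y * sqrt (real D) * c1 = 0"
          by (simp add: xy(3) sqrt_neg_def)
        hence "c1 = 0" using False D by simp
        hence "c0 = 0" using root by simp
        thus False using q(2) q_eq \<open>c1 = 0\<close> by simp
      qed
    qed
    hence "min_poly \<rat> t = p" by (intro min_poly_eqI is_subfield_Rats)
    hence "coeff p i \<in> \<int>" for i using coeff_min_poly_algebraic_int[OF t(2), of i] by simp
    from this[of 0] this[of 1] have "complex_of_real (x\<^sup>2 + real D * y\<^sup>2) \<in> \<int>" "- complex_of_real (2 * x) \<in> \<int>"
      by (simp_all add: p_def)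
    hence "complex_of_real (x\<^sup>2 + real D * y\<^sup>2) \<in> \<int>" "complex_of_real (2 * x) \<in> \<int>"
      using Ints_minus[of "- complex_of_real (2 * x)"] by simp_all
    moreover have "r \<in> \<int>" if "complex_of_real r \<in> \<int>" for r
    proof -
      from that obtain k where "complex_of_real r = of_int k" by (rule Ints_cases)
      hence "complex_of_real r = of_real (of_int k)" by simp
      thus ?thesis by (simp only: of_real_eq_iff Ints_of_int)
    qed
    ultimately show ?thesis by blast
  qed
  then obtain T k :: int where T: "2 * x = of_int T" and k: "x\<^sup>2 + real D * y\<^sup>2 = of_int k"
    by (auto elim!: Ints_cases)
  have "real D * (2 * y)\<^sup>2 = 4 * (x\<^sup>2 + real D * y\<^sup>2) - (2 * x)\<^sup>2"
    by (simp add: power_mult_distrib)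
  also have "\<dots> = of_int (4 * k - T\<^sup>2)" unfolding T k by simp
  finally have int: "real D * (2 * y)\<^sup>2 \<in> \<int>" by (simp only: Ints_of_int)
  have "2 * y \<in> \<rat>" using xy(2) by simp
  hence "2 * y \<in> \<int>" using int by (rule squarefree_denominator[OF D(2)])
  then obtain V where V: "2 * y = of_int V" by (auto elim: Ints_cases)
  have "real_of_int (T\<^sup>2 + int D * V\<^sup>2) = (2 * x)\<^sup>2 + real D * (2 * y)\<^sup>2"
    unfolding T V by simp
  also have "\<dots> = 4 * (x\<^sup>2 + real D * y\<^sup>2)" by (simp add: power_mult_distrib)
  also have "\<dots> = of_int (4 * k)" unfolding k by simp
  finally have "T\<^sup>2 + int D * V\<^sup>2 = 4 * k" by (simp only: of_int_eq_iff)
  moreover have "of_int T / 2 = x" "of_int V / 2 = y" using T V by simp_all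
  hence "t = quad_int D T V"
    unfolding quad_int_def xy(3) by (simp only:)
  ultimately have "t = quad_int D T V \<and> 4 dvd T\<^sup>2 + int D * V\<^sup>2" by simp
  thus "\<exists>T V. t = quad_int D T V \<and> 4 dvd T\<^sup>2 + int D * V\<^sup>2" by blast
qed

lemma four_dvd_norm_form_int:
  fixes T V :: int and D :: nat
  assumes "squarefree D"
  shows "4 dvd T\<^sup>2 + int D * V\<^sup>2 \<longleftrightarrow> (if D mod 4 = 3 then even (T + V) else even T \<and> even V)"
proof -
  have "int ((nat \<bar>T\<bar>)\<^sup>2 + D * (nat \<bar>V\<bar>)\<^sup>2) = T\<^sup>2 + int D * V\<^sup>2" by simp
  hence "4 dvd T\<^sup>2 + int D * V\<^sup>2 \<longleftrightarrow> int 4 dvd int ((nat \<bar>T\<bar>)\<^sup>2 + D * (nat \<bar>V\<bar>)\<^sup>2)"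
    by (simp only: of_nat_numeral)
  also have "\<dots> \<longleftrightarrow> 4 dvd (nat \<bar>T\<bar>)\<^sup>2 + D * (nat \<bar>V\<bar>)\<^sup>2"
    by (rule int_dvd_int_iff)
  also have "\<dots> \<longleftrightarrow> (if D mod 4 = 3 then even (T + V) else even T \<and> even V)"
    unfolding four_dvd_norm_form[OF assms] by (simp add: even_nat_iff even_add)
  finally show ?thesis .
qed

text \<open>Read off from the parity description of the integers; it puts the trace of a matrix back
  into the ring.\<close>

lemma ring_of_integers_add:
  assumes D: "D > 0" "squarefree D"
    and "s \<in> ring_of_integers (imag_quadratic_field D)" "t \<in> ring_of_integers (imag_quadratic_field D)"
  shows "s + t \<in> ring_of_integers (imag_quadratic_field D)"
proof -
  obtain T V T' V' where st: "s = quad_int D T V" "4 dvd T\<^sup>2 + int D * V\<^sup>2"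
      "t = quad_int D T' V'" "4 dvd T'\<^sup>2 + int D * V'\<^sup>2"
    using assms unfolding ring_of_integers_imag_quadratic[OF D] by blast
  have "s + t = quad_int D (T + T') (V + V')"
    by (simp add: st quad_int_def field_simps)
  moreover have "4 dvd (T + T')\<^sup>2 + int D * (V + V')\<^sup>2"
    using st(2,4) unfolding four_dvd_norm_form_int[OF D(2)] by (auto split: if_splits)
  ultimately show ?thesis
    unfolding ring_of_integers_imag_quadratic[OF D] by blast
qed

text \<open>Factoring \<open>t^2 - 4\<close> into \<open>t - 2\<close> and \<open>t + 2\<close>, of
  squared moduli \<open>N + 4 - 2 * T\<close> and \<open>N + 4 + 2 * T\<close>, gives the
  radicand.\<close>

lemma trace_cosh_quad_int:
  fixes D :: nat and T V :: int
  defines "N \<equiv> of_int (T\<^sup>2 + int D * V\<^sup>2) / 4"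
  shows "trace_cosh (quad_int D T V) = (N + sqrt ((N + 4)\<^sup>2 - 4 * (of_int T)\<^sup>2)) / 2"
proof -
  define x where "x = real_of_int T / 2"
  define y where "y = real_of_int V / 2 * sqrt (real D)"
  define t where "t = quad_int D T V"
  have t: "t = Complex x y" by (simp add: t_def quad_int_def x_def y_def sqrt_neg_def complex_eq_iff)
  have N: "N = x\<^sup>2 + y\<^sup>2" by (simp add: N_def x_def y_def power_mult_distrib power_divide field_simps)
  have "norm (t\<^sup>2 - 4) = norm ((t - 2) * (t + 2))"
    by (simp add: power2_eq_square algebra_simps)
  hence "(norm (t\<^sup>2 - 4))\<^sup>2 = (norm (t - 2))\<^sup>2 * (norm (t + 2))\<^sup>2"
    by (simp add: norm_mult power_mult_distrib)
  also have "\<dots> = ((x - 2)\<^sup>2 + y\<^sup>2) * ((x + 2)\<^sup>2 + y\<^sup>2)"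
    unfolding cmod_power2 by (simp add: t)
  also have "\<dots> = (N + 4)\<^sup>2 - 4 * (2 * x)\<^sup>2"
    unfolding N by (simp add: power2_eq_square algebra_simps)
  finally have "norm (t\<^sup>2 - 4) = sqrt ((N + 4)\<^sup>2 - 4 * (2 * x)\<^sup>2)"
    by (metis norm_ge_zero real_sqrt_unique)
  moreover have "(norm t)\<^sup>2 = N" unfolding cmod_power2 N by (simp add: t)
  moreover have "2 * x = of_int T" by (simp add: x_def)
  ultimately show ?thesis unfolding trace_cosh_def t_def[symmetric] by simp
qed

lemma sqrt_trace_exp: "sqrt_trace (exp (2 * l)) = 2 * cosh l"
proof -
  have "sqrt (exp (2 * l)) = exp l"
    by (rule real_sqrt_unique) (simp_all flip: exp_of_nat_mult)
  thus ?thesis by (simp add: sqrt_trace_def cosh_def exp_minus field_simps)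
qed


text \<open>Translation length depends on the trace alone, and every integer \<open>t\<close> is the
  trace of the matrix with rows \<open>(t, -1)\<close> and \<open>(1, 0)\<close>. Counting group
  elements thus becomes counting integers of the field.\<close>

lemma generated_salem_numbers_PSL2:
  assumes D: "D > 0" "squarefree D"
  shows "x \<in> generated_salem_numbers (PSL2 (ring_of_integers (imag_quadratic_field D))) \<longleftrightarrow>
     x > 1 \<and> (\<exists>t \<in> ring_of_integers (imag_quadratic_field D). sqrt_trace x = trace_cosh t)"
    (is "_ \<in> generated_salem_numbers (PSL2 ?O) \<longleftrightarrow> _")
proof
  assume "x \<in> generated_salem_numbers (PSL2 ?O)"
  then obtain A where A: "A \<in> SL2 ?O" "x = exp (2 * translation_length (restrict (poincare_extension A) hyp3))"
      "translation_length (restrict (poincare_extension A) hyp3) > 0"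
    by (auto simp: generated_salem_numbers_def PSL2_def hyperbolic_def)
  have "det A = 1" using A(1) by (simp add: SL2_def)
  note tl = translation_length_SL2[OF this]
  have "sqrt_trace x = trace_cosh (trace A)"
    unfolding A(2) sqrt_trace_exp tl using trace_cosh_ge_2[of "trace A"] by simp
  moreover have "trace A \<in> ?O"
    using A(1) by (auto simp: SL2_def trace_def sum_2 intro: ring_of_integers_add[OF D])
  moreover have "x > 1" using A by simp
  ultimately show "x > 1 \<and> (\<exists>t\<in>?O. sqrt_trace x = trace_cosh t)" by blast
next
  assume "x > 1 \<and> (\<exists>t\<in>?O. sqrt_trace x = trace_cosh t)"
  then obtain t where x: "x > 1" and t: "t \<in> ?O" "sqrt_trace x = trace_cosh t" by blast
  define A :: "complex^2^2" where "A = (\<chi> i j. if i = 1 then (if j = 1 then t else -1) else (if j = 1 then 1 else 0))"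
  have A: "A$1$1 = t" "A$1$2 = -1" "A$2$1 = 1" "A$2$2 = 0"
    by (simp_all add: A_def)
  have det: "det A = 1" by (simp add: det_2 A)
  have tr: "trace A = t" by (simp add: trace_def sum_2 A)
  have int: "quad_int D (2 * k) 0 \<in> ?O" for k
    unfolding ring_of_integers_imag_quadratic[OF D]
    by (intro exI[of _ "2 * k"] exI[of _ 0]) (simp add: power_mult_distrib)
  have "0 \<in> ?O" "1 \<in> ?O" "-1 \<in> ?O"
    using int[of 0] int[of 1] int[of "-1"] by (simp_all add: quad_int_def)
  hence "A \<in> SL2 ?O"
    using t(1) by (simp add: SL2_def det forall_2 A)
  define l where "l = translation_length (restrict (poincare_extension A) hyp3)"
  have l: "l = arcosh (trace_cosh t / 2)"
    unfolding l_def translation_length_SL2[OF det] tr ..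
  have gt: "trace_cosh t > 2" using sqrt_trace_gt_2[OF x] t by simp
  hence "l > 0" unfolding l by simp
  moreover have "exp (2 * l) = x"
  proof (rule sqrt_trace_inj)
    show "exp (2 * l) > 1" using \<open>l > 0\<close> by simp
    show "sqrt_trace (exp (2 * l)) = sqrt_trace x"
      unfolding sqrt_trace_exp t(2) l using gt by simp
  qed (rule x)
  moreover have "restrict (poincare_extension A) hyp3 \<in> PSL2 ?O"
    using \<open>A \<in> SL2 ?O\<close> by (auto simp: PSL2_def)
  ultimately show "x \<in> generated_salem_numbers (PSL2 ?O)"
    unfolding generated_salem_numbers_def hyperbolic_def l_def by blast
qed

section \<open>Counting the Salem numbers of Bianchi orbifolds\<close>

definition ellipse_root :: "nat \<Rightarrow> nat \<times> nat \<Rightarrow> real" where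
  "ellipse_root D = (\<lambda>(V, T). trace_cosh (quad_int D (int T) (int V)))"

text \<open>Both numbers are roots of \<open>y^2 - N * y + (T^2 - 2 * N - 4)\<close>. For nonzero
  \<open>T\<close> and \<open>V\<close> one has \<open>0 < T^2 < 4 * N\<close>, which is equivalent
  to \<open>\<bar>N - 4\<bar> < w < N + 4\<close> for the root \<open>w\<close> of the
  discriminant.\<close>

lemma ellipse_root_props:
  fixes D V T :: nat
  assumes pos: "D > 0" "V > 0" "T > 0" and dvd: "4 dvd T\<^sup>2 + D * V\<^sup>2"
  obtains N :: nat and s' where
    "4 * N = T\<^sup>2 + D * V\<^sup>2" "N > 0" "ellipse_root D (V, T) + s' = real N"
    "ellipse_root D (V, T) * s' = (real T)\<^sup>2 - 2 * real N - 4"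
    "\<bar>s'\<bar> < 2" "ellipse_root D (V, T) > 2"
proof -
  obtain N where N: "T\<^sup>2 + D * V\<^sup>2 = 4 * N" using dvd by (rule dvdE)
  have N0: "N > 0" using N pos by (cases N) auto
  have "real (T\<^sup>2 + D * V\<^sup>2) = real (4 * N)" using N by (simp only:)
  hence NR: "(real T)\<^sup>2 + real D * (real V)\<^sup>2 = 4 * real N" by simp
  define s where "s = ellipse_root D (V, T)"
  define w where "w = sqrt ((real N + 4)\<^sup>2 - 4 * (real T)\<^sup>2)"
  have "real_of_int ((int T)\<^sup>2 + int D * (int V)\<^sup>2) / 4 = real N" using NR by simp
  hence s: "s = (real N + w) / 2"
    unfolding s_def ellipse_root_def prod.case trace_cosh_quad_int w_def by simp
  have T: "0 < (real T)\<^sup>2" "(real T)\<^sup>2 < 4 * real N"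
    unfolding NR[symmetric] using pos by simp_all
  have low: "(real N - 4)\<^sup>2 < (real N + 4)\<^sup>2 - 4 * (real T)\<^sup>2"
    using T by (simp add: power2_eq_square algebra_simps)
  hence wl: "\<bar>real N - 4\<bar> < w" unfolding w_def by (intro real_less_rsqrt) simp
  have w2: "w\<^sup>2 = (real N + 4)\<^sup>2 - 4 * (real T)\<^sup>2"
    unfolding w_def using low zero_le_power2[of "real N - 4"] by (intro real_sqrt_pow2) linarith
  hence "w\<^sup>2 < (real N + 4)\<^sup>2" using T by simp
  hence wu: "w < real N + 4" by (rule power2_less_imp_less) simp
  have "s * (real N - s) = ((real N)\<^sup>2 - w\<^sup>2) / 4"
    unfolding s by (simp add: power2_eq_square field_simps)
  also have "\<dots> = (real T)\<^sup>2 - 2 * real N - 4"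
    unfolding w2 by (simp add: power2_eq_square field_simps)
  finally have prod: "s * (real N - s) = (real T)\<^sup>2 - 2 * real N - 4" .
  have "\<bar>real N - s\<bar> < 2" "s > 2" unfolding s using wl wu by (auto simp: abs_less_iff field_simps)
  thus thesis using that[of N "real N - s"] N N0 prod unfolding s_def by simp
qed

text \<open>If \<open>T = 0\<close> or \<open>V = 0\<close>, the integer has trace \<open>0\<close> or is rational, and \<open>s\<close> is rational.\<close>

lemma trace_cosh_quad_int_degenerate:
  assumes "T = 0 \<or> V = 0"
  shows "trace_cosh (quad_int D T V) \<in> \<rat>"
proof -
  define N where "N = real_of_int (T\<^sup>2 + int D * V\<^sup>2) / 4"
  have N: "N \<in> \<rat>" "N \<ge> 0" by (auto simp: N_def)
  have "\<exists>r\<in>\<rat>. (N + 4)\<^sup>2 - 4 * (real_of_int T)\<^sup>2 = r\<^sup>2"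
  proof (cases "T = 0")
    case True
    thus ?thesis using N by (intro bexI[of _ "N + 4"]) auto
  next
    case False
    hence "(real_of_int T)\<^sup>2 = 4 * N" using assms by (simp add: N_def)
    hence "(N + 4)\<^sup>2 - 4 * (real_of_int T)\<^sup>2 = (N - 4)\<^sup>2"
      by (simp add: power2_eq_square algebra_simps)
    thus ?thesis using N by (intro bexI[of _ "N - 4"]) auto
  qed
  then obtain r where r: "r \<in> \<rat>" "(N + 4)\<^sup>2 - 4 * (real_of_int T)\<^sup>2 = r\<^sup>2" by blast
  have "trace_cosh (quad_int D T V) = (N + \<bar>r\<bar>) / 2"
    unfolding trace_cosh_quad_int N_def[symmetric] r(2) by simp
  moreover have "\<bar>r\<bar> \<in> \<rat>" using r(1) by (simp add: abs_if)
  hence "(N + \<bar>r\<bar>) / 2 \<in> \<rat>" using N by (intro Rats_divide Rats_add) auto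
  ultimately show ?thesis by (simp only:)
qed

definition degenerate_ellipse_points :: "nat \<Rightarrow> real \<Rightarrow> (nat \<times> nat) set" where
  "degenerate_ellipse_points D R = {z \<in> ellipse_points D R. ellipse_root D z \<in> \<rat>}"

lemma ellipse_root_le:
  assumes "D > 0" "(V, T) \<in> ellipse_points D R"
  shows "ellipse_root D (V, T) < R + 2"
proof -
  have z: "V > 0" "T > 0" "4 dvd T\<^sup>2 + D * V\<^sup>2" "real (T\<^sup>2 + D * V\<^sup>2) \<le> 4 * R"
    using assms(2) by (auto simp: ellipse_points_def)
  obtain N s' where N: "4 * N = T\<^sup>2 + D * V\<^sup>2" "ellipse_root D (V, T) + s' = real N" "\<bar>s'\<bar> < 2"
    using ellipse_root_props[OF assms(1) z(1-3)] by metis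
  have "real N \<le> R" using z(4) unfolding N(1)[symmetric] by simp
  thus ?thesis using N by linarith
qed

text \<open>Two quadratics sharing the irrational root \<open>s\<close> have the same
  \<open>N\<close>, hence the same second root. The product of the roots then gives
  \<open>T\<close>, and the norm gives \<open>V\<close>.\<close>

lemma ellipse_root_inj:
  assumes D: "D > 0" and z: "(V, T) \<in> ellipse_points D R" "(V', T') \<in> ellipse_points D R"
    and eq: "ellipse_root D (V, T) = ellipse_root D (V', T')" and irr: "ellipse_root D (V, T) \<notin> \<rat>"
  shows "(V, T) = (V', T')"
proof -
  define s where "s = ellipse_root D (V, T)"
  have z': "V > 0" "T > 0" "4 dvd T\<^sup>2 + D * V\<^sup>2" "V' > 0" "T' > 0" "4 dvd T'\<^sup>2 + D * V'\<^sup>2"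
    using z by (auto simp: ellipse_points_def)
  obtain N u where N: "4 * N = T\<^sup>2 + D * V\<^sup>2" "s + u = real N" "s * u = (real T)\<^sup>2 - 2 * real N - 4"
    using ellipse_root_props[OF D z'(1-3)] unfolding s_def by metis
  obtain N' u' where N': "4 * N' = T'\<^sup>2 + D * V'\<^sup>2" "s + u' = real N'" "s * u' = (real T')\<^sup>2 - 2 * real N' - 4"
    using ellipse_root_props[OF D z'(4-6)] unfolding s_def eq by metis
  have u: "u - u' = real N - real N'" using N N' by simp
  have "(real N - real N') * s = s * u - s * u'" unfolding u[symmetric] by (simp add: algebra_simps)
  also have "\<dots> \<in> \<rat>" unfolding N(3) N'(3) by auto
  finally have "real N - real N' = 0"
    using irr unfolding s_def[symmetric] by (intro rational_multiple_irrational[of s]) auto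
  hence NN: "N = N'" by simp
  hence "u = u'" using u by simp
  hence "(real T)\<^sup>2 - 2 * real N - 4 = (real T')\<^sup>2 - 2 * real N' - 4"
    using N(3) N'(3) by (simp only:)
  hence T: "T = T'" using NN by simp
  have "T'\<^sup>2 + D * V\<^sup>2 = T'\<^sup>2 + D * V'\<^sup>2"
    using N(1)[unfolded NN T] N'(1) by (rule trans[OF sym])
  hence "V = V'" using D by auto
  thus ?thesis using T by simp
qed

text \<open>In the degenerate case \<open>s\<close> and \<open>s'\<close> are integers with \<open>T\<^sup>2 = (s + 2) (s' + 2)\<close> and
  \<open>\<bar>s'\<bar> \<le> 1\<close>.\<close>

lemma card_degenerate_ellipse_points:
  assumes D: "D > 0" and R: "R \<ge> 0"
  shows "real (card (degenerate_ellipse_points D R)) \<le> 3 * (sqrt (3 * (R + 4)) + 1)"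
proof -
  define k where "k = nat \<lfloor>sqrt (3 * (R + 4))\<rfloor>"
  \<comment> \<open>The pairs \<open>(T, s')\<close>: the bound on \<open>T\<close> comes from
    \<open>s < R + 2\<close> and \<open>s' \<le> 1\<close>. As \<open>s' + 2\<close> is not 0, such
    a pair returns \<open>s\<close>, then the norm and \<open>V\<close>.\<close>
  define B where "B = {0..k} \<times> {-1, 0, 1 :: int}"
  define r where "r = (\<lambda>(V, T) (a, b). a = T \<and> 4 * (ellipse_root D (V, T) + of_int b) = real (T\<^sup>2 + D * V\<^sup>2) \<and>
     (real T)\<^sup>2 = (ellipse_root D (V, T) + 2) * (of_int b + 2) \<and> \<bar>b\<bar> \<le> 1)"
  have "card (degenerate_ellipse_points D R) \<le> card B"
  proof (rule inj_relation_finite_card)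
    show "finite B" by (simp add: B_def)
    fix z assume "z \<in> degenerate_ellipse_points D R"
    then obtain V T where z: "z = (V, T)" "(V, T) \<in> ellipse_points D R" "ellipse_root D (V, T) \<in> \<rat>"
      unfolding degenerate_ellipse_points_def by (cases z) blast
    have z': "V > 0" "T > 0" "4 dvd T\<^sup>2 + D * V\<^sup>2" using z(2) by (auto simp: ellipse_points_def)
    define s where "s = ellipse_root D (V, T)"
    obtain N s' where N: "4 * N = T\<^sup>2 + D * V\<^sup>2" "s + s' = real N"
        "s * s' = (real T)\<^sup>2 - 2 * real N - 4" "\<bar>s'\<bar> < 2" "s > 2"
      using ellipse_root_props[OF D z'] unfolding s_def by metis
    have "s \<in> \<int>"
    proof (rule rational_root_monic_quadratic_int)
      show "s \<in> \<rat>" using z(3) by (simp add: s_def)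
      show "s\<^sup>2 + - real N * s + ((real T)\<^sup>2 - 2 * real N - 4) = 0"
        unfolding N(2)[symmetric] N(3)[symmetric, unfolded N(2)[symmetric]]
        by (simp add: power2_eq_square algebra_simps)
    qed auto
    moreover have "s' = real N - s" using N by simp
    ultimately have "s' \<in> \<int>" by simp
    then obtain b where b: "s' = of_int b" by (auto elim: Ints_cases)
    have "b \<in> {-1, 0, 1}" using N(4) unfolding b by auto
    have T2: "(real T)\<^sup>2 = (s + 2) * (s' + 2)" using N(2,3) by (simp add: algebra_simps)
    also have "\<dots> \<le> (R + 4) * 3"
    proof (rule mult_mono)
      show "s + 2 \<le> R + 4" using ellipse_root_le[OF D z(2)] by (simp add: s_def)
      show "s' + 2 \<le> 3" using \<open>b \<in> {-1, 0, 1}\<close> unfolding b by auto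
    qed (use R N in auto)
    finally have "real T \<le> sqrt (3 * (R + 4))" by (intro real_le_rsqrt) (simp add: mult.commute)
    hence "T \<le> k" unfolding k_def by (simp add: le_nat_floor)
    moreover have "4 * (s + of_int b) = real (T\<^sup>2 + D * V\<^sup>2)"
      unfolding b[symmetric] N(1)[symmetric] using N(2) by simp
    ultimately have "(T, b) \<in> B \<and> r z (T, b)"
      using T2 \<open>b \<in> {-1, 0, 1}\<close> unfolding z(1) B_def r_def s_def b by auto
    thus "\<exists>b\<in>B. r z b" by blast
  next
    fix z z' b assume r: "r z b" "r z' b"
    obtain V T V' T' T0 b0 where z: "z = (V, T)" "z' = (V', T')" "b = (T0, b0)"
      by (cases z, cases z', cases b)
    have T: "T = T0" "T' = T0" using r by (auto simp: r_def z)
    have "(ellipse_root D (V, T) + 2) * (of_int b0 + 2) = (ellipse_root D (V', T') + 2) * (of_int b0 + 2)"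
      using r unfolding r_def z T by simp
    moreover have "of_int b0 + 2 \<noteq> (0::real)" using r by (simp add: r_def z) linarith
    ultimately have "ellipse_root D (V, T) = ellipse_root D (V', T')" by simp
    hence "real (T\<^sup>2 + D * V\<^sup>2) = real (T'\<^sup>2 + D * V'\<^sup>2)" using r unfolding r_def z by simp
    hence "T\<^sup>2 + D * V\<^sup>2 = T'\<^sup>2 + D * V'\<^sup>2" by (simp only: of_nat_eq_iff)
    hence "V = V'" using T D by simp
    thus "z = z'" using T by (simp add: z)
  qed
  also have "card B = 3 * (k + 1)" by (simp add: B_def card_cartesian_product)
  finally have "real (card (degenerate_ellipse_points D R)) \<le> real (3 * (k + 1))"
    by (simp only: of_nat_le_iff)
  hence "real (card (degenerate_ellipse_points D R)) \<le> 3 * (real k + 1)" by simp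
  moreover have "sqrt (3 * (R + 4)) \<ge> 0" using R by simp
  hence "real k \<le> sqrt (3 * (R + 4))" unfolding k_def by linarith
  ultimately show ?thesis by argo
qed

text \<open>The radii differ from \<open>sqrt Q\<close> because
  \<open>N = s + s' < (sqrt x + 1) + 2\<close> in one direction, and
  \<open>sqrt x < s < R + 2\<close> with \<open>R = sqrt Q - 2\<close> in the other.\<close>

lemma card_generated_square_rootable_salem4:
  fixes D :: nat and Q :: real
  assumes D: "D > 0" "squarefree D" and Q: "sqrt Q \<ge> 4"
  defines "S \<equiv> {x \<in> generated_salem_numbers (PSL2 (ring_of_integers (imag_quadratic_field D))).
                square_rootable_salem4 x \<and> x \<le> Q}"
  shows "card S \<le> card (ellipse_points D (sqrt Q + 3))"
    and "card (ellipse_points D (sqrt Q - 2)) \<le> card S + card (degenerate_ellipse_points D (sqrt Q - 2))"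
proof -
  have fin: "finite (ellipse_points D R)" if "R > 0" for R
    using card_ellipse_points_3[OF D(2,1) _ that] card_ellipse_points_12[OF D(2,1) _ that] by blast
  define r where "r = (\<lambda>x z. sqrt_trace x = ellipse_root D z)"
  have 1: "\<exists>z\<in>ellipse_points D (sqrt Q + 3). r x z" if "x \<in> S" for x
  proof -
    have x: "square_rootable_salem4 x" "x \<le> Q" "x > 1"
        "\<exists>t \<in> ring_of_integers (imag_quadratic_field D). sqrt_trace x = trace_cosh t"
      using that by (auto simp: S_def generated_salem_numbers_PSL2[OF D])
    from x(4) obtain t where t: "t \<in> ring_of_integers (imag_quadratic_field D)" "sqrt_trace x = trace_cosh t"
      by blast
    then obtain T V where TV: "sqrt_trace x = trace_cosh (quad_int D T V)" "4 dvd T\<^sup>2 + int D * V\<^sup>2"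
      unfolding ring_of_integers_imag_quadratic[OF D] by blast
    have "sqrt_trace x \<notin> \<rat>"
    proof
      assume "sqrt_trace x \<in> \<rat>"
      hence "(sqrt_trace x)\<^sup>2 \<in> \<rat>" by simp
      thus False using square_rootable_salem4_imp[OF x(1)] by metis
    qed
    hence nz: "T \<noteq> 0" "V \<noteq> 0" unfolding TV(1) using trace_cosh_quad_int_degenerate by blast+
    define z where "z = (nat \<bar>V\<bar>, nat \<bar>T\<bar>)"
    have rz: "sqrt_trace x = ellipse_root D z"
      unfolding TV(1) z_def ellipse_root_def prod.case trace_cosh_quad_int by simp
    have "int ((nat \<bar>T\<bar>)\<^sup>2 + D * (nat \<bar>V\<bar>)\<^sup>2) = T\<^sup>2 + int D * V\<^sup>2" by simp
    hence "int 4 dvd int ((nat \<bar>T\<bar>)\<^sup>2 + D * (nat \<bar>V\<bar>)\<^sup>2)" using TV(2) by simp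
    hence dvd: "4 dvd (nat \<bar>T\<bar>)\<^sup>2 + D * (nat \<bar>V\<bar>)\<^sup>2" by (simp only: int_dvd_int_iff)
    have pos: "nat \<bar>V\<bar> > 0" "nat \<bar>T\<bar> > 0" using nz by simp_all
    obtain N s' where N: "4 * N = (nat \<bar>T\<bar>)\<^sup>2 + D * (nat \<bar>V\<bar>)\<^sup>2" "sqrt_trace x + s' = real N" "\<bar>s'\<bar> < 2"
      using ellipse_root_props[OF D(1) pos dvd] unfolding rz z_def by metis
    have "sqrt_trace x < sqrt x + 1" using x(3) by (rule sqrt_trace_bounds)
    moreover have "sqrt x \<le> sqrt Q" using x(2) by simp
    ultimately have "real N \<le> sqrt Q + 3" using N(2,3) by linarith
    hence "real (4 * N) \<le> 4 * (sqrt Q + 3)" by simp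
    hence "z \<in> ellipse_points D (sqrt Q + 3)"
      using pos dvd unfolding N(1) by (simp add: ellipse_points_def z_def)
    thus ?thesis using rz unfolding r_def by blast
  qed
  have 2: "x = y" if "x \<in> S" "y \<in> S" "r x z" "r y z" for x y z
  proof (rule sqrt_trace_inj)
    show "x > 1" "y > 1"
      using that(1,2) by (auto simp: S_def square_rootable_salem4_def salem_number_def)
    show "sqrt_trace x = sqrt_trace y" using that(3,4) by (simp only: r_def)
  qed
  have finS: "finite S" and "card S \<le> card (ellipse_points D (sqrt Q + 3))"
    using inj_relation_finite_card[where r = r, OF fin[of "sqrt Q + 3"] 1 2] Q by auto
  thus "card S \<le> card (ellipse_points D (sqrt Q + 3))" by simp
  have 3: "\<exists>x\<in>S. r x z"
    if "z \<in> ellipse_points D (sqrt Q - 2) - degenerate_ellipse_points D (sqrt Q - 2)" for z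
  proof -
    obtain V T where z: "z = (V, T)" by (cases z)
    have zp: "(V, T) \<in> ellipse_points D (sqrt Q - 2)" and irr: "ellipse_root D (V, T) \<notin> \<rat>"
      using that by (auto simp: z degenerate_ellipse_points_def)
    have z': "V > 0" "T > 0" "4 dvd T\<^sup>2 + D * V\<^sup>2" using zp by (auto simp: ellipse_points_def)
    define s where "s = ellipse_root D (V, T)"
    obtain N s' where N: "4 * N = T\<^sup>2 + D * V\<^sup>2" "N > 0" "s + s' = real N"
        "s * s' = (real T)\<^sup>2 - 2 * real N - 4" "\<bar>s'\<bar> < 2" "s > 2"
      using ellipse_root_props[OF D(1) z'] unfolding s_def by metis
    from sqrt_trace_surj[OF N(6)] obtain x where x: "x > 1" "sqrt_trace x = s" by blast
    have "square_rootable_salem4 x"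
    \<comment> \<open>Here \<open>m = N^2\<close> is a perfect square. Since
      \<open>s^2 = N * s - s * s'\<close> with \<open>N > 0\<close>, irrationality of
      \<open>s\<close> carries over to \<open>s^2\<close>.\<close>
    proof (rule square_rootable_salem4I[OF x(1) N(5)])
      show "sqrt_trace x * s' = of_int ((int T)\<^sup>2 - 2 * int N - 4)" using N(4) by (simp add: x)
      show "(sqrt_trace x + s')\<^sup>2 = of_int ((int N)\<^sup>2)" using N(3) by (simp add: x)
      show "(sqrt_trace x)\<^sup>2 \<notin> \<rat>"
      proof
        assume "(sqrt_trace x)\<^sup>2 \<in> \<rat>"
        hence "s\<^sup>2 \<in> \<rat>" by (simp add: x)
        moreover have "real N * s = s\<^sup>2 + s * s'"
          unfolding N(3)[symmetric] by (simp add: power2_eq_square algebra_simps)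
        ultimately have "real N * s \<in> \<rat>" unfolding N(4) by auto
        hence "real N = 0" using irr unfolding s_def[symmetric]
          by (intro rational_multiple_irrational[of s]) auto
        thus False using N(2) by simp
      qed
    qed
    moreover have "sqrt x \<le> sqrt Q"
      using sqrt_trace_bounds(1)[OF x(1)] ellipse_root_le[OF D(1) zp] unfolding x(2) s_def by linarith
    hence "x \<le> Q" by simp
    moreover have "quad_int D (int T) (int V) \<in> ring_of_integers (imag_quadratic_field D)"
    proof -
      have "int 4 dvd int (T\<^sup>2 + D * V\<^sup>2)" using z'(3) by (simp only: int_dvd_int_iff)
      hence "4 dvd (int T)\<^sup>2 + int D * (int V)\<^sup>2" by simp
      thus ?thesis unfolding ring_of_integers_imag_quadratic[OF D] by blast
    qed
    hence "x \<in> generated_salem_numbers (PSL2 (ring_of_integers (imag_quadratic_field D)))"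
      unfolding generated_salem_numbers_PSL2[OF D] using x by (auto simp: s_def ellipse_root_def)
    ultimately have "x \<in> S" by (simp add: S_def)
    thus ?thesis using x unfolding r_def z s_def by blast
  qed
  have 4: "z = z'" if
    "z \<in> ellipse_points D (sqrt Q - 2) - degenerate_ellipse_points D (sqrt Q - 2)"
    "z' \<in> ellipse_points D (sqrt Q - 2) - degenerate_ellipse_points D (sqrt Q - 2)" "r x z" "r x z'" for z z' x
    using that ellipse_root_inj[OF D(1), of "fst z" "snd z" "sqrt Q - 2" "fst z'" "snd z'"]
    by (auto simp: r_def degenerate_ellipse_points_def)
  have "card (ellipse_points D (sqrt Q - 2) - degenerate_ellipse_points D (sqrt Q - 2)) \<le> card S"
    by (rule inj_relation_finite_card(2)[where r = "\<lambda>z x. r x z", OF finS 3 4])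
  moreover have "card (ellipse_points D (sqrt Q - 2)) - card (degenerate_ellipse_points D (sqrt Q - 2))
     \<le> card (ellipse_points D (sqrt Q - 2) - degenerate_ellipse_points D (sqrt Q - 2))"
    by (rule diff_card_le_card_Diff, rule finite_subset[OF _ fin[of "sqrt Q - 2"]])
       (use Q in \<open>auto simp: degenerate_ellipse_points_def\<close>)
  ultimately show "card (ellipse_points D (sqrt Q - 2)) \<le> card S + card (degenerate_ellipse_points D (sqrt Q - 2))"
    by linarith
qed

lemma generated_square_rootable_salem4_asymptotics:
  fixes D :: nat and Q :: real
  assumes D: "D > 0" "squarefree D" and Q: "sqrt Q \<ge> 4"
  defines "c \<equiv> if D mod 4 = 3 then pi / (2 * sqrt (real D)) else pi / (4 * sqrt (real D))"
  shows "\<bar>real (card {x \<in> generated_salem_numbers (PSL2 (ring_of_integers (imag_quadratic_field D))).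
                square_rootable_salem4 x \<and> x \<le> Q}) - c * sqrt Q\<bar> \<le> (3 * c + 20) * sqrt (sqrt Q)"
proof -
  define r where "r = sqrt Q"
  define n where "n = real (card {x \<in> generated_salem_numbers (PSL2 (ring_of_integers (imag_quadratic_field D))).
                square_rootable_salem4 x \<and> x \<le> Q})"
  have r: "r \<ge> 4" using Q by (simp add: r_def)
  define q where "q = sqrt r"
  have q: "q \<ge> 1" using r by (simp add: q_def)
  have c: "c \<ge> 0" by (simp add: c_def)
  have ell: "\<bar>real (card (ellipse_points D R)) - c * R\<bar> \<le> 4 * sqrt R" if "R > 0" for R
    using card_ellipse_points_3[OF D(2,1) _ that] card_ellipse_points_12[OF D(2,1) _ that]
    unfolding c_def by auto
  have "sqrt (r + 3) \<le> sqrt (4 * r)" "sqrt (r - 2) \<le> sqrt r" "sqrt (3 * (r - 2 + 4)) \<le> sqrt (9 * r)"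
    using r by simp_all
  moreover have "sqrt (4 * r) = 2 * q" "sqrt (9 * r) = 3 * q"
    by (simp_all add: q_def real_sqrt_mult)
  ultimately have sq: "sqrt (r + 3) \<le> 2 * q" "sqrt (r - 2) \<le> q" "sqrt (3 * (r - 2 + 4)) \<le> 3 * q"
    by (simp_all add: q_def)
  \<comment> \<open>The shifts of the radius by 3 and by -2 change the main term by
    \<open>3 * c\<close> and \<open>2 * c\<close>; as \<open>q \<ge> 1\<close>, both fit into the
    error term.\<close>
  have cq: "3 * c \<le> 3 * c * q" "2 * c \<le> 3 * c * q"
    using q c mult_left_mono[of 1 q "3 * c"] by simp_all
  have "n \<le> real (card (ellipse_points D (r + 3)))"
    unfolding n_def r_def using card_generated_square_rootable_salem4(1)[OF D Q] by simp
  also have "\<dots> \<le> c * (r + 3) + 4 * sqrt (r + 3)"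
    using ell[of "r + 3"] r by (simp add: abs_le_iff)
  also have "\<dots> \<le> c * r + 3 * c * q + 8 * q" using sq(1) cq(1) by (simp add: algebra_simps)
  finally have up: "n \<le> c * r + (3 * c * q + 20 * q)" using q by simp
  have "real (card (ellipse_points D (r - 2))) \<le> n + real (card (degenerate_ellipse_points D (r - 2)))"
    unfolding n_def r_def using card_generated_square_rootable_salem4(2)[OF D Q] by linarith
  moreover have "real (card (degenerate_ellipse_points D (r - 2))) \<le> 3 * (3 * q + 1)"
    using card_degenerate_ellipse_points[OF D(1), of "r - 2"] sq(3) r by simp
  moreover have "c * (r - 2) - 4 * sqrt (r - 2) \<le> real (card (ellipse_points D (r - 2)))"
    using ell[of "r - 2"] r by (simp add: abs_le_iff)
  moreover have "c * (r - 2) = c * r - 2 * c" by (simp add: algebra_simps)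
  ultimately have "c * r - (3 * c * q + 20 * q) \<le> n" using sq(2) cq(2) q by argo
  with up have "\<bar>n - c * r\<bar> \<le> 3 * c * q + 20 * q" by (simp add: abs_le_iff)
  thus ?thesis unfolding n_def r_def q_def by (simp add: algebra_simps)
qed

section \<open>The two asymptotic formulas\<close>

theorem theorem1:
  shows
    "(\<forall>D::nat. D > 0 \<and> squarefree D \<longrightarrow>
        (\<lambda>Q::real.
           real (card {x \<in> generated_salem_numbers (PSL2 (ring_of_integers (imag_quadratic_field D))).
                         salem_number x \<and> algebraic_degree x = 4 \<and> square_rootable \<rat> x \<and> x \<le> Q})
           - (if D mod 4 = 3 then pi / (2 * sqrt (real D)) else pi / (4 * sqrt (real D))) * Q powr (1/2))
        \<in> O[at_top](\<lambda>Q. Q powr (1/4))) \<and>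
     (\<lambda>Q::real.
        real (card {x. salem_number x \<and> algebraic_degree x = 4 \<and> square_rootable \<rat> x \<and> x \<le> Q})
        - 4/3 * Q powr (3/2))
     \<in> O[at_top](\<lambda>Q. Q)"
proof (intro conjI allI impI)
  fix D :: nat assume D: "D > 0 \<and> squarefree D"
  define c where "c = (if D mod 4 = 3 then pi / (2 * sqrt (real D)) else pi / (4 * sqrt (real D)))"
  have bound: "norm (real (card {x \<in> generated_salem_numbers (PSL2 (ring_of_integers (imag_quadratic_field D))).
                         salem_number x \<and> algebraic_degree x = 4 \<and> square_rootable \<rat> x \<and> x \<le> Q}) - c * Q powr (1/2))
      \<le> (3 * c + 20) * norm (Q powr (1/4))" if "Q \<ge> 16" for Q
  proof -
    have "sqrt Q \<ge> sqrt 16" using that by (intro real_sqrt_le_mono)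
    hence Q: "sqrt Q \<ge> 4" by simp
    have "Q powr (1/2) = sqrt Q" using that by (simp add: powr_half_sqrt)
    moreover have "Q powr (1/4) = sqrt (sqrt Q)"
    proof -
      have "sqrt (sqrt Q) = (Q powr (1/2)) powr (1/2)" using that by (simp add: powr_half_sqrt)
      thus ?thesis unfolding powr_powr by simp
    qed
    moreover have "sqrt (sqrt Q) \<ge> 0" using that by (intro real_sqrt_ge_zero) simp
    ultimately show ?thesis
      using generated_square_rootable_salem4_asymptotics[of D Q] D Q
      by (simp only: square_rootable_salem4_def c_def real_norm_def abs_of_nonneg conj_assoc simp_thms)
  qed
  show "(\<lambda>Q. real (card {x \<in> generated_salem_numbers (PSL2 (ring_of_integers (imag_quadratic_field D))).
                         salem_number x \<and> algebraic_degree x = 4 \<and> square_rootable \<rat> x \<and> x \<le> Q})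
           - (if D mod 4 = 3 then pi / (2 * sqrt (real D)) else pi / (4 * sqrt (real D))) * Q powr (1/2))
        \<in> O[at_top](\<lambda>Q. Q powr (1/4))"
    unfolding c_def[symmetric]
    by (rule bigoI[of _ "3 * c + 20"]) (rule eventually_mono[OF eventually_ge_at_top[of 16] bound])
next
  have bound: "norm (real (card {x. salem_number x \<and> algebraic_degree x = 4 \<and> square_rootable \<rat> x \<and> x \<le> Q})
        - 4/3 * Q powr (3/2)) \<le> 250 * norm Q" if "Q \<ge> 1" for Q
  proof -
    have "Q powr (3/2) = (Q powr (1/2)) powr (real 3)" unfolding powr_powr by simp
    also have "\<dots> = sqrt Q ^ 3"
      using that by (subst powr_realpow) (simp_all add: powr_half_sqrt)
    finally show ?thesis
      using square_rootable_salem4_asymptotics[OF that] that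
      by (simp only: square_rootable_salem4_def real_norm_def abs_of_nonneg[OF order_trans[OF zero_le_one that]] conj_assoc)
  qed
  show "(\<lambda>Q. real (card {x. salem_number x \<and> algebraic_degree x = 4 \<and> square_rootable \<rat> x \<and> x \<le> Q})
        - 4/3 * Q powr (3/2)) \<in> O[at_top](\<lambda>Q. Q)"
    by (rule bigoI[of _ 250]) (rule eventually_mono[OF eventually_ge_at_top[of 1] bound])
qed

end
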